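(* Let $f:\mathbb{R}\to\mathbb{R}$ be a non-constant polynomial (independent of $N$), and let $(\lambda_1,\dots,\lambda_N)$ be distributed according to the probability measure $\mathbb{P}^N_{x^2,2}$ on $\mathbb{R}^N$ with density proportional to $\prod_{i<j}|\lambda_i-\lambda_j|^2\exp\big(-2N\sum_{j=1}^N\lambda_j^2\big)$. Let $\nu_N=\sum_{j=1}^N\delta_{\lambda_j}-N\mu_{\mathrm{sc}}$. Then there is a constant $C_f$ such that for all $N\ge1$ $$\mathrm W_2\Big(\frac{1}{\sqrt{\boldsymbol\Sigma(f)}}\int_{\mathbb{R}}f\,d\nu_N,\ \gamma_1\Big)\le\frac{C_f}{N}.$$ Moreover, if $f(x)=x^2$, the result is sharp: there are constants $0<c\le C$ such that for all $N\ge1$ $$\frac cN\le\mathrm W_2\Big(\frac{1}{\sqrt{\boldsymbol\Sigma(f)}}\int_{\mathbb{R}}x^2\,\nu_N(dx),\ \gamma_1\Big)\le\frac CN.$$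
   Context: $\mu_{\mathrm{sc}}(dx)=\frac2\pi\sqrt{1-x^2}\,\mathbf 1_{(-1,1)}(x)dx$ (the equilibrium measure of the potential $V(x)=x^2$); $\varrho(dx)=\frac{\mathbf 1_{(-1,1)}(x)}{\pi\sqrt{1-x^2}}dx$; $$\boldsymbol\Sigma(f)=\frac14\iint_{(-1,1)^2}\Big(\frac{f(x)-f(y)}{x-y}\Big)^2(1-xy)\,\varrho(dx)\varrho(dy).$$ $\mathrm W_2(X,\nu)$ denotes the quadratic Kantorovich (Wasserstein-2) distance between the law of $X$ and $\nu$; $\gamma_1$ is the standard Gaussian measure on $\mathbb{R}$. *)

theory Defs
  imports "HOL-Probability.Probability" "HOL-Computational_Algebra.Polynomial"
begin

definition couplings :: "'a measure \<Rightarrow> 'b measure \<Rightarrow> ('a \<times> 'b) measure set" where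
  "couplings \<mu> \<nu> =
    {\<pi>. sets \<pi> = sets (\<mu> \<Otimes>\<^sub>M \<nu>) \<and> distr \<pi> \<mu> fst = \<mu> \<and> distr \<pi> \<nu> snd = \<nu>}"

definition ennreal_sqrt :: "ennreal \<Rightarrow> ennreal" where
  "ennreal_sqrt x = (if x = \<top> then \<top> else ennreal (sqrt (enn2real x)))"

text \<open>The quadratic Kantorovich distance takes values in \<^typ>\<open>ennreal\<close>, so that a measure
  without second moment is not silently assigned a finite distance.\<close>

definition W2 :: "real measure \<Rightarrow> real measure \<Rightarrow> ennreal" where
  "W2 \<mu> \<nu> = ennreal_sqrt (INF \<pi>\<in>couplings \<mu> \<nu>. \<integral>\<^sup>+(x, y). ennreal ((x - y)\<^sup>2) \<partial>\<pi>)"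

definition std_gaussian :: "real measure" where
  "std_gaussian = density lborel (\<lambda>x. ennreal (std_normal_density x))"

definition mu_sc :: "real measure" where
  "mu_sc = density lborel (\<lambda>x. ennreal (2 / pi * sqrt (1 - x\<^sup>2) * indicator {-1<..<1} x))"

definition arcsine_measure :: "real measure" where
  "arcsine_measure = density lborel (\<lambda>x. ennreal (indicator {-1<..<1} x / (pi * sqrt (1 - x\<^sup>2))))"

text \<open>On the diagonal the difference quotient is \<open>0 / 0 = 0\<close>; the diagonal is a null set.\<close>

definition Sigma_functional :: "(real \<Rightarrow> real) \<Rightarrow> real" where
  "Sigma_functional f = 1 / 4 *
    (LINT p:{-1<..<1} \<times> {-1<..<1}|(arcsine_measure \<Otimes>\<^sub>M arcsine_measure).
      ((f (fst p) - f (snd p)) / (fst p - snd p))\<^sup>2 * (1 - fst p * snd p))"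

text \<open>A point of \<open>\<real>\<^sup>N\<close> is a function on the index set \<open>{1..N}\<close>, extended by
  \<^const>\<open>undefined\<close>, with Lebesgue measure \<open>\<Pi>\<^sub>M j\<in>{1..N}. lborel\<close>.\<close>

definition gue_weight :: "nat \<Rightarrow> (nat \<Rightarrow> real) \<Rightarrow> real" where
  "gue_weight N l =
    (\<Prod>j\<in>{1..N}. \<Prod>i\<in>{1..<j}. \<bar>l i - l j\<bar>\<^sup>2) * exp (- 2 * real N * (\<Sum>j=1..N. (l j)\<^sup>2))"

definition gue_normalization :: "nat \<Rightarrow> ennreal" where
  "gue_normalization N = (\<integral>\<^sup>+l. ennreal (gue_weight N l) \<partial>(\<Pi>\<^sub>M j\<in>{1..N}. lborel))"

definition gue_eigenvalues :: "nat \<Rightarrow> (nat \<Rightarrow> real) measure" where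
  "gue_eigenvalues N = density (\<Pi>\<^sub>M j\<in>{1..N}. lborel)
    (\<lambda>l. ennreal (gue_weight N l) / gue_normalization N)"

text \<open>The integral of \<open>f\<close> against the signed measure \<open>\<nu>\<^sub>N = (\<Sum>j. \<delta>(l j)) - N \<mu>\<^sub>s\<^sub>c\<close>.\<close>

definition nu_integral :: "nat \<Rightarrow> (real \<Rightarrow> real) \<Rightarrow> (nat \<Rightarrow> real) \<Rightarrow> real" where
  "nu_integral N f l = (\<Sum>j=1..N. f (l j)) - real N * (LINT x|mu_sc. f x)"

definition normalized_law :: "nat \<Rightarrow> (real \<Rightarrow> real) \<Rightarrow> real measure" where
  "normalized_law N f =
    distr (gue_eigenvalues N) borel (\<lambda>l. 1 / sqrt (Sigma_functional f) * nu_integral N f l)"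

end

theory Submission
  imports Defs "HOL-Computational_Algebra.Formal_Power_Series"
begin

text \<open>
  The Kantorovich distance to the Gaussian is controlled by Stein's method. If \<open>X\<close> satisfies
  \<open>E[(X - m) \<phi>(X)] = E[\<tau> \<phi>'(X)]\<close> for all \<open>\<phi>\<close> with bounded continuous derivative, then
  \<open>W\<^sub>2(X, \<gamma>\<^sub>1)\<^sup>2 \<le> 3 (E(\<tau> - 1)\<^sup>2 + m\<^sup>2)\<close> (\<open>W2_le_stein_discrepancy\<close>). The reason, for \<open>m = 0\<close> and a law with
  a positive density, lies in the monotone coupling \<open>Z = Q(X)\<close>. Its cross term \<open>E[X Z]\<close> can be
  estimated from below both by the Stein identity of \<open>X\<close>, applied to \<open>Q\<close>, and by that of \<open>Z\<close>, applied to
  the inverse of \<open>Q\<close>; then \<open>E(X - Z)\<^sup>2\<close> is at most the mean of an expression in \<open>\<tau>\<close> and \<open>Q'\<close> that is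
  pointwise bounded by \<open>(\<tau> - 1)\<^sup>2\<close> (\<open>monotone_coupling_bound\<close>). Other laws are smoothed.

  The Stein identity comes from integrating by parts against the density. Write \<open>\<nu>\<^sub>k\<close> for the centred
  power sum \<open>\<Sum>\<^sub>j \<lambda>\<^sub>j\<^sup>k - N s\<^sub>k\<close>, where \<open>s\<^sub>k\<close> is the \<open>k\<close>-th semicircle moment. Testing with the vector field
  \<open>\<lambda>\<^sub>j\<^sup>k\<close> gives the loop equation (\<open>loop_equation\<close>)
  \<open>E[(4 \<nu>\<^sub>k\<^sub>+\<^sub>1 - 2 \<Sum>\<^sub>a s\<^sub>a \<nu>\<^sub>k\<^sub>-\<^sub>1\<^sub>-\<^sub>a - (1/N) \<Sum>\<^sub>a \<nu>\<^sub>a \<nu>\<^sub>k\<^sub>-\<^sub>1\<^sub>-\<^sub>a) \<Psi>] = (1/N) E[\<Sum>\<^sub>j \<lambda>\<^sub>j\<^sup>k \<partial>\<^sub>j \<Psi>]\<close>.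
  For the square of the Vandermonde product the diagonal terms cancel exactly, which leaves no
  correction of order \<open>N\<close>. Now let \<open>\<Psi>\<close> be a product of a monomial in the \<open>\<nu>\<^sub>k\<close> and a test function. If the
  derivative falls on the test function, the term is \<open>1 / N\<close> times a divergence; all other terms
  except the first have lower degree. So induction on the degree expresses each polynomial in the \<open>\<nu>\<^sub>k\<close>,
  with coefficients bounded in \<open>N\<close>, as its mean plus \<open>1 / N\<close> times the divergence of a vector field of
  the same kind (\<open>admissible_stein_rep\<close>), and it shows that these means are bounded uniformly in \<open>N\<close>
  (\<open>admissible_moment_bounded\<close>).

  For a linear statistic \<open>\<nu>(f)\<close> the leading vector field is explicit. The linear part of the loop
  equation is inverted by \<open>H f (x) = \<integral> (f x - f y) / (x - y) \<rho>(dy)\<close> (\<open>drift_inversion\<close>), which maps the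
  Chebyshev polynomial \<open>T\<^sub>k\<close> to \<open>U\<^sub>k\<^sub>-\<^sub>1\<close>, and \<open>\<Sigma>(f) = (1/4) \<integral> f' H f d\<mu>\<^sub>s\<^sub>c\<close>
  (\<open>Sigma_functional_poly\<close>). Hence \<open>\<tau> - 1\<close> and \<open>m\<close> are \<open>1 / N\<close> times quantities with bounded moments,
  which is the upper bound (\<open>normalized_law_W2_upper\<close>).

  For \<open>f x = x\<^sup>2\<close> the loop equation with \<open>k = 1\<close> involves \<open>\<nu>\<^sub>2\<close> only and yields its moments. The
  normalised statistic has third moment \<open>\<surd>8 / N\<close> and bounded fourth moment, while the Gaussian has third
  moment \<open>0\<close>; Young's inequality turns this into the lower bound (\<open>W2_third_moment_lower\<close>).
\<close>

section \<open>Integration by parts on the line\<close>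

text \<open>The \<open>n\<close>-th term of the exponential series bounds \<open>(1 + \<bar>x\<bar>) ^ n\<close>, and completing the square
  bounds \<open>1 + \<bar>x\<bar>\<close> by \<open>c * x\<^sup>2\<close> plus a constant.\<close>

lemma power_le_exp_square:
  fixes c :: real
  assumes c: "c > 0"
  shows "\<exists>B>0. \<forall>x. (1 + \<bar>x\<bar>) ^ n \<le> B * exp (c * x\<^sup>2)"
proof (intro exI conjI allI)
  define K where "K = 1 + 1 / (4 * c)"
  show "fact n * exp K > 0" by simp
  fix x :: real
  have "(1 + \<bar>x\<bar>) ^ n / fact n \<le> exp (1 + \<bar>x\<bar>)"
  proof -
    have "(1 + \<bar>x\<bar>) ^ n / fact n = (\<Sum>k\<in>{n}. (1 + \<bar>x\<bar>) ^ k / fact k)" by simp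
    also have "\<dots> \<le> (\<Sum>k. (1 + \<bar>x\<bar>) ^ k / fact k)"
      using summable_exp[of "1 + \<bar>x\<bar>"]
      by (intro sum_le_suminf) (auto simp: field_simps)
    also have "\<dots> = exp (1 + \<bar>x\<bar>)" by (simp add: exp_def field_simps)
    finally show ?thesis .
  qed
  also have "1 + \<bar>x\<bar> \<le> K + c * x\<^sup>2"
  proof -
    have "0 \<le> (2 * c * \<bar>x\<bar> - 1)\<^sup>2 / (4 * c)" using c by simp
    also have "\<dots> = c * x\<^sup>2 - \<bar>x\<bar> + 1 / (4 * c)"
      using c by (simp add: power2_eq_square field_simps)
    finally show ?thesis by (simp add: K_def)
  qed
  finally have "(1 + \<bar>x\<bar>) ^ n / fact n \<le> exp (K + c * x\<^sup>2)" by simp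
  then show "(1 + \<bar>x\<bar>) ^ n \<le> fact n * exp K * exp (c * x\<^sup>2)"
    by (simp add: exp_add field_simps)
qed

lemma exp_minus_square_lborel:
  fixes c :: real
  assumes c: "c > 0"
  shows "integrable lborel (\<lambda>x. exp (- c * x\<^sup>2))"
proof -
  define s where "s = sqrt (1 / (2 * c))"
  have s: "s > 0" "s\<^sup>2 = 1 / (2 * c)" using c by (simp_all add: s_def)
  have e: "exp (- c * x\<^sup>2) = sqrt (2 * pi * s\<^sup>2) * normal_density 0 s x" for x
    using c s by (simp add: normal_density_def)
  show ?thesis unfolding e using s by simp
qed

lemma power_exp_minus_square_le:
  fixes c :: real
  assumes c: "c > 0"
  shows "\<exists>B>0. \<forall>x. (1 + \<bar>x\<bar>) ^ n * exp (- c * x\<^sup>2) \<le> B * exp (- (c / 2) * x\<^sup>2)"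
proof -
  obtain B where B: "B > 0" "\<And>x. (1 + \<bar>x\<bar>) ^ n \<le> B * exp (c / 2 * x\<^sup>2)"
    using power_le_exp_square[of "c / 2" n] c by auto
  have "(1 + \<bar>x\<bar>) ^ n * exp (- c * x\<^sup>2) \<le> B * exp (- (c / 2) * x\<^sup>2)" for x
  proof -
    have "(1 + \<bar>x\<bar>) ^ n * exp (- c * x\<^sup>2) \<le> (B * exp (c / 2 * x\<^sup>2)) * exp (- c * x\<^sup>2)"
      using B by (intro mult_right_mono) auto
    also have "\<dots> = B * exp (- (c / 2) * x\<^sup>2)"
      by (simp add: mult.assoc flip: exp_add)
    finally show ?thesis .
  qed
  with B(1) show ?thesis by blast
qed

lemma power_exp_minus_square_integrable:
  fixes c :: real
  assumes c: "c > 0"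
  shows "integrable lborel (\<lambda>x. (1 + \<bar>x\<bar>) ^ n * exp (- c * x\<^sup>2))"
proof -
  obtain B where B: "\<And>x. (1 + \<bar>x\<bar>) ^ n * exp (- c * x\<^sup>2) \<le> B * exp (- (c / 2) * x\<^sup>2)" "B > 0"
    using power_exp_minus_square_le[OF c, of n] by blast
  show ?thesis
  proof (rule Bochner_Integration.integrable_bound)
    show "integrable lborel (\<lambda>x. B * exp (- (c / 2) * x\<^sup>2))"
      using exp_minus_square_lborel[of "c / 2"] c by simp
    show "AE x in lborel. norm ((1 + \<bar>x\<bar>) ^ n * exp (- c * x\<^sup>2)) \<le> norm (B * exp (- (c / 2) * x\<^sup>2))"
      using B by (intro AE_I2) (auto simp: abs_mult)
  qed simp
qed

lemma filterlim_exp_minus_square: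
  fixes c :: real
  assumes c: "c > 0"
  shows "((\<lambda>x. exp (- c * x\<^sup>2)) \<longlongrightarrow> 0) at_infinity"
proof -
  have "filterlim (\<lambda>x::real. (norm x)\<^sup>2) at_top at_infinity"
    by (intro filterlim_pow_at_top filterlim_norm_at_top) auto
  then have "filterlim (\<lambda>x::real. c * (norm x)\<^sup>2) at_top at_infinity"
    by (rule filterlim_tendsto_pos_mult_at_top[OF tendsto_const c])
  then have "filterlim (\<lambda>x::real. - (c * (norm x)\<^sup>2)) at_bot at_infinity"
    by (simp add: filterlim_uminus_at_bot)
  from filterlim_compose[OF exp_at_bot this] show ?thesis by simp
qed

lemma power_exp_minus_square_tendsto_0:
  fixes c :: real
  assumes c: "c > 0"
  shows "((\<lambda>x. (1 + \<bar>x\<bar>) ^ n * exp (- c * x\<^sup>2)) \<longlongrightarrow> 0) at_infinity"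
proof -
  obtain B where B: "\<And>x. (1 + \<bar>x\<bar>) ^ n * exp (- c * x\<^sup>2) \<le> B * exp (- (c / 2) * x\<^sup>2)"
    using power_exp_minus_square_le[OF c, of n] by blast
  have "((\<lambda>x. B * exp (- (c / 2) * x\<^sup>2)) \<longlongrightarrow> B * 0) at_infinity"
    using c by (intro tendsto_mult tendsto_const filterlim_exp_minus_square) auto
  then have *: "((\<lambda>x. B * exp (- (c / 2) * x\<^sup>2)) \<longlongrightarrow> 0) at_infinity" by simp
  show ?thesis
    by (intro tendsto_sandwich[OF _ _ tendsto_const *] always_eventually) (use B in auto)
qed

text \<open>The fundamental theorem of calculus on the whole line. Both the Gaussian integration by parts
  and the one behind the loop equations reduce to it.\<close>

lemma integral_derivative_eq_0:
  fixes H h :: "real \<Rightarrow> real"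
  assumes "\<And>x. (H has_real_derivative h x) (at x)" and "continuous_on UNIV h"
    and "integrable lborel h" and "(H \<longlongrightarrow> 0) at_infinity"
  shows "integral\<^sup>L lborel h = 0"
proof -
  have top: "(H \<longlongrightarrow> 0) at_top" and bot: "(H \<longlongrightarrow> 0) at_bot"
    using filterlim_mono[OF assms(4) order_refl at_top_le_at_infinity]
      filterlim_mono[OF assms(4) order_refl at_bot_le_at_infinity] by auto
  have "interval_lebesgue_integral lborel (-\<infinity>) \<infinity> h = 0 - 0"
  proof (rule interval_integral_FTC_integrable)
    show "((H \<circ> real_of_ereal) \<longlongrightarrow> 0) (at_right (- \<infinity>))"
      using bot by (simp add: at_right_MInf filterlim_filtermap o_def)
    show "((H \<circ> real_of_ereal) \<longlongrightarrow> 0) (at_left \<infinity>)"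
      using top by (simp add: at_left_PInf filterlim_filtermap o_def)
    show "set_integrable lborel (einterval (- \<infinity>) \<infinity>) h"
      using assms(3) by (simp add: set_integrable_def)
  qed (use assms in \<open>auto simp: has_real_derivative_iff_has_vector_derivative continuous_on_eq_continuous_at\<close>)
  then show ?thesis
    by (simp add: interval_lebesgue_integral_def set_lebesgue_integral_def)
qed

lemma sets_std_gaussian [simp, measurable_cong]: "sets std_gaussian = sets borel"
  and space_std_gaussian [simp]: "space std_gaussian = UNIV"
  by (simp_all add: std_gaussian_def)

lemma prob_space_std_gaussian: "prob_space std_gaussian"
  unfolding std_gaussian_def by (rule prob_space_normal_density) simp

lemma integral_std_gaussian:
  fixes f :: "real \<Rightarrow> real"
  assumes [measurable]: "f \<in> borel_measurable borel"
  shows "integral\<^sup>L std_gaussian f = (\<integral>x. std_normal_density x * f x \<partial>lborel)"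
  and "integrable std_gaussian f \<longleftrightarrow> integrable lborel (\<lambda>x. std_normal_density x * f x)"
  unfolding std_gaussian_def by (simp_all add: integral_density integrable_density)

lemma std_gaussian_moment_integrable [simp]: "integrable std_gaussian (\<lambda>x. x ^ k)"
  by (simp add: integral_std_gaussian integrable_std_normal_moment)

lemma std_gaussian_moments:
  "(\<integral>x. x \<partial>std_gaussian) = 0" "(\<integral>x. x\<^sup>2 \<partial>std_gaussian) = 1"
  "(\<integral>x. x ^ 3 \<partial>std_gaussian) = 0" "(\<integral>x. x ^ 4 \<partial>std_gaussian) = 3"
  using integral_std_normal_moment_odd[of 0] integral_std_normal_moment_even[of 1]
    integral_std_normal_moment_odd[of 1] integral_std_normal_moment_even[of 2]
  by (simp_all add: integral_std_gaussian fact_numeral)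

lemma bounded_deriv_linear_growth:
  fixes \<phi> :: "real \<Rightarrow> real"
  assumes "\<And>x. (\<phi> has_real_derivative \<phi>' x) (at x)" "\<And>x. \<bar>\<phi>' x\<bar> \<le> K"
  shows "\<bar>\<phi> x\<bar> \<le> \<bar>\<phi> 0\<bar> + K * \<bar>x\<bar>"
proof -
  have "norm (\<phi> x - \<phi> 0) \<le> K * norm (x - 0)"
    by (rule field_differentiable_bound[where S = UNIV and f' = \<phi>']) (use assms in auto)
  then show ?thesis by (simp add: algebra_simps)
qed

lemma bounded_deriv_continuous:
  fixes \<phi> :: "real \<Rightarrow> real"
  assumes "\<And>x. (\<phi> has_real_derivative \<phi>' x) (at x)"
  shows "continuous_on UNIV \<phi>"
  using assms by (auto intro!: continuous_at_imp_continuous_on DERIV_isCont)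

lemma continuous_antiderivative:
  fixes f :: "real \<Rightarrow> real"
  assumes "continuous_on UNIV f"
  obtains F where "\<And>x. (F has_real_derivative f x) (at x)"
proof -
  have "\<exists>F. \<forall>x. (- \<infinity>) < ereal x \<longrightarrow> ereal x < \<infinity> \<longrightarrow> (F has_vector_derivative f x) (at x)"
    by (rule einterval_antiderivative) (use assms in \<open>auto simp: continuous_on_eq_continuous_at\<close>)
  then show ?thesis using that
    by (auto simp: has_real_derivative_iff_has_vector_derivative)
qed

lemma (in prob_space) square_integrable_lipschitz:
  assumes [measurable]: "Y \<in> borel_measurable M" and Y2: "integrable M (\<lambda>w. (Y w)\<^sup>2)"
    and d: "\<And>x. (\<phi> has_real_derivative \<phi>' x) (at x)" and K: "\<And>x. \<bar>\<phi>' x\<bar> \<le> K"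
  shows "integrable M (\<lambda>w. (\<phi> (Y w :: real))\<^sup>2)"
proof -
  have [measurable]: "\<phi> \<in> borel_measurable borel"
    using bounded_deriv_continuous[OF d] by (auto intro: borel_measurable_continuous_onI)
  have gr: "\<bar>\<phi> x\<bar> \<le> \<bar>\<phi> 0\<bar> + K * \<bar>x\<bar>" for x
    by (rule bounded_deriv_linear_growth[OF d K])
  show ?thesis
  proof (rule Bochner_Integration.integrable_bound)
    show "integrable M (\<lambda>w. 2 * \<bar>\<phi> 0\<bar>\<^sup>2 + 2 * K\<^sup>2 * (Y w)\<^sup>2)" using Y2 by simp
    have "(\<phi> x)\<^sup>2 \<le> 2 * \<bar>\<phi> 0\<bar>\<^sup>2 + 2 * K\<^sup>2 * x\<^sup>2" for x
    proof -
      have "\<bar>\<phi> x\<bar>\<^sup>2 \<le> (\<bar>\<phi> 0\<bar> + K * \<bar>x\<bar>)\<^sup>2" using gr by (intro power_mono) auto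
      also have "\<dots> \<le> 2 * \<bar>\<phi> 0\<bar>\<^sup>2 + 2 * (K * \<bar>x\<bar>)\<^sup>2"
        using sum_squares_bound[of "\<bar>\<phi> 0\<bar>" "K * \<bar>x\<bar>"] by (simp add: power2_sum)
      finally show ?thesis by (simp add: power_mult_distrib)
    qed
    then show "AE w in M. norm ((\<phi> (Y w))\<^sup>2) \<le> norm (2 * \<bar>\<phi> 0\<bar>\<^sup>2 + 2 * K\<^sup>2 * (Y w)\<^sup>2)"
      by (intro AE_I2) simp
  qed simp
qed

lemma integrable_mult_L2:
  fixes f g :: "'a \<Rightarrow> real"
  assumes [measurable]: "f \<in> borel_measurable M" "g \<in> borel_measurable M"
    and "integrable M (\<lambda>x. (f x)\<^sup>2)" "integrable M (\<lambda>x. (g x)\<^sup>2)"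
  shows "integrable M (\<lambda>x. f x * g x)"
proof (rule Bochner_Integration.integrable_bound)
  show "integrable M (\<lambda>x. (f x)\<^sup>2 + (g x)\<^sup>2)" using assms by simp
  have "\<bar>a * b\<bar> \<le> a\<^sup>2 + b\<^sup>2" for a b :: real
  proof -
    have "0 \<le> (\<bar>a\<bar> - \<bar>b\<bar>)\<^sup>2" by simp
    then have "2 * (\<bar>a\<bar> * \<bar>b\<bar>) \<le> a\<^sup>2 + b\<^sup>2" by (simp add: power2_eq_square algebra_simps)
    moreover have "0 \<le> \<bar>a\<bar> * \<bar>b\<bar>" by simp
    ultimately have "\<bar>a\<bar> * \<bar>b\<bar> \<le> a\<^sup>2 + b\<^sup>2" by linarith
    then show ?thesis by (simp only: abs_mult)
  qed
  then show "AE x in M. norm (f x * g x) \<le> norm ((f x)\<^sup>2 + (g x)\<^sup>2)" by simp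
qed simp

text \<open>Stein's identity: \<open>\<phi>' x - x * \<phi> x\<close> times the Gaussian density is the derivative of
  \<open>\<phi>\<close> times the density.\<close>

lemma gaussian_integration_by_parts:
  assumes d: "\<And>x. (\<phi> has_real_derivative \<phi>' x) (at x)" and c: "continuous_on UNIV \<phi>'"
    and K: "\<And>x. \<bar>\<phi>' x\<bar> \<le> K"
  shows "(\<integral>x. x * \<phi> x \<partial>std_gaussian) = (\<integral>x. \<phi>' x \<partial>std_gaussian)"
proof -
  interpret G: prob_space std_gaussian by (rule prob_space_std_gaussian)
  have [measurable]: "\<phi> \<in> borel_measurable borel" "\<phi>' \<in> borel_measurable borel"
    using bounded_deriv_continuous[OF d] c by (auto intro: borel_measurable_continuous_onI)
  have gr: "\<bar>\<phi> x\<bar> \<le> \<bar>\<phi> 0\<bar> + K * \<bar>x\<bar>" for x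
    by (rule bounded_deriv_linear_growth[OF d K])
  have K0: "K \<ge> 0" using K[of 0] by linarith
  have i1: "integrable std_gaussian \<phi>'"
    by (rule G.integrable_const_bound[where B = K]) (use K in auto)
  have i0: "integrable std_gaussian (\<lambda>x. (\<phi> x)\<^sup>2)"
    by (rule G.square_integrable_lipschitz[where Y = "\<lambda>x. x", OF _ _ d K]) simp_all
  have i2: "integrable std_gaussian (\<lambda>x. x * \<phi> x)"
    by (rule integrable_mult_L2) (use i0 in auto)
  have "integral\<^sup>L lborel (\<lambda>x. std_normal_density x * (\<phi>' x - x * \<phi> x)) = 0"
  proof (rule integral_derivative_eq_0[where H = "\<lambda>x. std_normal_density x * \<phi> x"])
    show "((\<lambda>x. std_normal_density x * \<phi> x) has_real_derivative
        std_normal_density x * (\<phi>' x - x * \<phi> x)) (at x)" for x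
    proof -
      have "((\<lambda>x. c * exp (- x\<^sup>2 / 2) * \<phi> x) has_real_derivative
        c * exp (- x\<^sup>2 / 2) * (\<phi>' x - x * \<phi> x)) (at x)" for c :: real
        by (auto intro!: derivative_eq_intros d simp: algebra_simps)
      then show ?thesis unfolding std_normal_density_def .
    qed
    show "continuous_on UNIV (\<lambda>x. std_normal_density x * (\<phi>' x - x * \<phi> x))"
      unfolding std_normal_density_def
      by (intro continuous_intros c bounded_deriv_continuous[OF d]) auto
    show "integrable lborel (\<lambda>x. std_normal_density x * (\<phi>' x - x * \<phi> x))"
      using Bochner_Integration.integrable_diff[OF i1 i2] by (simp add: integral_std_gaussian)
    have "((\<lambda>x. (\<bar>\<phi> 0\<bar> + K) / sqrt (2 * pi) * ((1 + \<bar>x\<bar>) ^ 1 * exp (- (1/2) * x\<^sup>2))) \<longlongrightarrow>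
        (\<bar>\<phi> 0\<bar> + K) / sqrt (2 * pi) * 0) at_infinity"
      by (intro tendsto_mult tendsto_const power_exp_minus_square_tendsto_0) auto
    then have lim: "((\<lambda>x. (\<bar>\<phi> 0\<bar> + K) / sqrt (2 * pi) * ((1 + \<bar>x\<bar>) * exp (- x\<^sup>2 / 2))) \<longlongrightarrow> 0) at_infinity"
      by simp
    have "norm (std_normal_density x * \<phi> x) \<le> (\<bar>\<phi> 0\<bar> + K) / sqrt (2 * pi) * ((1 + \<bar>x\<bar>) * exp (- x\<^sup>2 / 2))" for x
    proof -
      have "\<bar>\<phi> x\<bar> \<le> (\<bar>\<phi> 0\<bar> + K) * (1 + \<bar>x\<bar>)"
      proof -
        have "0 \<le> \<bar>x\<bar> * \<bar>\<phi> 0\<bar>" by simp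
        moreover have "(\<bar>\<phi> 0\<bar> + K) * (1 + \<bar>x\<bar>) = \<bar>\<phi> 0\<bar> + K * \<bar>x\<bar> + (K + \<bar>x\<bar> * \<bar>\<phi> 0\<bar>)"
          by (simp add: algebra_simps)
        ultimately show ?thesis using gr[of x] K0 by linarith
      qed
      then have "std_normal_density x * \<bar>\<phi> x\<bar> \<le> std_normal_density x * ((\<bar>\<phi> 0\<bar> + K) * (1 + \<bar>x\<bar>))"
        by (intro mult_left_mono) auto
      then show ?thesis by (simp add: abs_mult std_normal_density_def field_simps)
    qed
    then show "((\<lambda>x. std_normal_density x * \<phi> x) \<longlongrightarrow> 0) at_infinity"
      by (intro Lim_null_comparison[OF always_eventually lim]) auto
  qed
  then have "(\<integral>x. \<phi>' x - x * \<phi> x \<partial>std_gaussian) = 0"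
    by (simp add: integral_std_gaussian)
  then show ?thesis using i1 i2 by simp
qed

lemma cdf_density_has_derivative:
  fixes f :: "real \<Rightarrow> real"
  assumes f: "continuous_on UNIV f" "\<And>x. 0 \<le> f x"
    and M: "M = density lborel (\<lambda>x. ennreal (f x))" "finite_borel_measure M"
  shows "(cdf M has_real_derivative f x) (at x)"
proof -
  interpret finite_borel_measure M by fact
  obtain F where F: "\<And>x. (F has_real_derivative f x) (at x)"
    using continuous_antiderivative[OF f(1)] by blast
  have [measurable]: "f \<in> borel_measurable borel"
    using f by (auto intro: borel_measurable_continuous_onI)
  have eq: "cdf M b - cdf M a = F b - F a" if "a \<le> b" for a b
  proof -
    have "emeasure M {a<..b} = (\<integral>\<^sup>+x. ennreal (f x) * indicator {a<..b} x \<partial>lborel)"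
      unfolding M by (subst emeasure_density) auto
    also have "\<dots> = (\<integral>\<^sup>+x. ennreal (f x) * indicator {a..b} x \<partial>lborel)"
      by (intro nn_integral_cong_AE)
        (use AE_lborel_singleton[of a] in \<open>auto elim!: eventually_mono simp: indicator_def\<close>)
    also have "\<dots> = F b - F a"
      by (rule nn_integral_FTC_Icc) (use F f that in \<open>auto intro: has_field_derivative_at_within\<close>)
    finally have em: "emeasure M {a<..b} = ennreal (F b - F a)" .
    have "measure M {a<..b} = F b - F a"
    proof -
      have "F a \<le> F b"
        by (rule DERIV_nonneg_imp_nondecreasing[OF that]) (use F f(2) in blast)
      with em show ?thesis by (simp add: measure_def)
    qed
    then show ?thesis using cdf_diff_eq[of a b] that by (cases "a = b") auto
  qed
  have "cdf M y = F y + (cdf M 0 - F 0)" for y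
    using eq[of 0 y] eq[of y 0] by (cases "0 \<le> y") auto
  then obtain c where c: "cdf M = (\<lambda>y. F y + c)" by blast
  show ?thesis unfolding c using F by (auto intro!: derivative_eq_intros)
qed

section \<open>Monotone transport to the Gaussian\<close>

lemma strict_mono_DERIV_pos:
  fixes F :: "real \<Rightarrow> real"
  assumes "\<And>x. (F has_real_derivative f x) (at x)" "\<And>x. f x > 0"
  shows "x < y \<Longrightarrow> F x < F y" and "F x = F y \<Longrightarrow> x = y" and "F x \<le> F y \<longleftrightarrow> x \<le> y"
proof -
  have *: "F x < F y" if "x < y" for x y
    using DERIV_pos_imp_increasing[OF that, of F] assms by blast
  then show "x < y \<Longrightarrow> F x < F y" .
  show "F x = F y \<Longrightarrow> x = y" using *[of x y] *[of y x] by (cases x y rule: linorder_cases) auto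
  show "F x \<le> F y \<longleftrightarrow> x \<le> y" using *[of x y] *[of y x] by (cases x y rule: linorder_cases) auto
qed

text \<open>The distribution functions of the two laws are composed with such inverses to obtain the
  transport map and its inverse, together with their derivatives.\<close>

lemma cdf_inverse:
  fixes F :: "real \<Rightarrow> real"
  assumes d: "\<And>x. (F has_real_derivative f x) (at x)" and pos: "\<And>x. f x > 0"
    and top: "(F \<longlongrightarrow> 1) at_top" and bot: "(F \<longlongrightarrow> 0) at_bot"
  obtains g where "\<And>x. g (F x) = x" "\<And>u. 0 < u \<Longrightarrow> u < 1 \<Longrightarrow> F (g u) = u"
    "\<And>x. 0 < F x" "\<And>x. F x < 1"
    "\<And>x. (g has_real_derivative 1 / f x) (at (F x))"
proof -
  note mono = strict_mono_DERIV_pos[OF d pos]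
  have cont: "isCont F x" for x using d by (rule DERIV_isCont)
  have less1: "F x < 1" for x
  proof -
    have "F (x + 1) \<le> 1"
      by (rule tendsto_lowerbound[OF top])
        (use mono(3) in \<open>auto simp: eventually_at_top_linorder\<close>)
    with mono(1)[of x "x + 1"] show ?thesis by simp
  qed
  have gr0: "0 < F x" for x
  proof -
    have "0 \<le> F (x - 1)"
      by (rule tendsto_upperbound[OF bot])
        (use mono(3) in \<open>auto simp: eventually_at_bot_linorder\<close>)
    with mono(1)[of "x - 1" x] show ?thesis by simp
  qed
  have ex: "\<exists>x. F x = u" if u: "0 < u" "u < 1" for u
  proof -
    obtain b where b: "u < F b"
      using order_tendstoD(1)[OF top u(2)] by (auto simp: eventually_at_top_linorder)
    obtain a where a: "F a < u"
      using order_tendstoD(2)[OF bot u(1)] by (auto simp: eventually_at_bot_linorder)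
    have "a \<le> b" using a b mono(3)[of a b] by linarith
    with a b show ?thesis using IVT[of F a u b] cont by auto
  qed
  define g where "g u = (SOME x. F x = u)" for u
  have Fg: "F (g u) = u" if "0 < u" "u < 1" for u
    unfolding g_def using someI_ex[OF ex[OF that]] .
  have gF: "g (F x) = x" for x
    by (rule mono(2)[OF Fg]) (use gr0 less1 in auto)
  have "isCont g (F x)" for x
    by (rule isCont_inverse_function2[of "x - 1" x "x + 1"]) (use gF cont in auto)
  then have "DERIV g (F x) :> inverse (f x)" for x
    by (intro DERIV_inverse_function[where f = F and a = 0 and b = 1])
      (use d pos Fg gF gr0 less1 in \<open>auto simp: less_imp_neq[symmetric]\<close>)
  then show ?thesis using that[of g] Fg gF gr0 less1 by (simp add: inverse_eq_divide)
qed

text \<open>A centred variable is positively correlated with every increasing function of itself, here with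
  \<open>B - A\<close>. This is how a transport map \<open>B\<close> is exchanged for a map \<open>A\<close> of bounded slope, to which the
  Stein identities apply.\<close>

lemma (in prob_space) expectation_mono_diff_nonneg:
  fixes Y :: "'a \<Rightarrow> real"
  assumes "integrable M Y" "expectation Y = 0"
    and "integrable M (\<lambda>w. Y w * A (Y w))" "integrable M (\<lambda>w. Y w * B (Y w))"
    and mono: "\<And>x y. x \<le> y \<Longrightarrow> B x - A x \<le> B y - A y"
  shows "expectation (\<lambda>w. Y w * A (Y w)) \<le> expectation (\<lambda>w. Y w * B (Y w))"
proof -
  have "0 \<le> expectation (\<lambda>w. Y w * (B (Y w) - A (Y w) - (B 0 - A 0)))"
  proof (rule Bochner_Integration.integral_nonneg)
    fix w
    show "0 \<le> Y w * (B (Y w) - A (Y w) - (B 0 - A 0))"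
    proof (cases "0 \<le> Y w")
      case True then show ?thesis using mono[of 0 "Y w"] by (intro mult_nonneg_nonneg) auto
    next
      case False then show ?thesis using mono[of "Y w" 0] by (intro mult_nonpos_nonpos) auto
    qed
  qed
  also have "(\<lambda>w. Y w * (B (Y w) - A (Y w) - (B 0 - A 0))) =
      (\<lambda>w. Y w * B (Y w) - Y w * A (Y w) - (B 0 - A 0) * Y w)"
    by (auto simp: algebra_simps)
  also have "expectation \<dots> = expectation (\<lambda>w. Y w * B (Y w)) - expectation (\<lambda>w. Y w * A (Y w))"
    using assms by simp
  finally show ?thesis by simp
qed

text \<open>Without the truncations, and for \<open>t \<ge> 0\<close>, the left-hand side is at most
  \<open>(sqrt t - 1)\<^sup>2\<close> by the inequality of arithmetic and geometric means. A Stein kernel need not be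
  nonnegative pointwise; capping both slopes at \<open>3\<close> makes the estimate hold for every real \<open>t\<close>.\<close>

lemma truncated_transport_inequality:
  fixes q t :: real
  assumes "q > 0"
  shows "t + 1 - t * min q 3 - min (1 / q) 3 \<le> (t - 1)\<^sup>2"
proof -
  consider "q \<ge> 3" | "q \<le> 1/3" | "1/3 < q" "q < 3" by linarith
  then show ?thesis
  proof cases
    case 1
    then have "min (1 / q) 3 \<ge> 0" by simp
    moreover have "t + 1 - t * 3 \<le> (t - 1)\<^sup>2" by (simp add: power2_eq_square algebra_simps)
    ultimately have "t + 1 - t * 3 - min (1 / q) 3 \<le> (t - 1)\<^sup>2" by linarith
    moreover have "min q 3 = 3" using 1 by simp
    ultimately show ?thesis by (simp only:)
  next
    case 2
    have "min (1 / q) 3 = 3" using 2 assms by (simp add: field_simps)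
    moreover have "(t - 1) * (1 - q) \<le> (t - 1)\<^sup>2 + (1 - q)\<^sup>2 / 4"
    proof -
      have "0 \<le> ((t - 1) - (1 - q) / 2)\<^sup>2" by simp
      then show ?thesis by (simp add: power2_eq_square field_simps)
    qed
    moreover have "(1 - q)\<^sup>2 \<le> 1\<^sup>2" using 2 assms by (intro power_mono) auto
    ultimately show ?thesis using 2 assms by (simp add: min_def algebra_simps)
  next
    case 3
    have "t + 1 - t * q - 1 / q = (t - 1) * (1 - q) - (1 - q)\<^sup>2 / q"
      using assms by (simp add: field_simps power2_eq_square)
    also have "\<dots> \<le> q / 4 * (t - 1)\<^sup>2"
    proof -
      have "0 \<le> (q * (t - 1) / 2 - (1 - q))\<^sup>2 / q" using assms by simp
      also have "\<dots> = q / 4 * (t - 1)\<^sup>2 - ((t - 1) * (1 - q) - (1 - q)\<^sup>2 / q)"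
        using assms by (simp add: field_simps power2_eq_square)
      finally show ?thesis by simp
    qed
    also have "\<dots> \<le> 1 * (t - 1)\<^sup>2" using 3 by (intro mult_right_mono) auto
    finally have "t + 1 - t * q - 1 / q \<le> (t - 1)\<^sup>2" by simp
    moreover have "1 / q < 3" using 3 by (simp add: field_simps)
    ultimately show ?thesis using 3 by (simp add: min_def)
  qed
qed

text \<open>\<open>Q\<close> is the increasing map that transports the law of \<open>Y\<close> to the Gaussian, \<open>T\<close> its inverse, and
  \<open>q\<close>, \<open>r\<close> are their derivatives, so that \<open>r (Q y) = 1 / q y\<close>. With \<open>Z = Q Y\<close>,
  \<open>E(Y - Z)\<^sup>2 = E[t] + 1 - 2 E[Y Z]\<close>. One copy of \<open>E[Y Z] = E[Y Q(Y)]\<close> is at least \<open>E[t min (q Y) 3]\<close>,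
  by the Stein identity of \<open>Y\<close> for a primitive of \<open>min q 3\<close>; the other copy, read as \<open>E[Z T(Z)]\<close>, is at
  least \<open>E[min (1 / q Y) 3]\<close>, by Gaussian integration by parts for a primitive of \<open>min r 3\<close>.\<close>

lemma (in prob_space) monotone_coupling_bound:
  fixes Y t :: "'a \<Rightarrow> real"
  assumes [measurable]: "Y \<in> borel_measurable M" "t \<in> borel_measurable M"
    and Y2: "integrable M (\<lambda>w. (Y w)\<^sup>2)" and t2: "integrable M (\<lambda>w. (t w)\<^sup>2)"
    and stein: "\<And>\<phi> \<phi>' K. (\<And>x. (\<phi> has_real_derivative \<phi>' x) (at x)) \<Longrightarrow> continuous_on UNIV \<phi>' \<Longrightarrow>
      (\<And>x. \<bar>\<phi>' x\<bar> \<le> K) \<Longrightarrow> expectation (\<lambda>w. Y w * \<phi> (Y w)) = expectation (\<lambda>w. t w * \<phi>' (Y w))"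
    and p: "distr M borel Y = density lborel (\<lambda>x. ennreal (p x))" "continuous_on UNIV p" "\<And>y. p y > 0"
  obtains Q where "Q \<in> borel_measurable borel" "distr M borel (\<lambda>w. Q (Y w)) = std_gaussian"
    "integrable M (\<lambda>w. (Y w - Q (Y w))\<^sup>2)"
    "expectation (\<lambda>w. (Y w - Q (Y w))\<^sup>2) \<le> expectation (\<lambda>w. (t w - 1)\<^sup>2)"
proof -
  define \<gamma> where "\<gamma> = std_normal_density"
  interpret D: real_distribution "distr M borel Y"
    by (rule real_distribution_distr) simp
  interpret G: real_distribution std_gaussian
    by (simp add: real_distribution_def real_distribution_axioms_def prob_space_std_gaussian)
  have \<gamma>pos: "\<gamma> z > 0" for z by (simp add: \<gamma>_def normal_density_pos)
  have \<gamma>cont: "continuous_on UNIV \<gamma>"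
    unfolding \<gamma>_def std_normal_density_def by (intro continuous_intros) auto
  define F where "F = cdf (distr M borel Y)"
  define \<Phi> where "\<Phi> = cdf std_gaussian"
  have F: "(F has_real_derivative p y) (at y)" for y
    unfolding F_def
    by (rule cdf_density_has_derivative[OF p(2) _ p(1)])
      (use p(3) D.finite_borel_measure_axioms in \<open>auto intro: less_imp_le\<close>)
  have \<Phi>: "(\<Phi> has_real_derivative \<gamma> y) (at y)" for y
    unfolding \<Phi>_def
    by (rule cdf_density_has_derivative[OF \<gamma>cont])
      (use \<gamma>pos G.finite_borel_measure_axioms in \<open>auto intro: less_imp_le simp: std_gaussian_def \<gamma>_def\<close>)
  obtain f where f: "\<And>x. f (F x) = x" "\<And>u. 0 < u \<Longrightarrow> u < 1 \<Longrightarrow> F (f u) = u"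
    "\<And>x. 0 < F x" "\<And>x. F x < 1" "\<And>x. (f has_real_derivative 1 / p x) (at (F x))"
    using cdf_inverse[OF F p(3)] D.cdf_lim_at_top_prob D.cdf_lim_at_bot unfolding F_def by metis
  obtain h where h: "\<And>x. h (\<Phi> x) = x" "\<And>u. 0 < u \<Longrightarrow> u < 1 \<Longrightarrow> \<Phi> (h u) = u"
    "\<And>x. 0 < \<Phi> x" "\<And>x. \<Phi> x < 1" "\<And>x. (h has_real_derivative 1 / \<gamma> x) (at (\<Phi> x))"
    using cdf_inverse[OF \<Phi> \<gamma>pos] G.cdf_lim_at_top_prob G.cdf_lim_at_bot unfolding \<Phi>_def by metis
  define Q where "Q y = h (F y)" for y
  define T where "T z = f (\<Phi> z)" for z
  have TQ: "T (Q y) = y" and QT: "Q (T z) = z" for y z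
    by (simp_all add: T_def Q_def f h)
  define q where "q y = p y / \<gamma> (Q y)" for y
  define r where "r z = \<gamma> z / p (T z)" for z
  have qpos: "q y > 0" and rpos: "r z > 0" for y z
    by (simp_all add: q_def r_def p(3) \<gamma>pos)
  have rQ: "r (Q y) = 1 / q y" for y by (simp add: r_def q_def TQ)
  have Q': "(Q has_real_derivative q y) (at y)" for y
  proof -
    have "F y = \<Phi> (Q y)" by (simp add: Q_def f h)
    then have "(h has_real_derivative 1 / \<gamma> (Q y)) (at (F y))" using h(5)[of "Q y"] by simp
    from DERIV_chain2[OF this F] show ?thesis unfolding Q_def[abs_def] q_def by simp
  qed
  have T': "(T has_real_derivative r z) (at z)" for z
  proof -
    have "\<Phi> z = F (T z)" by (simp add: T_def f h)
    then have "(f has_real_derivative 1 / p (T z)) (at (\<Phi> z))" using f(5)[of "T z"] by simp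
    from DERIV_chain2[OF this \<Phi>] show ?thesis unfolding T_def[abs_def] r_def by simp
  qed
  have Qcont: "continuous_on UNIV Q" and Tcont: "continuous_on UNIV T"
    using bounded_deriv_continuous[OF Q'] bounded_deriv_continuous[OF T'] by auto
  have qcont: "continuous_on UNIV q"
    unfolding q_def using \<gamma>pos
    by (intro continuous_intros p continuous_on_compose2[OF \<gamma>cont Qcont]) (auto simp: less_imp_neq[symmetric])
  have rcont: "continuous_on UNIV r"
    unfolding r_def using p(3)
    by (intro continuous_intros \<gamma>cont continuous_on_compose2[OF p(2) Tcont]) (auto simp: less_imp_neq[symmetric])
  have [measurable]: "Q \<in> borel_measurable borel" "T \<in> borel_measurable borel"
    "q \<in> borel_measurable borel" "r \<in> borel_measurable borel"
    using Qcont Tcont qcont rcont by (auto intro: borel_measurable_continuous_onI)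
  have Qle: "Q y \<le> z \<longleftrightarrow> y \<le> T z" for y z
    using strict_mono_DERIV_pos(3)[OF Q' qpos, of y "T z"] QT by simp
  have distrQ: "distr M borel (\<lambda>w. Q (Y w)) = std_gaussian"
  proof (rule cdf_unique)
    show "real_distribution (distr M borel (\<lambda>w. Q (Y w)))"
      by (rule real_distribution_distr) simp
    show "real_distribution std_gaussian" by (rule G.real_distribution_axioms)
    have "cdf (distr M borel (\<lambda>w. Q (Y w))) z = F (T z)" for z
      by (simp add: cdf_def F_def measure_distr Qle vimage_def)
    also have "F (T z) = \<Phi> z" for z by (simp add: T_def f h)
    finally show "cdf (distr M borel (\<lambda>w. Q (Y w))) = cdf std_gaussian"
      by (auto simp: \<Phi>_def)
  qed
  have EQ: "expectation (\<lambda>w. g (Q (Y w))) = integral\<^sup>L std_gaussian g"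
    and IQ: "integrable M (\<lambda>w. g (Q (Y w))) \<longleftrightarrow> integrable std_gaussian g"
    if [measurable]: "g \<in> borel_measurable borel" for g :: "real \<Rightarrow> real"
    by (simp_all add: distrQ[symmetric] integral_distr integrable_distr_eq)
  have Q2: "integrable M (\<lambda>w. (Q (Y w))\<^sup>2)" "expectation (\<lambda>w. (Q (Y w))\<^sup>2) = 1"
    and EQ1: "integrable M (\<lambda>w. Q (Y w))" "expectation (\<lambda>w. Q (Y w)) = 0"
    using EQ[of "\<lambda>x. x\<^sup>2"] EQ[of "\<lambda>x. x"] IQ[of "\<lambda>x. x\<^sup>2"] IQ[of "\<lambda>x. x"]
      std_gaussian_moment_integrable[of 1]
    by (simp_all add: std_gaussian_moments)
  have "continuous_on UNIV (\<lambda>y. min (q y) 3)" by (intro continuous_intros qcont)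
  from continuous_antiderivative[OF this]
  obtain Qt where Qt: "\<And>y. (Qt has_real_derivative min (q y) 3) (at y)" by blast
  have "continuous_on UNIV (\<lambda>z. min (r z) 3)" by (intro continuous_intros rcont)
  from continuous_antiderivative[OF this]
  obtain Tt where Tt: "\<And>z. (Tt has_real_derivative min (r z) 3) (at z)" by blast
  have bq: "\<bar>min (q y) 3\<bar> \<le> 3" and br: "\<bar>min (r y) 3\<bar> \<le> 3" for y
    using qpos[of y] rpos[of y] by auto
  have [measurable]: "Qt \<in> borel_measurable borel" "Tt \<in> borel_measurable borel"
    using bounded_deriv_continuous[OF Qt] bounded_deriv_continuous[OF Tt]
    by (auto intro: borel_measurable_continuous_onI)
  have Y1: "integrable M Y" using square_integrable_imp_integrable[OF _ Y2] by simp
  have t1: "integrable M t" using square_integrable_imp_integrable[OF _ t2] by simp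
  have EY: "expectation Y = 0"
    using stein[of "\<lambda>_. 1" "\<lambda>_. 0" 0] by simp
  have EY2: "expectation (\<lambda>w. (Y w)\<^sup>2) = expectation t"
    using stein[of "\<lambda>x. x" "\<lambda>_. 1" 1] by (simp add: power2_eq_square)
  have iYQ: "integrable M (\<lambda>w. Y w * Q (Y w))"
    by (rule integrable_mult_L2) (use Y2 Q2 in auto)
  have iYQt: "integrable M (\<lambda>w. Y w * Qt (Y w))"
    by (rule integrable_mult_L2) (use Y2 square_integrable_lipschitz[OF _ Y2 Qt bq] in auto)
  have iQTt: "integrable M (\<lambda>w. Q (Y w) * Tt (Q (Y w)))"
    by (rule integrable_mult_L2) (use Q2 square_integrable_lipschitz[OF _ Q2(1) Tt br] in auto)
  have imq: "integrable M (\<lambda>w. t w * min (q (Y w)) 3)"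
  proof (rule Bochner_Integration.integrable_bound)
    show "integrable M (\<lambda>w. 3 * t w)" using t1 by simp
    show "AE w in M. norm (t w * min (q (Y w)) 3) \<le> norm (3 * t w)"
      using mult_left_mono[OF bq abs_ge_zero] by (intro AE_I2) (simp add: abs_mult mult.commute)
  qed simp
  have imr: "integrable M (\<lambda>w. min (1 / q (Y w)) 3)"
    by (rule integrable_const_bound[where B = 3]) (use br[of "Q _"] in \<open>auto simp: rQ\<close>)
  have A: "expectation (\<lambda>w. t w * min (q (Y w)) 3) \<le> expectation (\<lambda>w. Y w * Q (Y w))"
  proof -
    have "expectation (\<lambda>w. t w * min (q (Y w)) 3) = expectation (\<lambda>w. Y w * Qt (Y w))"
      by (rule stein[symmetric, OF Qt _ bq]) (intro continuous_intros qcont)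
    also have "\<dots> \<le> expectation (\<lambda>w. Y w * Q (Y w))"
    proof (rule expectation_mono_diff_nonneg[OF Y1 EY iYQt iYQ])
      fix x y :: real assume "x \<le> y"
      then show "Q x - Qt x \<le> Q y - Qt y"
        by (rule DERIV_nonneg_imp_nondecreasing)
          (auto intro!: exI[of _ "q _ - min (q _) 3"] DERIV_diff Q' Qt)
    qed
    finally show ?thesis .
  qed
  have B: "expectation (\<lambda>w. min (1 / q (Y w)) 3) \<le> expectation (\<lambda>w. Y w * Q (Y w))"
  proof -
    have "expectation (\<lambda>w. min (1 / q (Y w)) 3) = expectation (\<lambda>w. min (r (Q (Y w))) 3)"
      by (simp add: rQ)
    also have "\<dots> = (\<integral>z. min (r z) 3 \<partial>std_gaussian)" by (rule EQ) simp
    also have "\<dots> = (\<integral>z. z * Tt z \<partial>std_gaussian)"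
      by (rule gaussian_integration_by_parts[symmetric, OF Tt _ br]) (intro continuous_intros rcont)
    also have "\<dots> = expectation (\<lambda>w. Q (Y w) * Tt (Q (Y w)))" by (rule EQ[symmetric]) simp
    also have "\<dots> \<le> expectation (\<lambda>w. Q (Y w) * T (Q (Y w)))"
    proof (rule expectation_mono_diff_nonneg[OF EQ1 iQTt])
      show "integrable M (\<lambda>w. Q (Y w) * T (Q (Y w)))"
        using iYQ by (simp add: TQ mult.commute)
      fix x y :: real assume "x \<le> y"
      then show "T x - Tt x \<le> T y - Tt y"
        by (rule DERIV_nonneg_imp_nondecreasing)
          (auto intro!: exI[of _ "r _ - min (r _) 3"] DERIV_diff T' Tt)
    qed
    finally show ?thesis by (simp add: TQ mult.commute)
  qed
  have sq: "(Y w - Q (Y w))\<^sup>2 = (Y w)\<^sup>2 + (Q (Y w))\<^sup>2 - 2 * (Y w * Q (Y w))" for w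
    by (simp add: power2_diff)
  have "expectation (\<lambda>w. (Y w - Q (Y w))\<^sup>2) = expectation t + 1 - 2 * expectation (\<lambda>w. Y w * Q (Y w))"
    unfolding sq using Y2 Q2 iYQ EY2 by simp
  also have "\<dots> \<le> expectation t + 1 - expectation (\<lambda>w. t w * min (q (Y w)) 3)
      - expectation (\<lambda>w. min (1 / q (Y w)) 3)"
    using A B by linarith
  also have "\<dots> = expectation (\<lambda>w. t w + 1 - t w * min (q (Y w)) 3 - min (1 / q (Y w)) 3)"
    using t1 imq imr by (simp add: prob_space)
  also have "\<dots> \<le> expectation (\<lambda>w. (t w - 1)\<^sup>2)"
  proof (rule Bochner_Integration.integral_mono)
    show "integrable M (\<lambda>w. t w + 1 - t w * min (q (Y w)) 3 - min (1 / q (Y w)) 3)"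
      using t1 imq imr by simp
    show "integrable M (\<lambda>w. (t w - 1)\<^sup>2)" using t1 t2 by (simp add: power2_diff)
    show "t w + 1 - t w * min (q (Y w)) 3 - min (1 / q (Y w)) 3 \<le> (t w - 1)\<^sup>2" for w
      by (rule truncated_transport_inequality[OF qpos])
  qed
  finally have "expectation (\<lambda>w. (Y w - Q (Y w))\<^sup>2) \<le> expectation (\<lambda>w. (t w - 1)\<^sup>2)" .
  moreover have "integrable M (\<lambda>w. (Y w - Q (Y w))\<^sup>2)"
    unfolding sq using Y2 Q2 iYQ by simp
  ultimately show ?thesis using that[of Q] distrQ by simp
qed

section \<open>From Stein identities to the Kantorovich distance\<close>

text \<open>Adding an independent Gaussian turns an arbitrary law into one with a continuous positive
  density, as the transport map requires.\<close>

lemma gaussian_smoothing_density: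
  fixes X :: "'a \<Rightarrow> real"
  assumes "prob_space M" and [measurable]: "X \<in> borel_measurable M" and e: "e > 0"
  defines "p \<equiv> \<lambda>y. \<integral>w. normal_density (X w) e y \<partial>M"
  shows "distr (M \<Otimes>\<^sub>M std_gaussian) borel (\<lambda>(w, g). X w + e * g) = density lborel (\<lambda>y. ennreal (p y))"
    and "continuous_on UNIV p" and "p y > 0"
proof -
  interpret M: prob_space M by fact
  interpret G: prob_space std_gaussian by (rule prob_space_std_gaussian)
  interpret MB: pair_sigma_finite M lborel
    by (intro pair_sigma_finite.intro M.sigma_finite_measure_axioms lborel.sigma_finite_measure_axioms)
  have nd_meas[measurable]: "(\<lambda>(w, y). normal_density (X w) e y) \<in> borel_measurable (M \<Otimes>\<^sub>M lborel)"
    unfolding normal_density_def by measurable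
  have nd_meas2[measurable]: "(\<lambda>w. normal_density (X w) e y) \<in> borel_measurable M" for y
    unfolding normal_density_def by measurable
  have bound: "\<bar>normal_density x e y\<bar> \<le> 1 / sqrt (2 * pi * e\<^sup>2)" for x y
    unfolding normal_density_def by (auto simp: abs_mult intro!: divide_right_mono)
  have int: "integrable M (\<lambda>w. normal_density (X w) e y)" for y
    by (rule M.integrable_const_bound[where B = "1 / sqrt (2 * pi * e\<^sup>2)"]) (use bound in auto)
  have p_enn: "ennreal (p y) = (\<integral>\<^sup>+w. ennreal (normal_density (X w) e y) \<partial>M)" for y
    unfolding p_def by (rule nn_integral_eq_integral[symmetric, OF int]) auto
  have [measurable]: "p \<in> borel_measurable borel"
    unfolding p_def normal_density_def by measurable
  show "continuous_on UNIV p"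
  proof (rule continuous_at_imp_continuous_on, rule ballI)
    fix y
    show "isCont p y"
      unfolding continuous_at_sequentially o_def
    proof (intro allI impI)
      fix u :: "nat \<Rightarrow> real" assume u: "u \<longlonglongrightarrow> y"
      show "(\<lambda>n. p (u n)) \<longlonglongrightarrow> p y"
        unfolding p_def
      proof (rule integral_dominated_convergence[where w = "\<lambda>_. 1 / sqrt (2 * pi * e\<^sup>2)"])
        show "AE w in M. (\<lambda>n. normal_density (X w) e (u n)) \<longlonglongrightarrow> normal_density (X w) e y"
          unfolding normal_density_def using e by (intro AE_I2 tendsto_intros u) auto
      qed (use bound in auto)
    qed
  qed
  show "p y > 0"
    unfolding p_def
    by (rule M.expectation_greater[OF int]) (use e in \<open>auto simp: normal_density_pos\<close>)
  show "distr (M \<Otimes>\<^sub>M std_gaussian) borel (\<lambda>(w, g). X w + e * g) = density lborel (\<lambda>y. ennreal (p y))"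
  proof (rule measure_eqI)
    fix A assume "A \<in> sets (distr (M \<Otimes>\<^sub>M std_gaussian) borel (\<lambda>(w, g). X w + e * g))"
    then have [measurable]: "A \<in> sets borel" by simp
    have inner: "(\<integral>\<^sup>+g. indicator A (a + e * g) \<partial>std_gaussian) =
        (\<integral>\<^sup>+y. ennreal (normal_density a e y) * indicator A y \<partial>lborel)" for a
    proof -
      have nd: "ennreal e * (ennreal (normal_density a e (a + e * g)) * indicator A (a + e * g)) =
          ennreal (std_normal_density g) * indicator A (a + e * g)" for g
      proof -
        have "e * normal_density a e (a + e * g) = std_normal_density g"
          using e by (simp add: normal_density_def real_sqrt_mult power_mult_distrib)
        then show ?thesis
          using e by (metis ennreal_mult less_imp_le mult.assoc normal_density_nonneg)
      qed
      have "(\<integral>\<^sup>+y. ennreal (normal_density a e y) * indicator A y \<partial>lborel) =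
          ennreal \<bar>e\<bar> * (\<integral>\<^sup>+g. ennreal (normal_density a e (a + e * g)) * indicator A (a + e * g) \<partial>lborel)"
        by (rule nn_integral_real_affine) (use e in auto)
      also have "\<dots> = (\<integral>\<^sup>+g. ennreal (std_normal_density g) * indicator A (a + e * g) \<partial>lborel)"
        using e nd by (simp add: nn_integral_cmult[symmetric])
      also have "\<dots> = (\<integral>\<^sup>+g. indicator A (a + e * g) \<partial>std_gaussian)"
        unfolding std_gaussian_def by (subst nn_integral_density) auto
      finally show ?thesis by simp
    qed
    have "emeasure (distr (M \<Otimes>\<^sub>M std_gaussian) borel (\<lambda>(w, g). X w + e * g)) A =
        (\<integral>\<^sup>+z. indicator A z \<partial>distr (M \<Otimes>\<^sub>M std_gaussian) borel (\<lambda>(w, g). X w + e * g))"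
      by simp
    also have "\<dots> = (\<integral>\<^sup>+v. indicator A (X (fst v) + e * snd v) \<partial>(M \<Otimes>\<^sub>M std_gaussian))"
      by (subst nn_integral_distr) (auto simp: case_prod_beta)
    also have "\<dots> = (\<integral>\<^sup>+w. \<integral>\<^sup>+g. indicator A (X w + e * g) \<partial>std_gaussian \<partial>M)"
      by (subst G.nn_integral_fst[symmetric]) auto
    also have "\<dots> = (\<integral>\<^sup>+w. \<integral>\<^sup>+y. ennreal (normal_density (X w) e y) * indicator A y \<partial>lborel \<partial>M)"
      unfolding inner ..
    also have "\<dots> = (\<integral>\<^sup>+y. \<integral>\<^sup>+w. ennreal (normal_density (X w) e y) * indicator A y \<partial>M \<partial>lborel)"
      by (rule MB.Fubini'[symmetric]) measurable
    also have "\<dots> = (\<integral>\<^sup>+y. ennreal (p y) * indicator A y \<partial>lborel)"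
      unfolding p_enn by (subst nn_integral_multc) auto
    also have "\<dots> = emeasure (density lborel (\<lambda>y. ennreal (p y))) A"
      by (subst emeasure_density) auto
    finally show "emeasure (distr (M \<Otimes>\<^sub>M std_gaussian) borel (\<lambda>(w, g). X w + e * g)) A =
        emeasure (density lborel (\<lambda>y. ennreal (p y))) A" .
  qed simp
qed

lemma coupling_cost_le:
  fixes X Z :: "'a \<Rightarrow> real"
  assumes "prob_space P" and [measurable]: "X \<in> borel_measurable P" "Z \<in> borel_measurable P"
    and i: "integrable P (\<lambda>w. (X w - Z w)\<^sup>2)"
  shows "(INF \<pi>\<in>couplings (distr P borel X) (distr P borel Z). \<integral>\<^sup>+(x, y). ennreal ((x - y)\<^sup>2) \<partial>\<pi>)
    \<le> ennreal (\<integral>w. (X w - Z w)\<^sup>2 \<partial>P)"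
proof (rule INF_lower2)
  let ?\<mu> = "distr P borel X" and ?\<nu> = "distr P borel Z"
  let ?\<pi> = "distr P (?\<mu> \<Otimes>\<^sub>M ?\<nu>) (\<lambda>w. (X w, Z w))"
  have [measurable]: "(\<lambda>w. (X w, Z w)) \<in> measurable P (?\<mu> \<Otimes>\<^sub>M ?\<nu>)"
    by (intro measurable_Pair) simp_all
  have [measurable]: "fst \<in> measurable (?\<mu> \<Otimes>\<^sub>M ?\<nu>) ?\<mu>" "snd \<in> measurable (?\<mu> \<Otimes>\<^sub>M ?\<nu>) ?\<nu>"
    by simp_all
  have "distr ?\<pi> ?\<mu> fst = ?\<mu>"
    by (subst distr_distr, simp_all) (rule distr_cong, simp_all)
  moreover have "distr ?\<pi> ?\<nu> snd = ?\<nu>"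
    by (subst distr_distr, simp_all) (rule distr_cong, simp_all)
  ultimately show "?\<pi> \<in> couplings ?\<mu> ?\<nu>" by (simp add: couplings_def)
  have "(\<integral>\<^sup>+(x, y). ennreal ((x - y)\<^sup>2) \<partial>?\<pi>) = (\<integral>\<^sup>+w. ennreal ((X w - Z w)\<^sup>2) \<partial>P)"
    by (subst nn_integral_distr) (auto simp: case_prod_beta)
  also have "\<dots> = ennreal (\<integral>w. (X w - Z w)\<^sup>2 \<partial>P)"
    by (rule nn_integral_eq_integral[OF i]) simp
  finally show "(\<integral>\<^sup>+(x, y). ennreal ((x - y)\<^sup>2) \<partial>?\<pi>) \<le> ennreal (\<integral>w. (X w - Z w)\<^sup>2 \<partial>P)" by simp
qed

lemma ennreal_sqrt_le:
  assumes "x \<le> ennreal a" "0 \<le> a"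
  shows "ennreal_sqrt x \<le> ennreal (sqrt a)"
proof -
  have "x \<noteq> \<top>" using assms(1) by (auto simp: top_unique)
  moreover have "enn2real x \<le> a" using enn2real_mono[OF assms(1)] assms(2) by simp
  ultimately show ?thesis by (simp add: ennreal_sqrt_def ennreal_leI)
qed

text \<open>The variable \<open>Y = X - m + e G\<close>, with \<open>G\<close> an independent Gaussian, has the Stein kernel
  \<open>\<tau> + e\<^sup>2\<close> and a continuous positive density, so \<open>monotone_coupling_bound\<close> provides a Gaussian
  variable \<open>Q Y\<close> close to \<open>Y\<close>. The coupling consists of \<open>X\<close> itself and \<open>Q Y\<close>. The factor \<open>3\<close> comes
  from \<open>(a + b + c)\<^sup>2 \<le> 3 (a\<^sup>2 + b\<^sup>2 + c\<^sup>2)\<close>, applied to \<open>X - Q Y = (Y - Q Y) + m - e G\<close>; finally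
  \<open>e\<close> tends to \<open>0\<close>.\<close>

theorem W2_le_stein_discrepancy:
  fixes X \<tau> :: "'a \<Rightarrow> real"
  assumes "prob_space M" and [measurable]: "X \<in> borel_measurable M" "\<tau> \<in> borel_measurable M"
    and X2: "integrable M (\<lambda>w. (X w)\<^sup>2)" and \<tau>2: "integrable M (\<lambda>w. (\<tau> w)\<^sup>2)"
    and stein: "\<And>\<phi> \<phi>' K. (\<And>x. (\<phi> has_real_derivative \<phi>' x) (at x)) \<Longrightarrow> continuous_on UNIV \<phi>' \<Longrightarrow>
      (\<And>x. \<bar>\<phi>' x\<bar> \<le> K) \<Longrightarrow> (\<integral>w. (X w - m) * \<phi> (X w) \<partial>M) = (\<integral>w. \<tau> w * \<phi>' (X w) \<partial>M)"
  shows "W2 (distr M borel X) std_gaussian \<le> ennreal (sqrt (3 * ((\<integral>w. (\<tau> w - 1)\<^sup>2 \<partial>M) + m\<^sup>2)))"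
proof -
  interpret M: prob_space M by fact
  interpret G: prob_space std_gaussian by (rule prob_space_std_gaussian)
  interpret P: pair_prob_space M std_gaussian
    by (intro pair_prob_space.intro pair_sigma_finite.intro M.prob_space_axioms G.prob_space_axioms
        M.sigma_finite_measure_axioms G.sigma_finite_measure_axioms)
  let ?P = "M \<Otimes>\<^sub>M std_gaussian"
  let ?inf = "INF \<pi>\<in>couplings (distr M borel X) std_gaussian. \<integral>\<^sup>+(x, y). ennreal ((x - y)\<^sup>2) \<partial>\<pi>"
  have X1: "integrable M X" using M.square_integrable_imp_integrable[OF _ X2] by simp
  have \<tau>1: "integrable M \<tau>" using M.square_integrable_imp_integrable[OF _ \<tau>2] by simp
  have i_fst: "integrable ?P (\<lambda>v. f (fst v))" and e_fst: "(\<integral>v. f (fst v) \<partial>?P) = integral\<^sup>L M f"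
    if "integrable M f" for f :: "'a \<Rightarrow> real"
  proof -
    have d: "distr ?P M fst = M" by (rule G.distr_pair_fst)
    show "integrable ?P (\<lambda>v. f (fst v))" "(\<integral>v. f (fst v) \<partial>?P) = integral\<^sup>L M f"
      using that integrable_distr_eq[of fst ?P M f] integral_distr[of fst ?P M f]
      by (auto simp: d)
  qed
  have i_snd: "integrable ?P (\<lambda>v. f (snd v))" and e_snd: "(\<integral>v. f (snd v) \<partial>?P) = integral\<^sup>L std_gaussian f"
    if "integrable std_gaussian f" for f :: "real \<Rightarrow> real"
  proof -
    have d: "distr ?P std_gaussian snd = std_gaussian"
    proof (rule measure_eqI)
      fix B assume "B \<in> sets (distr ?P std_gaussian snd)"
      then have B: "B \<in> sets std_gaussian" by simp
      then have "snd -` B \<inter> space ?P = space M \<times> B"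
        by (auto simp: space_pair_measure)
      then show "emeasure (distr ?P std_gaussian snd) B = emeasure std_gaussian B"
        using B by (simp add: emeasure_distr G.emeasure_pair_measure_Times M.emeasure_space_1)
    qed simp
    show "integrable ?P (\<lambda>v. f (snd v))" "(\<integral>v. f (snd v) \<partial>?P) = integral\<^sup>L std_gaussian f"
      using that integrable_distr_eq[of snd ?P std_gaussian f] integral_distr[of snd ?P std_gaussian f]
      by (auto simp: d)
  qed
  have bound: "?inf \<le> ennreal (3 * ((\<integral>w. (\<tau> w + e\<^sup>2 - 1)\<^sup>2 \<partial>M) + m\<^sup>2 + e\<^sup>2))" if e: "e > 0" for e :: real
  proof -
    define Y where "Y v = (X (fst v) - m) + e * snd v" for v
    define t where "t v = \<tau> (fst v) + e\<^sup>2" for v :: "'a \<times> real"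
    have [measurable]: "Y \<in> borel_measurable ?P" "t \<in> borel_measurable ?P"
      unfolding Y_def t_def by measurable
    have Xm2: "integrable M (\<lambda>w. (X w - m)\<^sup>2)" using X1 X2 by (simp add: power2_diff)
    have iXg: "integrable ?P (\<lambda>v. (X (fst v) - m) * (e * snd v))"
      by (rule integrable_mult_L2)
        (use i_fst[OF Xm2] i_snd[OF std_gaussian_moment_integrable[of 2]] in \<open>auto simp: power_mult_distrib\<close>)
    have Y2: "integrable ?P (\<lambda>v. (Y v)\<^sup>2)"
    proof -
      have "(\<lambda>v. (Y v)\<^sup>2) = (\<lambda>v. (X (fst v) - m)\<^sup>2 + e\<^sup>2 * (snd v)\<^sup>2 + 2 * ((X (fst v) - m) * (e * snd v)))"
        by (rule ext) (simp add: Y_def power2_eq_square algebra_simps)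
      then show ?thesis
        by (simp only:)
          (intro Bochner_Integration.integrable_add integrable_mult_right iXg i_fst[OF Xm2]
            i_snd[OF std_gaussian_moment_integrable[of 2]])
    qed
    have t2: "integrable ?P (\<lambda>v. (t v)\<^sup>2)"
      using i_fst[OF \<tau>2] i_fst[OF \<tau>1] by (simp add: t_def power2_sum)
    note dens = gaussian_smoothing_density[OF \<open>prob_space M\<close>, of "\<lambda>w. X w - m" e]
    have Yeq: "(\<lambda>(w, g). (X w - m) + e * g) = Y" by (auto simp: Y_def)
    \<comment> \<open>Given \<open>G\<close>, the Stein identity of \<open>X\<close> treats \<open>X - m\<close>; given \<open>X\<close>, the Gaussian one treats \<open>e G\<close>.\<close>
    have stein_Y: "(\<integral>v. Y v * \<phi> (Y v) \<partial>?P) = (\<integral>v. t v * \<phi>' (Y v) \<partial>?P)"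
      if d: "\<And>x. (\<phi> has_real_derivative \<phi>' x) (at x)" and c: "continuous_on UNIV \<phi>'"
        and K: "\<And>x. \<bar>\<phi>' x\<bar> \<le> K" for \<phi> \<phi>' K
    proof -
      have [measurable]: "\<phi> \<in> borel_measurable borel" "\<phi>' \<in> borel_measurable borel"
        using bounded_deriv_continuous[OF d] c by (auto intro: borel_measurable_continuous_onI)
      have phi2: "integrable ?P (\<lambda>v. (\<phi> (Y v))\<^sup>2)"
        by (rule P.square_integrable_lipschitz[OF _ Y2 d K]) simp
      have i1: "integrable ?P (\<lambda>v. (X (fst v) - m) * \<phi> (Y v))"
        by (rule integrable_mult_L2) (use i_fst[OF Xm2] phi2 in auto)
      have i2: "integrable ?P (\<lambda>v. (e * snd v) * \<phi> (Y v))"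
        by (rule integrable_mult_L2)
          (use i_snd[OF std_gaussian_moment_integrable[of 2]] phi2 in \<open>auto simp: power_mult_distrib\<close>)
      have phi'i: "integrable ?P (\<lambda>v. \<phi>' (Y v))"
        by (rule P.integrable_const_bound[where B = K]) (use K in auto)
      have phi'2: "integrable ?P (\<lambda>v. (\<phi>' (Y v))\<^sup>2)"
        by (rule P.integrable_const_bound[where B = "K\<^sup>2"])
          (use power_mono[OF K abs_ge_zero, where n = 2] in auto)
      have i3: "integrable ?P (\<lambda>v. \<tau> (fst v) * \<phi>' (Y v))"
        by (rule integrable_mult_L2) (use i_fst[OF \<tau>2] phi'2 in auto)
      have "(\<integral>v. (X (fst v) - m) * \<phi> (Y v) \<partial>?P) =
          (\<integral>g. \<integral>w. (X w - m) * \<phi> ((X w - m) + e * g) \<partial>M \<partial>std_gaussian)"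
        using P.integral_snd[of "\<lambda>w g. (X w - m) * \<phi> ((X w - m) + e * g)"] i1
        by (simp add: Y_def split_beta')
      also have "\<dots> = (\<integral>g. \<integral>w. \<tau> w * \<phi>' ((X w - m) + e * g) \<partial>M \<partial>std_gaussian)"
      proof -
        have "(\<integral>w. (X w - m) * \<phi> ((X w - m) + e * g) \<partial>M) = (\<integral>w. \<tau> w * \<phi>' ((X w - m) + e * g) \<partial>M)" for g
        proof (rule stein[where \<phi> = "\<lambda>x. \<phi> ((x - m) + e * g)" and \<phi>' = "\<lambda>x. \<phi>' ((x - m) + e * g)"])
          show "((\<lambda>x. \<phi> ((x - m) + e * g)) has_real_derivative \<phi>' ((x - m) + e * g)) (at x)" for x
          proof -
            have "((\<lambda>x. (x - m) + e * g) has_real_derivative 1) (at x)"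
              by (auto intro!: derivative_eq_intros)
            from DERIV_chain2[OF d this] show ?thesis by simp
          qed
          show "continuous_on UNIV (\<lambda>x. \<phi>' ((x - m) + e * g))"
            by (intro continuous_on_compose2[OF c] continuous_intros) auto
        qed (rule K)
        then show ?thesis by simp
      qed
      also have "\<dots> = (\<integral>v. \<tau> (fst v) * \<phi>' (Y v) \<partial>?P)"
        using P.integral_snd[of "\<lambda>w g. \<tau> w * \<phi>' ((X w - m) + e * g)"] i3
        by (simp add: Y_def split_beta')
      finally have A: "(\<integral>v. (X (fst v) - m) * \<phi> (Y v) \<partial>?P) = (\<integral>v. \<tau> (fst v) * \<phi>' (Y v) \<partial>?P)" .
      have "(\<integral>v. (e * snd v) * \<phi> (Y v) \<partial>?P) =
          (\<integral>w. \<integral>g. (e * g) * \<phi> ((X w - m) + e * g) \<partial>std_gaussian \<partial>M)"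
        using P.integral_fst'[of "\<lambda>v. (e * snd v) * \<phi> (Y v)"] i2
        by (simp add: Y_def split_beta')
      also have "\<dots> = (\<integral>w. \<integral>g. e\<^sup>2 * \<phi>' ((X w - m) + e * g) \<partial>std_gaussian \<partial>M)"
      proof -
        have "(\<integral>g. (e * g) * \<phi> (a + e * g) \<partial>std_gaussian) = (\<integral>g. e\<^sup>2 * \<phi>' (a + e * g) \<partial>std_gaussian)" for a
        proof -
          have "(\<integral>g. g * \<phi> (a + e * g) \<partial>std_gaussian) = (\<integral>g. e * \<phi>' (a + e * g) \<partial>std_gaussian)"
          proof (rule gaussian_integration_by_parts[where K = "e * K"])
            show "((\<lambda>g. \<phi> (a + e * g)) has_real_derivative e * \<phi>' (a + e * g)) (at g)" for g
            proof -
              have "((\<lambda>g. a + e * g) has_real_derivative e) (at g)"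
                by (auto intro!: derivative_eq_intros)
              from DERIV_chain2[OF d this] show ?thesis by (simp add: mult.commute)
            qed
            show "continuous_on UNIV (\<lambda>g. e * \<phi>' (a + e * g))"
              by (intro continuous_intros continuous_on_compose2[OF c]) auto
            show "\<bar>e * \<phi>' (a + e * g)\<bar> \<le> e * K" for g
              using K e by (simp add: abs_mult)
          qed
          then show ?thesis by (simp add: mult.assoc power2_eq_square)
        qed
        then show ?thesis by simp
      qed
      also have "\<dots> = (\<integral>v. e\<^sup>2 * \<phi>' (Y v) \<partial>?P)"
        using P.integral_fst'[of "\<lambda>v. e\<^sup>2 * \<phi>' (Y v)"] phi'i
        by (simp add: Y_def split_beta')
      finally have B: "(\<integral>v. (e * snd v) * \<phi> (Y v) \<partial>?P) = (\<integral>v. e\<^sup>2 * \<phi>' (Y v) \<partial>?P)" .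
      have "(\<integral>v. Y v * \<phi> (Y v) \<partial>?P) = (\<integral>v. (X (fst v) - m) * \<phi> (Y v) + (e * snd v) * \<phi> (Y v) \<partial>?P)"
        by (intro Bochner_Integration.integral_cong) (auto simp: Y_def algebra_simps)
      also have "\<dots> = (\<integral>v. \<tau> (fst v) * \<phi>' (Y v) \<partial>?P) + (\<integral>v. e\<^sup>2 * \<phi>' (Y v) \<partial>?P)"
        using i1 i2 A B by simp
      also have "\<dots> = (\<integral>v. t v * \<phi>' (Y v) \<partial>?P)"
        using i3 phi'i by (simp add: t_def distrib_right)
      finally show ?thesis .
    qed
    obtain Q where Q: "Q \<in> borel_measurable borel" "distr ?P borel (\<lambda>v. Q (Y v)) = std_gaussian"
      "integrable ?P (\<lambda>v. (Y v - Q (Y v))\<^sup>2)"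
      "(\<integral>v. (Y v - Q (Y v))\<^sup>2 \<partial>?P) \<le> (\<integral>v. (t v - 1)\<^sup>2 \<partial>?P)"
      by (rule P.monotone_coupling_bound[of Y t "\<lambda>y. \<integral>w. normal_density (X w - m) e y \<partial>M", OF _ _ Y2 t2 stein_Y])
        (use dens e in \<open>auto simp: Yeq\<close>)
    note [measurable] = Q(1)
    define Z where "Z v = Q (Y v)" for v
    have [measurable]: "Z \<in> borel_measurable ?P" unfolding Z_def by measurable
    have triangle: "(X (fst v) - Z v)\<^sup>2 \<le> 3 * ((Y v - Z v)\<^sup>2 + m\<^sup>2 + e\<^sup>2 * (snd v)\<^sup>2)" for v
    proof -
      have *: "(a + b + c)\<^sup>2 \<le> 3 * (a\<^sup>2 + b\<^sup>2 + c\<^sup>2)" for a b c :: real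
      proof -
        have "0 \<le> (a - b)\<^sup>2 + (b - c)\<^sup>2 + (a - c)\<^sup>2" by simp
        then show ?thesis by (simp add: power2_eq_square algebra_simps)
      qed
      have eq: "X (fst v) - Z v = (Y v - Z v) + m + - (e * snd v)" by (simp add: Y_def)
      show ?thesis unfolding eq using *[of "Y v - Z v" m "- (e * snd v)"] by (simp add: power_mult_distrib)
    qed
    have iR: "integrable ?P (\<lambda>v. 3 * ((Y v - Z v)\<^sup>2 + m\<^sup>2 + e\<^sup>2 * (snd v)\<^sup>2))"
      using Q(3) i_snd[OF std_gaussian_moment_integrable[of 2]] by (simp add: Z_def)
    have iL: "integrable ?P (\<lambda>v. (X (fst v) - Z v)\<^sup>2)"
      by (rule Bochner_Integration.integrable_bound[OF iR])
        (use triangle in \<open>auto intro: order_trans[OF _ abs_ge_self]\<close>)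
    have "(\<integral>v. (X (fst v) - Z v)\<^sup>2 \<partial>?P) \<le> (\<integral>v. 3 * ((Y v - Z v)\<^sup>2 + m\<^sup>2 + e\<^sup>2 * (snd v)\<^sup>2) \<partial>?P)"
      by (intro Bochner_Integration.integral_mono iL iR triangle)
    also have "\<dots> = 3 * ((\<integral>v. (Y v - Z v)\<^sup>2 \<partial>?P) + m\<^sup>2 + e\<^sup>2)"
      using Q(3) i_snd[OF std_gaussian_moment_integrable[of 2]] e_snd[OF std_gaussian_moment_integrable[of 2]]
      by (simp add: Z_def std_gaussian_moments P.prob_space)
    also have "\<dots> \<le> 3 * ((\<integral>w. (\<tau> w + e\<^sup>2 - 1)\<^sup>2 \<partial>M) + m\<^sup>2 + e\<^sup>2)"
    proof -
      have "integrable M (\<lambda>w. (\<tau> w + e\<^sup>2 - 1)\<^sup>2)"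
        using \<tau>1 \<tau>2 by (simp add: power2_diff power2_sum distrib_right)
      from e_fst[OF this] Q(4) show ?thesis by (simp add: t_def Z_def)
    qed
    finally have le: "(\<integral>v. (X (fst v) - Z v)\<^sup>2 \<partial>?P) \<le> 3 * ((\<integral>w. (\<tau> w + e\<^sup>2 - 1)\<^sup>2 \<partial>M) + m\<^sup>2 + e\<^sup>2)" .
    have "distr ?P borel (\<lambda>v. X (fst v)) = distr (distr ?P M fst) borel X"
      by (subst distr_distr) (auto simp: o_def)
    also have "distr ?P M fst = M" by (rule G.distr_pair_fst)
    finally have dX: "distr ?P borel (\<lambda>v. X (fst v)) = distr M borel X" .
    have dZ: "distr ?P borel Z = std_gaussian" using Q(2) by (simp add: Z_def[abs_def])
    have "?inf \<le> ennreal (\<integral>v. (X (fst v) - Z v)\<^sup>2 \<partial>?P)"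
      using coupling_cost_le[OF P.prob_space_axioms, of "\<lambda>v. X (fst v)" Z] iL by (simp add: dX dZ)
    also have "\<dots> \<le> ennreal (3 * ((\<integral>w. (\<tau> w + e\<^sup>2 - 1)\<^sup>2 \<partial>M) + m\<^sup>2 + e\<^sup>2))"
      using le by (rule ennreal_leI)
    finally show ?thesis .
  qed
  define D where "D = (\<integral>w. (\<tau> w - 1)\<^sup>2 \<partial>M)"
  have expand: "(\<integral>w. (\<tau> w + e\<^sup>2 - 1)\<^sup>2 \<partial>M) = D + 2 * e\<^sup>2 * (\<integral>w. \<tau> w - 1 \<partial>M) + e ^ 4" for e :: real
  proof -
    have "(\<tau> w + e\<^sup>2 - 1)\<^sup>2 = (\<tau> w - 1)\<^sup>2 + 2 * e\<^sup>2 * (\<tau> w - 1) + e ^ 4" for w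
      by (simp add: power2_eq_square algebra_simps eval_nat_numeral)
    moreover have "integrable M (\<lambda>w. (\<tau> w - 1)\<^sup>2)" using \<tau>1 \<tau>2 by (simp add: power2_diff)
    ultimately show ?thesis using \<tau>1 by (simp add: D_def M.prob_space)
  qed
  have "?inf \<le> ennreal (3 * (D + m\<^sup>2))"
  proof (rule tendsto_lowerbound)
    have "((\<lambda>e. 3 * (D + 2 * e\<^sup>2 * (\<integral>w. \<tau> w - 1 \<partial>M) + e ^ 4 + m\<^sup>2 + e\<^sup>2)) \<longlongrightarrow>
        3 * (D + 2 * 0\<^sup>2 * (\<integral>w. \<tau> w - 1 \<partial>M) + 0 ^ 4 + m\<^sup>2 + 0\<^sup>2)) (at_right (0::real))"
      by (intro tendsto_intros)
    then show "((\<lambda>e. ennreal (3 * (D + 2 * e\<^sup>2 * (\<integral>w. \<tau> w - 1 \<partial>M) + e ^ 4 + m\<^sup>2 + e\<^sup>2))) \<longlongrightarrow>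
        ennreal (3 * (D + m\<^sup>2))) (at_right 0)"
      by (intro tendsto_ennrealI) simp
    show "\<forall>\<^sub>F e in at_right 0. ?inf \<le> ennreal (3 * (D + 2 * e\<^sup>2 * (\<integral>w. \<tau> w - 1 \<partial>M) + e ^ 4 + m\<^sup>2 + e\<^sup>2))"
      using bound by (auto simp: expand eventually_at_right_field intro!: exI[of _ 1])
  qed simp
  moreover have "D \<ge> 0" unfolding D_def by simp
  ultimately show ?thesis
    unfolding W2_def D_def[symmetric] by (intro ennreal_sqrt_le) auto
qed

section \<open>The arcsine and semicircle laws\<close>

definition arcsine_moment :: "nat \<Rightarrow> real" where
  "arcsine_moment n = (\<integral>x. x ^ n \<partial>arcsine_measure)"

definition sc_moment :: "nat \<Rightarrow> real" where
  "sc_moment n = (\<integral>x. x ^ n \<partial>mu_sc)"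

lemma sets_arcsine_measure [simp, measurable_cong]: "sets arcsine_measure = sets borel"
  and space_arcsine_measure [simp]: "space arcsine_measure = UNIV"
  and sets_mu_sc [simp, measurable_cong]: "sets mu_sc = sets borel"
  and space_mu_sc [simp]: "space mu_sc = UNIV"
  by (simp_all add: arcsine_measure_def mu_sc_def)

lemma arcsine_density_nonneg: "0 \<le> indicator {-1<..<1} x / (pi * sqrt (1 - x\<^sup>2))"
  by (auto simp: indicator_def abs_square_le_1 intro!: divide_nonneg_nonneg mult_nonneg_nonneg)

lemma square_less_1: "x \<in> {-1<..<1} \<Longrightarrow> x\<^sup>2 < (1::real)"
  using abs_square_less_1[of x] by (simp add: abs_if)

text \<open>The primitive is \<open>arcsin\<close>.\<close>

lemma integral_arcsine_density:
  shows "integrable lborel (\<lambda>x. indicator {-1<..<1} x / (pi * sqrt (1 - x\<^sup>2)))"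
    and "(\<integral>x. indicator {-1<..<1} x / (pi * sqrt (1 - x\<^sup>2)) \<partial>lborel) = 1"
proof -
  have e: "einterval (ereal (-1)) (ereal 1) = {-1<..<1}" by simp
  have d: "(arcsin has_real_derivative inverse (sqrt (1 - x\<^sup>2))) (at x)"
    if "ereal (-1) < ereal x" "ereal x < ereal 1" for x
    using that DERIV_arcsin[of x] by simp
  have c: "isCont (\<lambda>x. inverse (sqrt (1 - x\<^sup>2))) x" if "ereal (-1) < ereal x" "ereal x < ereal 1" for x
    using that square_less_1[of x] by (intro continuous_intros) auto
  have n: "AE x in lborel. ereal (-1) < ereal x \<longrightarrow> ereal x < ereal 1 \<longrightarrow> 0 \<le> inverse (sqrt (1 - x\<^sup>2))"
    using square_less_1 by (intro AE_I2) (auto intro!: less_imp_le)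
  have l1: "(arcsin \<longlongrightarrow> arcsin (-1)) (at_right (-1))"
    using continuous_on_arcsin' continuous_on_subset
    by (intro continuous_on_tendsto_compose[OF continuous_on_arcsin'])
      (auto simp: eventually_at_right_field intro!: exI[of _ 0])
  have l2: "(arcsin \<longlongrightarrow> arcsin 1) (at_left 1)"
    by (intro continuous_on_tendsto_compose[OF continuous_on_arcsin'])
      (auto simp: eventually_at_left_field intro!: exI[of _ 0])
  have L1: "((arcsin \<circ> real_of_ereal) \<longlongrightarrow> arcsin (-1)) (at_right (ereal (-1)))"
    using l1 by (simp add: ereal_tendsto_simps)
  have L2: "((arcsin \<circ> real_of_ereal) \<longlongrightarrow> arcsin 1) (at_left (ereal 1))"
    using l2 by (simp add: ereal_tendsto_simps)
  have i: "set_integrable lborel {-1<..<1} (\<lambda>x::real. inverse (sqrt (1 - x\<^sup>2)))"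
    using interval_integral_FTC_nonneg(1)[OF _ d c n L1 L2] unfolding e by simp
  have v: "interval_lebesgue_integral lborel (ereal (-1)) (ereal 1) (\<lambda>x. inverse (sqrt (1 - x\<^sup>2))) = pi"
    using interval_integral_FTC_nonneg(2)[OF _ d c n L1 L2] by simp
  have eq: "indicator {-1<..<1} x / (pi * sqrt (1 - x\<^sup>2)) =
      (indicator {-1<..<1} x * inverse (sqrt (1 - x\<^sup>2))) / pi" for x :: real
    by (simp add: divide_inverse)
  show "integrable lborel (\<lambda>x. indicator {-1<..<1} x / (pi * sqrt (1 - x\<^sup>2)))"
    using i unfolding eq set_integrable_def by simp
  show "(\<integral>x. indicator {-1<..<1} x / (pi * sqrt (1 - x\<^sup>2)) \<partial>lborel) = 1"
    using v unfolding eq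
    by (simp add: interval_lebesgue_integral_def set_lebesgue_integral_def e)
qed

lemma prob_space_arcsine: "prob_space arcsine_measure"
proof
  have "emeasure arcsine_measure UNIV = (\<integral>\<^sup>+x. ennreal (indicator {-1<..<1} x / (pi * sqrt (1 - x\<^sup>2))) \<partial>lborel)"
    unfolding arcsine_measure_def by (subst emeasure_density) auto
  also have "\<dots> = 1"
    by (subst nn_integral_eq_integral[OF integral_arcsine_density(1)])
      (use arcsine_density_nonneg integral_arcsine_density(2) in auto)
  finally show "emeasure arcsine_measure (space arcsine_measure) = 1" by simp
qed

lemma integral_arcsine:
  fixes f :: "real \<Rightarrow> real"
  assumes [measurable]: "f \<in> borel_measurable borel"
  shows "integral\<^sup>L arcsine_measure f = (\<integral>x. indicator {-1<..<1} x / (pi * sqrt (1 - x\<^sup>2)) * f x \<partial>lborel)"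
  and "integrable arcsine_measure f \<longleftrightarrow> integrable lborel (\<lambda>x. indicator {-1<..<1} x / (pi * sqrt (1 - x\<^sup>2)) * f x)"
  unfolding arcsine_measure_def using arcsine_density_nonneg
  by (simp_all add: integral_density integrable_density)

lemma AE_arcsine_interval: "AE x in arcsine_measure. x \<in> {-1<..<1}"
  unfolding arcsine_measure_def by (subst AE_density) (auto simp: indicator_def)

lemma AE_arcsine_neq: "AE x in arcsine_measure. x \<noteq> y"
  unfolding arcsine_measure_def
  by (subst AE_density) (use AE_lborel_singleton[of y] in \<open>auto elim!: eventually_mono\<close>)

lemma poly_measurable [measurable]: "poly p \<in> borel_measurable (borel :: real measure)"
  by (intro borel_measurable_continuous_onI continuous_intros)

lemma poly_bounded_interval: "\<exists>B. \<forall>x\<in>{-1<..<1}. \<bar>poly p x\<bar> \<le> (B::real)"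
proof -
  have "compact (poly p ` {-1..1})"
    by (intro compact_continuous_image continuous_intros) auto
  then obtain B where "\<forall>y\<in>poly p ` {-1..1}. norm y \<le> B"
    using compact_imp_bounded bounded_iff by metis
  then show ?thesis by (intro exI[of _ B]) auto
qed

lemma integrable_arcsine_poly [simp]: "integrable arcsine_measure (poly p)"
proof -
  interpret A: prob_space arcsine_measure by (rule prob_space_arcsine)
  obtain B where "\<forall>x\<in>{-1<..<1}. \<bar>poly p x\<bar> \<le> B" using poly_bounded_interval by blast
  then show ?thesis
    by (intro A.integrable_const_bound[where B = B] eventually_mono[OF AE_arcsine_interval]) auto
qed

lemma mu_sc_eq_arcsine:
  "integrable mu_sc (poly p)"
  "integral\<^sup>L mu_sc (poly p) = 2 * integral\<^sup>L arcsine_measure (poly ([:1, 0, -1:] * p))"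
proof -
  have nn: "0 \<le> 2 / pi * sqrt (1 - x\<^sup>2) * indicator {-1<..<1} x" for x :: real
    using square_less_1[of x] by (auto simp: indicator_def intro!: mult_nonneg_nonneg less_imp_le)
  have eq: "2 / pi * sqrt (1 - x\<^sup>2) * indicator {-1<..<1} x * poly p x =
      2 * (indicator {-1<..<1} x / (pi * sqrt (1 - x\<^sup>2)) * poly ([:1, 0, -1:] * p) x)" for x
  proof (cases "x \<in> {-1<..<1}")
    case True
    then have "x\<^sup>2 < 1" by (rule square_less_1)
    define r where "r = sqrt (1 - x\<^sup>2)"
    have r: "r > 0" "1 - x\<^sup>2 = r * r" using \<open>x\<^sup>2 < 1\<close> by (simp_all add: r_def)
    have "poly ([:1, 0, -1:] * p) x = (1 - x\<^sup>2) * poly p x"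
      by (simp add: power2_eq_square algebra_simps)
    then have pe: "poly ([:1, 0, -1:] * p) x = r * r * poly p x" by (simp only: r)
    show ?thesis unfolding pe r_def[symmetric] using True r(1) by simp
  qed simp
  have i: "integrable lborel (\<lambda>x. indicator {-1<..<1} x / (pi * sqrt (1 - x\<^sup>2)) * poly ([:1, 0, -1:] * p) x)"
    using integrable_arcsine_poly[of "[:1, 0, -1:] * p"] by (subst (asm) integral_arcsine) auto
  have m: "(\<lambda>x::real. 2 / pi * sqrt (1 - x\<^sup>2) * indicator {-1<..<1} x) \<in> borel_measurable lborel"
    by measurable
  have mp: "poly p \<in> borel_measurable lborel" by measurable
  show "integrable mu_sc (poly p)"
    unfolding mu_sc_def
    using nn m mp integrable_mult_right[OF i, of 2]
    by (subst integrable_density) (auto simp only: real_scaleR_def eq intro!: AE_I2)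
  have "integral\<^sup>L mu_sc (poly p) = (\<integral>x. 2 / pi * sqrt (1 - x\<^sup>2) * indicator {-1<..<1} x * poly p x \<partial>lborel)"
    unfolding mu_sc_def using nn m by (subst integral_density) (auto simp: measurable_lborel1)
  also have "\<dots> = 2 * integral\<^sup>L arcsine_measure (poly ([:1, 0, -1:] * p))"
    by (simp only: eq integral_arcsine(1)[OF poly_measurable] integral_mult_right_zero)
  finally show "integral\<^sup>L mu_sc (poly p) = 2 * integral\<^sup>L arcsine_measure (poly ([:1, 0, -1:] * p))" .
qed

text \<open>Divided by \<open>sqrt (1 - x\<^sup>2)\<close>, the integrand is the derivative of \<open>sqrt (1 - x\<^sup>2) * p x\<close>, which
  vanishes at both endpoints. This determines all moments of the arcsine law.\<close>

lemma arcsine_integration_by_parts: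
  "integral\<^sup>L arcsine_measure (poly ([:1, 0, -1:] * pderiv p - [:0, 1:] * p)) = 0"
proof -
  let ?g = "[:1, 0, -1:] * pderiv p - [:0, 1:] * p"
  have g: "poly ?g x = (1 - x\<^sup>2) * poly (pderiv p) x - x * poly p x" for x
    by (simp add: power2_eq_square algebra_simps)
  have e: "einterval (ereal (-1)) (ereal 1) = {-1<..<1}" by simp
  let ?F = "\<lambda>x. sqrt (1 - x\<^sup>2) * poly p x"
  have lim: "(?F \<longlongrightarrow> ?F a) (at a within S)" for a S
    by (intro tendsto_intros tendsto_ident_at poly_isCont[THEN isCont_tendsto_compose]) 
  have "interval_lebesgue_integral lborel (ereal (-1)) (ereal 1) (\<lambda>x. inverse (sqrt (1 - x\<^sup>2)) * poly ?g x) = 0 - 0"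
  proof (rule interval_integral_FTC_integrable[where F = ?F])
    fix x assume x: "ereal (-1) < ereal x" "ereal x < ereal 1"
    then have x2: "x\<^sup>2 < 1" using square_less_1[of x] by simp
    have s: "sqrt (1 - x\<^sup>2) * sqrt (1 - x\<^sup>2) = 1 - x\<^sup>2" using x2 by simp
    have "(?F has_real_derivative (inverse (sqrt (1 - x\<^sup>2)) / 2 * (- (2 * x))) * poly p x
        + sqrt (1 - x\<^sup>2) * poly (pderiv p) x) (at x)"
      using x2 by (auto intro!: derivative_eq_intros simp: field_simps)
    also have "(inverse (sqrt (1 - x\<^sup>2)) / 2 * (- (2 * x))) * poly p x
        + sqrt (1 - x\<^sup>2) * poly (pderiv p) x = inverse (sqrt (1 - x\<^sup>2)) * poly ?g x"
      unfolding g using x2 s by (simp add: field_simps)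
    finally show "(?F has_vector_derivative inverse (sqrt (1 - x\<^sup>2)) * poly ?g x) (at x)"
      by (simp add: has_real_derivative_iff_has_vector_derivative)
    show "isCont (\<lambda>x. inverse (sqrt (1 - x\<^sup>2)) * poly ?g x) x"
      using x2 by (intro continuous_intros) auto
  next
    have "integrable lborel (\<lambda>x. pi * (indicator {-1<..<1} x / (pi * sqrt (1 - x\<^sup>2)) * poly ?g x))"
      using integral_arcsine(2)[OF poly_measurable, THEN iffD1, OF integrable_arcsine_poly]
      by (rule integrable_mult_right)
    moreover have "(\<lambda>x. pi * (indicator {-1<..<1} x / (pi * sqrt (1 - x\<^sup>2)) * poly ?g x)) =
      (\<lambda>x. indicator {-1<..<1} x *\<^sub>R (inverse (sqrt (1 - x\<^sup>2)) * poly ?g x))"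
    proof (rule ext)
      have "pi * (i / (pi * s) * g) = i *\<^sub>R (inverse s * g)" for i s g :: real
        by (simp add: field_simps)
      then show "pi * (indicator {-1<..<1} x / (pi * sqrt (1 - x\<^sup>2)) * poly ?g x) =
        indicator {-1<..<1} x *\<^sub>R (inverse (sqrt (1 - x\<^sup>2)) * poly ?g x)" for x .
    qed
    ultimately have "integrable lborel (\<lambda>x. indicator {-1<..<1} x *\<^sub>R (inverse (sqrt (1 - x\<^sup>2)) * poly ?g x))"
      by (simp only:)
    then show "set_integrable lborel (einterval (ereal (-1)) (ereal 1)) (\<lambda>x. inverse (sqrt (1 - x\<^sup>2)) * poly ?g x)"
      unfolding set_integrable_def e .
    show "((?F \<circ> real_of_ereal) \<longlongrightarrow> 0) (at_right (ereal (-1)))"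
      using lim[of "-1"] by (simp add: ereal_tendsto_simps)
    show "((?F \<circ> real_of_ereal) \<longlongrightarrow> 0) (at_left (ereal 1))"
      using lim[of 1] by (simp add: ereal_tendsto_simps)
  qed simp
  then have "(\<integral>x. indicator {-1<..<1} x * (inverse (sqrt (1 - x\<^sup>2)) * poly ?g x) \<partial>lborel) = 0"
    unfolding interval_lebesgue_integral_def set_lebesgue_integral_def e by simp
  moreover have "integral\<^sup>L arcsine_measure (poly ?g) =
      (\<integral>x. inverse pi * (indicator {-1<..<1} x * (inverse (sqrt (1 - x\<^sup>2)) * poly ?g x)) \<partial>lborel)"
  proof -
    have "i / (pi * s) * g = inverse pi * (i * (inverse s * g))" for i s g :: real
      by (simp add: field_simps)
    then show ?thesis by (simp only: integral_arcsine(1)[OF poly_measurable])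
  qed
  ultimately show ?thesis by simp
qed

section \<open>Moment functionals and difference quotients\<close>

text \<open>A linear functional on polynomials is represented by its moment sequence. Then
  \<open>moment_functional_pCons\<close> turns identities between such functionals into inductions on the polynomial,
  and the same notation serves for integrals, for evaluation at a point, and for the random functional
  with moments \<open>\<nu>\<^sub>k\<close>.\<close>

definition moment_functional :: "(nat \<Rightarrow> real) \<Rightarrow> real poly \<Rightarrow> real" where
  "moment_functional c p = (\<Sum>k\<le>degree p. coeff p k * c k)"

lemma moment_functional_le:
  assumes "degree p \<le> d"
  shows "moment_functional c p = (\<Sum>k\<le>d. coeff p k * c k)"
  unfolding moment_functional_def
  by (rule sum.mono_neutral_left) (use assms in \<open>auto simp: coeff_eq_0\<close>)

lemma moment_functional_add: "moment_functional c (p + q) = moment_functional c p + moment_functional c q"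
proof -
  let ?d = "max (degree p) (degree q)"
  have "degree (p + q) \<le> ?d" by (rule degree_add_le) auto
  then show ?thesis
    by (simp add: moment_functional_le[of _ ?d] distrib_right sum.distrib)
qed

lemma moment_functional_smult: "moment_functional c (smult a p) = a * moment_functional c p"
  by (simp add: moment_functional_le[OF degree_smult_le] moment_functional_def sum_distrib_left mult.assoc)

lemma moment_functional_0 [simp]: "moment_functional c 0 = 0"
  by (simp add: moment_functional_def)

lemma moment_functional_diff: "moment_functional c (p - q) = moment_functional c p - moment_functional c q"
  using moment_functional_add[of c p "- q"] moment_functional_smult[of c "-1" q] by simp

lemma moment_functional_pCons:
  "moment_functional c (pCons a p) = a * c 0 + moment_functional (\<lambda>k. c (Suc k)) p"
proof -
  have "moment_functional c (pCons a p) = (\<Sum>k\<le>Suc (degree p). coeff (pCons a p) k * c k)"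
    by (rule moment_functional_le) (rule degree_pCons_le)
  also have "\<dots> = a * c 0 + (\<Sum>k\<le>degree p. coeff p k * c (Suc k))"
    by (subst sum.atMost_Suc_shift) simp
  finally show ?thesis by (simp add: moment_functional_def)
qed

lemma moment_functional_scale: "moment_functional (\<lambda>k. a * c k) p = a * moment_functional c p"
  by (simp add: moment_functional_def sum_distrib_left algebra_simps)

lemma moment_functional_poly: "moment_functional (\<lambda>k. x ^ k) p = poly p x"
  by (induction p) (simp_all add: moment_functional_pCons moment_functional_scale)

lemma integral_poly_moments:
  fixes M :: "real measure"
  assumes "\<And>k. integrable M (\<lambda>x. x ^ k)"
  shows "integral\<^sup>L M (poly p) = moment_functional (\<lambda>k. \<integral>x. x ^ k \<partial>M) p"
proof -
  have "poly p = (\<lambda>x. \<Sum>k\<le>degree p. coeff p k * x ^ k)" by (rule ext) (simp add: poly_altdef)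
  then show ?thesis using assms by (simp add: moment_functional_def)
qed

text \<open>The functional with moments \<open>c\<close>, applied in the variable \<open>x\<close> to the polynomial
  \<open>(p x - p y) / (x - y)\<close> of \<open>x\<close> and \<open>y\<close>; the result is a polynomial in \<open>y\<close>. For the moments \<open>y ^ a\<close> of the
  evaluation at \<open>y\<close> this is the difference quotient itself
  (\<open>poly_difference_quotient_powers\<close>).\<close>

definition difference_quotient :: "(nat \<Rightarrow> real) \<Rightarrow> real poly \<Rightarrow> real poly" where
  "difference_quotient c p = (\<Sum>k\<le>degree p. smult (coeff p k) (\<Sum>a<k. monom (c a) (k - 1 - a)))"

lemma difference_quotient_0 [simp]: "difference_quotient c 0 = 0"
  by (simp add: difference_quotient_def)

lemma sum_pCons_0: "(\<Sum>i\<in>A. pCons 0 (g i)) = pCons 0 (\<Sum>i\<in>A. g i :: real poly)"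
  by (induction A rule: infinite_finite_induct) simp_all

text \<open>\<open>(x p x - y p y) / (x - y) = p x + y (p x - p y) / (x - y)\<close>.\<close>

lemma difference_quotient_pCons:
  "difference_quotient c (pCons a p) = pCons (moment_functional c p) (difference_quotient c p)"
proof (cases "p = 0")
  case True then show ?thesis by (cases "a = 0") (simp_all add: difference_quotient_def)
next
  case False
  have step: "(\<Sum>a<Suc k. monom (c a) (Suc k - 1 - a)) = [:c k:] + pCons 0 (\<Sum>a<k. monom (c a) (k - 1 - a))" for k
  proof -
    have "(\<Sum>a<k. monom (c a) (k - a)) = (\<Sum>a<k. pCons 0 (monom (c a) (k - 1 - a)))"
    proof (rule sum.cong[OF refl])
      fix a assume "a \<in> {..<k}"
      then have "k - a = Suc (k - 1 - a)" by simp
      then show "monom (c a) (k - a) = pCons 0 (monom (c a) (k - 1 - a))" by (simp only: monom_Suc)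
    qed
    then show ?thesis by (simp add: monom_0 sum_pCons_0)
  qed
  have "difference_quotient c (pCons a p) =
      (\<Sum>k\<le>Suc (degree p). smult (coeff (pCons a p) k) (\<Sum>a<k. monom (c a) (k - 1 - a)))"
    using False by (simp add: difference_quotient_def)
  also have "\<dots> = (\<Sum>k\<le>degree p. smult (coeff p k) (\<Sum>a<Suc k. monom (c a) (Suc k - 1 - a)))"
    by (subst sum.atMost_Suc_shift) simp
  also have "\<dots> = (\<Sum>k\<le>degree p. [:coeff p k * c k:] +
      pCons 0 (smult (coeff p k) (\<Sum>a<k. monom (c a) (k - 1 - a))))"
    unfolding step by simp
  also have "\<dots> = [:moment_functional c p:] + pCons 0 (difference_quotient c p)"
    by (simp only: sum.distrib sum_pCons_0 sum_to_poly moment_functional_def difference_quotient_def)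
  finally show ?thesis by simp
qed

lemma poly_difference_quotient_powers:
  "(x - y) * poly (difference_quotient (\<lambda>a. y ^ a) p) x = poly p x - poly p y"
proof (induction p)
  case (pCons c p)
  let ?D = "poly (difference_quotient (\<lambda>a. y ^ a) p) x"
  have "(x - y) * (poly p y + x * ?D) = (x - y) * poly p y + x * ((x - y) * ?D)"
    by (simp add: algebra_simps)
  then show ?case
    unfolding difference_quotient_pCons pCons.IH by (simp add: moment_functional_poly pCons.IH algebra_simps)
qed simp

lemma smult_sum_right: "smult c (\<Sum>i\<in>A. g i) = (\<Sum>i\<in>A. smult c (g i :: real poly))"
  by (induction A rule: infinite_finite_induct) (simp_all add: smult_add_right)

lemma moment_functional_difference_quotient:
  "moment_functional s (difference_quotient c p * q) =
    (\<Sum>k\<le>degree p. \<Sum>a<k. coeff p k * c a * moment_functional s (monom 1 (k - 1 - a) * q))"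
proof -
  have sum: "moment_functional s (\<Sum>i\<in>A. g i) = (\<Sum>i\<in>A. moment_functional s (g i))" for A :: "nat set" and g
    by (induction A rule: infinite_finite_induct) (simp_all add: moment_functional_add)
  have "difference_quotient c p * q = (\<Sum>k\<le>degree p. \<Sum>a<k. smult (coeff p k * c a) (monom 1 (k - 1 - a) * q))"
    by (simp add: difference_quotient_def sum_distrib_right smult_sum_right smult_monom flip: mult_smult_left)
  then show ?thesis by (simp only: sum moment_functional_smult)
qed

section \<open>Convolution identities for the moments\<close>

lemma power_integrable:
  "integrable arcsine_measure (\<lambda>x. x ^ k)" "integrable mu_sc (\<lambda>x. x ^ k)"
  using integrable_arcsine_poly[of "monom 1 k"] mu_sc_eq_arcsine(1)[of "monom 1 k"]
  by (simp_all add: poly_monom[abs_def])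

lemma integral_arcsine_poly: "integral\<^sup>L arcsine_measure (poly p) = moment_functional arcsine_moment p"
  unfolding arcsine_moment_def[abs_def] by (rule integral_poly_moments) (rule power_integrable)

lemma integral_mu_sc_poly: "integral\<^sup>L mu_sc (poly p) = moment_functional sc_moment p"
  unfolding sc_moment_def[abs_def] by (rule integral_poly_moments) (rule power_integrable)

lemma sc_eq_arcsine: "moment_functional sc_moment p = 2 * moment_functional arcsine_moment ([:1, 0, -1:] * p)"
  using mu_sc_eq_arcsine(2)[of p] by (simp only: integral_arcsine_poly integral_mu_sc_poly)

lemma moment_functional_monom: "moment_functional c (monom a n) = a * c n"
proof (induction n arbitrary: c)
  case 0 then show ?case by (simp add: monom_0 moment_functional_pCons)
next
  case (Suc n) show ?case by (simp add: monom_Suc moment_functional_pCons Suc)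
qed

lemma arcsine_moment_0 [simp]: "arcsine_moment 0 = 1"
  using prob_space.prob_space[OF prob_space_arcsine] by (simp add: arcsine_moment_def)

lemma arcsine_moment_1 [simp]: "arcsine_moment (Suc 0) = 0"
  using arcsine_integration_by_parts[of 1]
  by (simp only: integral_arcsine_poly) (simp add: moment_functional_pCons pderiv_1)

lemma arcsine_moment_rec: "real (n + 2) * arcsine_moment (n + 2) = real (n + 1) * arcsine_moment n"
proof -
  have m: "[:1, 0, -1:] * monom c n = monom c n - monom c (Suc (Suc n))"
    "[:0, 1:] * monom c n = monom c (Suc n)" for c :: real and n
    by (simp_all add: monom_Suc)
  have "[:1, 0, -1:] * pderiv (monom 1 (n + 1)) - [:0, 1:] * monom 1 (n + 1)
     = monom (real (n + 1)) n - (monom (real (n + 1)) (n + 2) + monom 1 (n + 2))"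
    by (simp only: pderiv_monom m) simp
  also have "\<dots> = monom (real (n + 1)) n - monom (real (n + 2)) (n + 2)"
    by (simp add: add_monom)
  finally have "[:1, 0, -1:] * pderiv (monom 1 (n + 1)) - [:0, 1:] * monom 1 (n + 1)
     = monom (real (n + 1)) n - monom (real (n + 2)) (n + 2)" .
  then have "moment_functional arcsine_moment (monom (real (n + 1)) n - monom (real (n + 2)) (n + 2)) = 0"
    using arcsine_integration_by_parts[of "monom 1 (n + 1)"] by (simp only: integral_arcsine_poly)
  then show ?thesis by (simp add: moment_functional_diff moment_functional_monom)
qed

lemma sc_moment_eq: "sc_moment n = 2 * (arcsine_moment n - arcsine_moment (n + 2))"
proof -
  have "[:1, 0, -1:] * monom 1 n = monom (1::real) n - monom 1 (n + 2)"
    by (simp add: monom_Suc)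
  then show ?thesis using sc_eq_arcsine[of "monom 1 n"]
    by (simp add: moment_functional_diff moment_functional_monom)
qed

lemma sc_moment_0 [simp]: "sc_moment 0 = 1"
  using sc_moment_eq[of 0] arcsine_moment_rec[of 0] by simp

lemma sc_moment_1 [simp]: "sc_moment (Suc 0) = 0"
  using sc_moment_eq[of 1] arcsine_moment_rec[of 1] by simp

lemma sc_moment_2: "sc_moment 2 = 1 / 4"
proof -
  have "arcsine_moment 2 = 1 / 2" using arcsine_moment_rec[of 0] by (simp add: numeral_2_eq_2)
  then show ?thesis using sc_moment_eq[of 2] arcsine_moment_rec[of 2] by simp
qed

text \<open>The recursion for the arcsine moments says that \<open>A\<close> solves \<open>(1 - X\<^sup>2) A' = X A\<close>, hence
  \<open>(1 - X\<^sup>2) A\<^sup>2 = 1\<close>. As the semicircle density is \<open>2 (1 - x\<^sup>2)\<close> times the arcsine density, \<open>S\<close> is an affine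
  function of \<open>A\<close>, and both identities follow algebraically. The second is the functional equation of
  the Catalan numbers.\<close>

lemma moment_generating_identities:
  defines "A \<equiv> Abs_fps arcsine_moment" and "S \<equiv> Abs_fps sc_moment"
  shows "S * A * fps_X\<^sup>2 = 2 * (A - 1)" and "S * S * fps_X\<^sup>2 = 4 * (S - 1)"
proof -
  have coeff2: "fps_nth (fps_X\<^sup>2 * f) n = (if n < 2 then 0 else fps_nth f (n - 2))" for f :: "real fps" and n
    by (simp add: fps_X_power_mult_nth)
  have ode: "(1 - fps_X\<^sup>2) * fps_deriv A = fps_X * A"
  proof (rule fps_ext)
    fix n
    have "fps_nth ((1 - fps_X\<^sup>2) * fps_deriv A) n =
        real (n + 1) * arcsine_moment (n + 1) - (if n < 2 then 0 else real (n - 1) * arcsine_moment (n - 1))"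
    proof (cases "n < 2")
      case False
      then obtain k where "n = k + 2" using le_Suc_ex[of 2 n] by (auto simp: add.commute)
      then show ?thesis by (simp add: A_def left_diff_distrib coeff2)
    qed (simp add: A_def left_diff_distrib coeff2)
    moreover have "fps_nth (fps_X * A) n = (if n = 0 then 0 else arcsine_moment (n - 1))"
      by (simp add: A_def)
    ultimately show "fps_nth ((1 - fps_X\<^sup>2) * fps_deriv A) n = fps_nth (fps_X * A) n"
      using arcsine_moment_rec[of "n - 1"] by (cases n; cases "n - 1") (auto simp: algebra_simps)
  qed
  have "fps_deriv ((1 - fps_X\<^sup>2) * A\<^sup>2) = 2 * A * ((1 - fps_X\<^sup>2) * fps_deriv A - fps_X * A)"
    by (simp add: power2_eq_square algebra_simps)
  then have "fps_deriv ((1 - fps_X\<^sup>2) * A\<^sup>2) = 0" by (simp add: ode)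
  then obtain c where "(1 - fps_X\<^sup>2) * A\<^sup>2 = fps_const c"
    unfolding fps_deriv_eq_0_iff by metis
  moreover have "fps_nth ((1 - fps_X\<^sup>2) * A\<^sup>2) 0 = 1"
    by (simp add: A_def fps_power_zeroth)
  ultimately have AA: "(1 - fps_X\<^sup>2) * A\<^sup>2 = 1" by simp
  have S: "fps_X\<^sup>2 * S = 2 * (1 - (1 - fps_X\<^sup>2) * A)"
  proof (rule fps_ext)
    fix n show "fps_nth (fps_X\<^sup>2 * S) n = fps_nth (2 * (1 - (1 - fps_X\<^sup>2) * A)) n"
    proof (cases "n < 2")
      case True
      then have "n = 0 \<or> n = 1" by auto
      then show ?thesis by (auto simp: A_def left_diff_distrib coeff2 numeral_fps_const)
    next
      case False
      then obtain k where "n = k + 2" using le_Suc_ex[of 2 n] by (auto simp: add.commute)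
      then show ?thesis using sc_moment_eq[of k]
        by (simp add: A_def S_def left_diff_distrib coeff2 numeral_fps_const)
    qed
  qed
  have "S * A * fps_X\<^sup>2 = (fps_X\<^sup>2 * S) * A" by (simp add: algebra_simps)
  also have "\<dots> = 2 * (A - (1 - fps_X\<^sup>2) * A\<^sup>2)" unfolding S by (simp add: algebra_simps power2_eq_square)
  finally show SA: "S * A * fps_X\<^sup>2 = 2 * (A - 1)" unfolding AA .
  have "fps_X\<^sup>2 * (S * S * fps_X\<^sup>2) = S * fps_X\<^sup>2 * (fps_X\<^sup>2 * S)" by (simp add: algebra_simps)
  also have "\<dots> = S * fps_X\<^sup>2 * (2 * (1 - (1 - fps_X\<^sup>2) * A))" by (simp only: S)
  also have "\<dots> = 2 * (fps_X\<^sup>2 * S) - 2 * (1 - fps_X\<^sup>2) * (S * A * fps_X\<^sup>2)" by (simp add: algebra_simps)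
  also have "\<dots> = 2 * (fps_X\<^sup>2 * S) - 2 * (1 - fps_X\<^sup>2) * (2 * (A - 1))" unfolding SA ..
  also have "\<dots> = 2 * (fps_X\<^sup>2 * S) + 2 * (2 * (1 - (1 - fps_X\<^sup>2) * A)) - 4 * fps_X\<^sup>2"
    by (simp add: algebra_simps)
  also have "\<dots> = 2 * (fps_X\<^sup>2 * S) + 2 * (fps_X\<^sup>2 * S) - 4 * fps_X\<^sup>2" by (simp only: S)
  also have "\<dots> = fps_X\<^sup>2 * (4 * (S - 1))" by (simp add: algebra_simps)
  finally show "S * S * fps_X\<^sup>2 = 4 * (S - 1)" by simp
qed

lemma sc_arcsine_convolution: "(\<Sum>a<k. arcsine_moment a * sc_moment (k - 1 - a)) = 2 * arcsine_moment (k + 1)"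
proof (cases k)
  case (Suc n)
  have "fps_nth (Abs_fps sc_moment * Abs_fps arcsine_moment * fps_X\<^sup>2) (n + 2) =
      fps_nth (2 * (Abs_fps arcsine_moment - 1)) (n + 2)"
    by (simp only: moment_generating_identities)
  then have "fps_nth (Abs_fps arcsine_moment * Abs_fps sc_moment) n = 2 * arcsine_moment (n + 2)"
    by (simp add: fps_X_power_mult_right_nth numeral_fps_const mult.commute)
  then show ?thesis
    by (simp add: fps_mult_nth Suc lessThan_Suc_atMost atLeast0AtMost)
qed simp

lemma sc_moment_convolution: "(\<Sum>a<k. sc_moment a * sc_moment (k - 1 - a)) = 4 * sc_moment (k + 1)"
proof (cases k)
  case (Suc n)
  have "fps_nth (Abs_fps sc_moment * Abs_fps sc_moment * fps_X\<^sup>2) (n + 2) =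
      fps_nth (4 * (Abs_fps sc_moment - 1)) (n + 2)"
    by (simp only: moment_generating_identities)
  then have "fps_nth (Abs_fps sc_moment * Abs_fps sc_moment) n = 4 * sc_moment (n + 2)"
    by (simp add: fps_X_power_mult_right_nth numeral_fps_const)
  then show ?thesis
    by (simp add: fps_mult_nth Suc lessThan_Suc_atMost atLeast0AtMost)
qed simp

lemma sc_of_arcsine_quotient:
  "moment_functional sc_moment (difference_quotient arcsine_moment p) =
    2 * moment_functional (\<lambda>k. arcsine_moment (Suc k)) p"
proof -
  have "moment_functional sc_moment (difference_quotient arcsine_moment p) =
      (\<Sum>k\<le>degree p. coeff p k * (\<Sum>a<k. arcsine_moment a * sc_moment (k - 1 - a)))"
    using moment_functional_difference_quotient[of sc_moment arcsine_moment p 1]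
    by (simp add: moment_functional_monom sum_distrib_left mult.assoc)
  also have "\<dots> = (\<Sum>k\<le>degree p. coeff p k * (2 * arcsine_moment (k + 1)))"
    by (simp only: sc_arcsine_convolution)
  also have "\<dots> = 2 * moment_functional (\<lambda>k. arcsine_moment (Suc k)) p"
    by (simp add: moment_functional_def sum_distrib_left mult_ac)
  finally show ?thesis .
qed

text \<open>On the left, \<open>h \<mapsto> 4 x h - 2 \<integral> (h x - h y) / (x - y) d\<mu>\<^sub>s\<^sub>c\<close> is the linear part of the loop
  equation. Up to constants it is inverted by the difference quotient with the arcsine law. The
  induction step consumes \<open>sc_of_arcsine_quotient\<close>.\<close>

lemma drift_inversion:
  "smult 4 (pCons 0 (difference_quotient arcsine_moment p))
    - smult 2 (difference_quotient sc_moment (difference_quotient arcsine_moment p))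
   = smult 4 p - [:4 * moment_functional arcsine_moment p:]"
proof (induction p)
  case (pCons c p)
  let ?a = "moment_functional arcsine_moment p" and ?h = "difference_quotient arcsine_moment p"
  have "smult 4 (pCons 0 (pCons ?a ?h)) - smult 2 (pCons (moment_functional sc_moment ?h) (difference_quotient sc_moment ?h))
    = pCons (- (2 * moment_functional sc_moment ?h))
        ([:4 * ?a:] + (smult 4 (pCons 0 ?h) - smult 2 (difference_quotient sc_moment ?h)))"
    by simp
  then show ?case
    unfolding difference_quotient_pCons pCons.IH
    by (simp add: moment_functional_pCons sc_of_arcsine_quotient)
qed simp

section \<open>The variance functional\<close>

lemma difference_quotient_bounded:
  "\<exists>B. \<forall>x\<in>{-1<..<1}. \<forall>y\<in>{-1<..<1}. \<bar>poly (difference_quotient (\<lambda>a. y ^ a) p) x\<bar> \<le> B"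
proof -
  let ?B = "\<Sum>k\<le>degree p. \<Sum>a<k. \<bar>coeff p k\<bar>"
  have "\<bar>poly (difference_quotient (\<lambda>a. y ^ a) p) x\<bar> \<le> ?B"
    if "x \<in> {-1<..<1}" "y \<in> {-1<..<1}" for x y :: real
  proof -
    have x: "\<bar>x\<bar> \<le> 1" and y: "\<bar>y\<bar> \<le> 1" using that by auto
    have "poly (difference_quotient (\<lambda>a. y ^ a) p) x = (\<Sum>k\<le>degree p. \<Sum>a<k. coeff p k * (y ^ a * x ^ (k - 1 - a)))"
      by (simp add: difference_quotient_def poly_sum poly_monom sum_distrib_left)
    also have "\<bar>\<dots>\<bar> \<le> ?B"
    proof (intro order_trans[OF sum_abs] sum_mono)
      fix k a
      have "\<bar>y ^ a * x ^ (k - 1 - a)\<bar> \<le> 1"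
        using x y by (auto simp: abs_mult power_abs intro!: mult_le_one power_le_one)
      then show "\<bar>coeff p k * (y ^ a * x ^ (k - 1 - a))\<bar> \<le> \<bar>coeff p k\<bar>"
        using mult_left_mono[of _ 1 "\<bar>coeff p k\<bar>"] by (simp add: abs_mult)
    qed
    finally show ?thesis .
  qed
  then show ?thesis by blast
qed

lemma Sigma_integrable:
  "integrable (arcsine_measure \<Otimes>\<^sub>M arcsine_measure)
    (\<lambda>v. indicator ({-1<..<1} \<times> {-1<..<1}) v *
      (((poly p (fst v) - poly p (snd v)) / (fst v - snd v))\<^sup>2 * (1 - fst v * snd v)))"
proof -
  interpret A: prob_space arcsine_measure by (rule prob_space_arcsine)
  interpret AA: pair_prob_space arcsine_measure arcsine_measure
    by (intro pair_prob_space.intro pair_sigma_finite.intro A.prob_space_axioms A.sigma_finite_measure_axioms)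
  obtain B where B: "\<And>x y. x \<in> {-1<..<1} \<Longrightarrow> y \<in> {-1<..<1} \<Longrightarrow>
      \<bar>poly (difference_quotient (\<lambda>a. y ^ a) p) x\<bar> \<le> B"
    using difference_quotient_bounded[of p] by blast
  have "\<bar>((poly p x - poly p y) / (x - y))\<^sup>2 * (1 - x * y)\<bar> \<le> B\<^sup>2 * 2"
    if xy: "x \<in> {-1<..<1}" "y \<in> {-1<..<1}" for x y
  proof -
    have "\<bar>(poly p x - poly p y) / (x - y)\<bar> \<le> B"
    proof (cases "x = y")
      case True then show ?thesis using B[OF xy] by simp
    next
      case False
      then have "(poly p x - poly p y) / (x - y) = poly (difference_quotient (\<lambda>a. y ^ a) p) x"
        by (simp add: poly_difference_quotient_powers[symmetric])
      then show ?thesis using B[OF xy] by simp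
    qed
    then have "((poly p x - poly p y) / (x - y))\<^sup>2 \<le> B\<^sup>2"
      by (metis abs_ge_zero power2_abs power_mono)
    moreover have "\<bar>1 - x * y\<bar> \<le> 2"
    proof -
      have "\<bar>x * y\<bar> \<le> 1" using xy by (auto simp: abs_mult intro!: mult_le_one)
      then show ?thesis by linarith
    qed
    ultimately show ?thesis unfolding abs_mult abs_power2 by (intro mult_mono) auto
  qed
  then have b: "norm (indicator ({-1<..<1} \<times> {-1<..<1}) v *
      (((poly p (fst v) - poly p (snd v)) / (fst v - snd v))\<^sup>2 * (1 - fst v * snd v))) \<le> B\<^sup>2 * 2" for v
    by (cases v) (auto simp: indicator_def)
  show ?thesis
    by (rule AA.integrable_const_bound[where B = "B\<^sup>2 * 2"]) (use b in \<open>auto\<close>)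
qed

text \<open>\<open>(1 - x y) / (x - y)\<^sup>2\<close> times the arcsine density is, as a function of \<open>x\<close>, the derivative of
  \<open>- sqrt (1 - x\<^sup>2) / (pi (x - y))\<close>. Integrating by parts against \<open>(p x - p y)\<^sup>2\<close>
  therefore replaces one difference quotient by \<open>p'\<close>, and the arcsine law by the semicircle law. In
  polynomial terms this is the integration by parts for \<open>(x - y) Q\<^sup>2\<close>, where \<open>Q\<close> is the difference
  quotient.\<close>

lemma arcsine_quotient_integral:
  "(\<integral>x. (poly (difference_quotient (\<lambda>a. y ^ a) p) x)\<^sup>2 * (1 - x * y) \<partial>arcsine_measure) =
    moment_functional sc_moment (difference_quotient (\<lambda>a. y ^ a) p * pderiv p)"
proof -
  let ?Q = "difference_quotient (\<lambda>a. y ^ a) p"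
  have "poly (p - [:poly p y:]) x = poly ([:-y, 1:] * ?Q) x" for x
    using poly_difference_quotient_powers[of x y p] by (simp add: algebra_simps)
  then have "p - [:poly p y:] = [:-y, 1:] * ?Q" by (metis poly_eq_poly_eq_iff ext)
  then have "pderiv (p - [:poly p y:]) = pderiv ([:-y, 1:] * ?Q)" by (rule arg_cong)
  then have d: "pderiv p = ?Q + [:-y, 1:] * pderiv ?Q"
    by (simp add: pderiv_diff pderiv_mult pderiv_pCons pderiv_smult add.commute)
  let ?H = "[:-y, 1:] * (?Q * ?Q)"
  have "poly ([:1, 0, -1:] * pderiv ?H - [:0, 1:] * ?H) x =
      poly (smult 2 ([:1, 0, -1:] * (?Q * pderiv p)) - ?Q * ?Q * [:1, -y:]) x" for x
    unfolding d by (simp add: pderiv_mult pderiv_pCons pderiv_diff pderiv_smult algebra_simps)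
  then have "[:1, 0, -1:] * pderiv ?H - [:0, 1:] * ?H =
      smult 2 ([:1, 0, -1:] * (?Q * pderiv p)) - ?Q * ?Q * [:1, -y:]" by (metis poly_eq_poly_eq_iff ext)
  then have "moment_functional arcsine_moment (smult 2 ([:1, 0, -1:] * (?Q * pderiv p)) - ?Q * ?Q * [:1, -y:]) = 0"
    using arcsine_integration_by_parts[of ?H] by (simp only: integral_arcsine_poly)
  then have "moment_functional arcsine_moment (?Q * ?Q * [:1, -y:]) = moment_functional sc_moment (?Q * pderiv p)"
    by (simp only: moment_functional_diff moment_functional_smult sc_eq_arcsine)
  moreover have "(\<lambda>x. (poly ?Q x)\<^sup>2 * (1 - x * y)) = poly (?Q * ?Q * [:1, -y:])"
    by (rule ext) (simp add: power2_eq_square algebra_simps)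
  ultimately show ?thesis by (simp only: integral_arcsine_poly)
qed

text \<open>After the inner integration the integrand depends on \<open>y\<close> only through the moments \<open>y ^ a\<close> of the
  evaluation functional, so integrating over \<open>y\<close> replaces them by the arcsine moments.\<close>

theorem Sigma_functional_poly:
  "Sigma_functional (poly p) =
    1 / 4 * moment_functional sc_moment (difference_quotient arcsine_moment p * pderiv p)"
proof -
  interpret A: prob_space arcsine_measure by (rule prob_space_arcsine)
  interpret AA: pair_prob_space arcsine_measure arcsine_measure
    by (intro pair_prob_space.intro pair_sigma_finite.intro A.prob_space_axioms A.sigma_finite_measure_axioms)
  define g where "g x y = indicator ({-1<..<1} \<times> {-1<..<1}) (x, y) *
      (((poly p x - poly p y) / (x - y))\<^sup>2 * (1 - x * y))" for x y :: real
  have [measurable]: "(\<lambda>x. g x y) \<in> borel_measurable borel" for y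
    unfolding g_def indicator_def by measurable
  have gi: "integrable (arcsine_measure \<Otimes>\<^sub>M arcsine_measure) (\<lambda>(x, y). g x y)"
    using Sigma_integrable[of p] by (simp add: g_def split_beta')
  let ?m = "\<lambda>k a. moment_functional sc_moment (monom 1 (k - 1 - a) * pderiv p)"
  have inner: "(\<integral>x. g x y \<partial>arcsine_measure) =
      (\<Sum>k\<le>degree p. \<Sum>a<k. coeff p k * y ^ a * ?m k a)"
    if y: "y \<in> {-1<..<1}" for y
  proof -
    have "(\<integral>x. g x y \<partial>arcsine_measure) =
        (\<integral>x. (poly (difference_quotient (\<lambda>a. y ^ a) p) x)\<^sup>2 * (1 - x * y) \<partial>arcsine_measure)"
    proof (rule integral_cong_AE)
      show "AE x in arcsine_measure. g x y = (poly (difference_quotient (\<lambda>a. y ^ a) p) x)\<^sup>2 * (1 - x * y)"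
        using AE_arcsine_interval AE_arcsine_neq[of y]
      proof eventually_elim
        case (elim x)
        then show ?case using y
          by (simp add: g_def poly_difference_quotient_powers[symmetric])
      qed
    qed simp_all
    then show ?thesis by (simp only: arcsine_quotient_integral moment_functional_difference_quotient)
  qed
  have "Sigma_functional (poly p) = 1 / 4 * (\<integral>v. (\<lambda>(x, y). g x y) v \<partial>(arcsine_measure \<Otimes>\<^sub>M arcsine_measure))"
    unfolding Sigma_functional_def set_lebesgue_integral_def g_def by (simp add: split_beta')
  also have "(\<integral>v. (\<lambda>(x, y). g x y) v \<partial>(arcsine_measure \<Otimes>\<^sub>M arcsine_measure)) =
      (\<integral>y. \<integral>x. g x y \<partial>arcsine_measure \<partial>arcsine_measure)"
    using AA.integral_snd[OF gi] by simp
  also have "\<dots> = (\<integral>y. (\<Sum>k\<le>degree p. \<Sum>a<k. coeff p k * y ^ a * ?m k a) \<partial>arcsine_measure)"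
  proof (rule integral_cong_AE)
    show "AE y in arcsine_measure. (\<integral>x. g x y \<partial>arcsine_measure) = (\<Sum>k\<le>degree p. \<Sum>a<k. coeff p k * y ^ a * ?m k a)"
      by (rule eventually_mono[OF AE_arcsine_interval]) (rule inner)
    have "(\<lambda>(y, x). g x y) \<in> borel_measurable (borel \<Otimes>\<^sub>M arcsine_measure)"
      unfolding g_def indicator_def by measurable
    then show "(\<lambda>y. \<integral>x. g x y \<partial>arcsine_measure) \<in> borel_measurable arcsine_measure"
      using A.borel_measurable_lebesgue_integral[of "\<lambda>y x. g x y" borel] by simp
  qed simp
  also have "\<dots> = (\<Sum>k\<le>degree p. \<Sum>a<k. coeff p k * arcsine_moment a * ?m k a)"
    by (simp add: power_integrable arcsine_moment_def)
  also have "\<dots> = moment_functional sc_moment (difference_quotient arcsine_moment p * pderiv p)"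
    by (simp only: moment_functional_difference_quotient)
  finally show ?thesis .
qed

text \<open>The integrand is nonnegative. If it vanished almost everywhere, \<open>p\<close> would take a single value
  almost everywhere on the interval and hence be constant.\<close>

theorem Sigma_functional_pos:
  assumes "degree p > 0"
  shows "Sigma_functional (poly p) > 0"
proof (rule ccontr)
  interpret A: prob_space arcsine_measure by (rule prob_space_arcsine)
  interpret AA: pair_prob_space arcsine_measure arcsine_measure
    by (intro pair_prob_space.intro pair_sigma_finite.intro A.prob_space_axioms A.sigma_finite_measure_axioms)
  let ?g = "\<lambda>v. indicator ({-1<..<1} \<times> {-1<..<1}) v *
      (((poly p (fst v) - poly p (snd v)) / (fst v - snd v))\<^sup>2 * (1 - fst v * snd v))"
  assume "\<not> Sigma_functional (poly p) > 0"
  then have le: "integral\<^sup>L (arcsine_measure \<Otimes>\<^sub>M arcsine_measure) ?g \<le> 0"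
    by (simp add: Sigma_functional_def set_lebesgue_integral_def)
  have xy1: "x * y < 1" if "x \<in> {-1<..<1}" "y \<in> {-1<..<1}" for x y :: real
  proof -
    have "\<bar>x\<bar> * \<bar>y\<bar> < 1 * 1" using that by (intro mult_strict_mono') auto
    then have "\<bar>x * y\<bar> < 1" by (simp add: abs_mult)
    then show ?thesis by linarith
  qed
  have nn: "0 \<le> ?g v" for v
    using xy1[of "fst v" "snd v"]
    by (cases v) (auto simp: indicator_def intro!: mult_nonneg_nonneg)
  have "integral\<^sup>L (arcsine_measure \<Otimes>\<^sub>M arcsine_measure) ?g = 0"
    by (intro antisym le Bochner_Integration.integral_nonneg nn)
  then have "AE v in arcsine_measure \<Otimes>\<^sub>M arcsine_measure. ?g v = 0"
    using integral_nonneg_eq_0_iff_AE[OF Sigma_integrable[of p]] nn by simp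
  then have "AE x in arcsine_measure. AE y in arcsine_measure. ?g (x, y) = 0"
    by (rule AA.AE_pair)
  then have ae: "AE x in arcsine_measure. x \<in> {-1<..<1} \<and> (AE y in arcsine_measure. ?g (x, y) = 0)"
    using AE_arcsine_interval by eventually_elim simp
  have "\<exists>x. x \<in> {-1<..<1} \<and> (AE y in arcsine_measure. ?g (x, y) = 0)"
  proof (rule ccontr)
    assume "\<not> ?thesis"
    then have "AE x in arcsine_measure. False" using eventually_mono[OF ae] by blast
    then show False using A.AE_False by blast
  qed
  then obtain x where x: "x \<in> {-1<..<1}" "AE y in arcsine_measure. ?g (x, y) = 0" by blast
  let ?R = "{y. poly (p - [:poly p x:]) y = 0}"
  have "p - [:poly p x:] \<noteq> 0" using assms by (metis degree_pCons_0 eq_iff_diff_eq_0 less_irrefl)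
  then have "finite ?R" by (rule poly_roots_finite)
  then have "AE y in arcsine_measure. \<forall>r\<in>?R. y \<noteq> r"
    by (rule AE_finite_allI) (rule AE_arcsine_neq)
  then have "AE y in arcsine_measure. y \<notin> ?R" by (rule eventually_mono) blast
  with AE_arcsine_interval x(2) have "AE y in arcsine_measure. False"
  proof eventually_elim
    case (elim y)
    then show ?case using x(1) xy1[of x y] by (auto simp: indicator_def)
  qed
  then show False using A.AE_False by simp
qed

section \<open>Integration by parts against polynomials times a Gaussian weight\<close>

abbreviation lebesgue_coords :: "nat \<Rightarrow> (nat \<Rightarrow> real) measure" where
  "lebesgue_coords N \<equiv> \<Pi>\<^sub>M j\<in>{1..N}. lborel"

text \<open>With a bound in product form, integrability against the Gaussian weight reduces to one
  dimension. The bound ranges over all functions on the naturals, hence it still applies after one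
  coordinate has been changed.\<close>

definition poly_growth :: "nat \<Rightarrow> ((nat \<Rightarrow> real) \<Rightarrow> real) \<Rightarrow> bool" where
  "poly_growth N g \<longleftrightarrow> g \<in> borel_measurable (lebesgue_coords N) \<and>
    (\<exists>C n. \<forall>l. \<bar>g l\<bar> \<le> C * (\<Prod>i\<in>{1..N}. (1 + \<bar>l i\<bar>) ^ n))"

lemma poly_growth_measurable: "poly_growth N g \<Longrightarrow> g \<in> borel_measurable (lebesgue_coords N)"
  by (simp add: poly_growth_def)

lemma poly_growthE:
  assumes "poly_growth N g"
  obtains C n where "C \<ge> 0" "\<And>l m. n \<le> m \<Longrightarrow> \<bar>g l\<bar> \<le> C * (\<Prod>i\<in>{1..N}. (1 + \<bar>l i\<bar>) ^ m)"
proof -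
  obtain C n where C: "\<And>l. \<bar>g l\<bar> \<le> C * (\<Prod>i\<in>{1..N}. (1 + \<bar>l i\<bar>) ^ n)"
    using assms by (auto simp: poly_growth_def)
  have "0 \<le> C * (\<Prod>i\<in>{1..N}. (1 + \<bar>0\<bar>) ^ n)" using C[of "\<lambda>_. 0"] by (rule order_trans[rotated]) simp
  then have C0: "C \<ge> 0" by simp
  have "\<bar>g l\<bar> \<le> C * (\<Prod>i\<in>{1..N}. (1 + \<bar>l i\<bar>) ^ m)" if "n \<le> m" for l m
    by (rule order_trans[OF C mult_left_mono[OF prod_mono C0]])
      (use that in \<open>auto intro: power_increasing\<close>)
  with C0 show ?thesis using that by blast
qed

lemma poly_growth_const: "poly_growth N (\<lambda>_. c)"
  unfolding poly_growth_def
  by (intro conjI exI[of _ "\<bar>c\<bar>"] exI[of _ 0]) auto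

lemma poly_growth_coord:
  assumes "j \<in> {1..N}"
  shows "poly_growth N (\<lambda>l. l j)"
  unfolding poly_growth_def
proof (intro conjI exI[of _ 1] allI)
  show "(\<lambda>l. l j) \<in> borel_measurable (lebesgue_coords N)" using assms by measurable
  fix l :: "nat \<Rightarrow> real"
  have "\<bar>l j\<bar> \<le> (1 + \<bar>l j\<bar>) ^ 1 * 1" by simp
  also have "\<dots> \<le> (1 + \<bar>l j\<bar>) ^ 1 * (\<Prod>i\<in>{1..N} - {j}. (1 + \<bar>l i\<bar>) ^ 1)"
    by (intro mult_left_mono prod_ge_1) auto
  also have "\<dots> = (\<Prod>i\<in>{1..N}. (1 + \<bar>l i\<bar>) ^ 1)"
    using assms by (subst prod.remove[of _ j]) auto
  finally show "\<bar>l j\<bar> \<le> 1 * (\<Prod>i\<in>{1..N}. (1 + \<bar>l i\<bar>) ^ 1)" by simp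
qed

lemma poly_growth_add:
  assumes "poly_growth N f" "poly_growth N g"
  shows "poly_growth N (\<lambda>l. f l + g l)"
proof -
  obtain C n where C: "\<And>l m. n \<le> m \<Longrightarrow> \<bar>f l\<bar> \<le> C * (\<Prod>i\<in>{1..N}. (1 + \<bar>l i\<bar>) ^ m)"
    by (rule poly_growthE[OF assms(1)]) blast
  obtain D k where D: "\<And>l m. k \<le> m \<Longrightarrow> \<bar>g l\<bar> \<le> D * (\<Prod>i\<in>{1..N}. (1 + \<bar>l i\<bar>) ^ m)"
    by (rule poly_growthE[OF assms(2)]) blast
  have "\<bar>f l + g l\<bar> \<le> (C + D) * (\<Prod>i\<in>{1..N}. (1 + \<bar>l i\<bar>) ^ max n k)" for l
    using C[of "max n k" l] D[of "max n k" l] by (simp add: distrib_right)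
  moreover have "(\<lambda>l. f l + g l) \<in> borel_measurable (lebesgue_coords N)"
    using assms[THEN poly_growth_measurable] by simp
  ultimately show ?thesis unfolding poly_growth_def by blast
qed

lemma poly_growth_mult:
  assumes "poly_growth N f" "poly_growth N g"
  shows "poly_growth N (\<lambda>l. f l * g l)"
proof -
  obtain C n where C: "C \<ge> 0" "\<And>l m. n \<le> m \<Longrightarrow> \<bar>f l\<bar> \<le> C * (\<Prod>i\<in>{1..N}. (1 + \<bar>l i\<bar>) ^ m)"
    by (rule poly_growthE[OF assms(1)]) blast
  obtain D k where D: "D \<ge> 0" "\<And>l m. k \<le> m \<Longrightarrow> \<bar>g l\<bar> \<le> D * (\<Prod>i\<in>{1..N}. (1 + \<bar>l i\<bar>) ^ m)"
    by (rule poly_growthE[OF assms(2)]) blast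
  have "\<bar>f l * g l\<bar> \<le> (C * D) * (\<Prod>i\<in>{1..N}. (1 + \<bar>l i\<bar>) ^ (n + k))" for l
  proof -
    have "\<bar>f l * g l\<bar> \<le> (C * (\<Prod>i\<in>{1..N}. (1 + \<bar>l i\<bar>) ^ n)) * (D * (\<Prod>i\<in>{1..N}. (1 + \<bar>l i\<bar>) ^ k))"
      unfolding abs_mult using C D by (intro mult_mono) (auto intro!: mult_nonneg_nonneg prod_nonneg)
    also have "\<dots> = (C * D) * (\<Prod>i\<in>{1..N}. (1 + \<bar>l i\<bar>) ^ (n + k))"
      by (simp add: power_add prod.distrib)
    finally show ?thesis .
  qed
  moreover have "(\<lambda>l. f l * g l) \<in> borel_measurable (lebesgue_coords N)"
    using assms[THEN poly_growth_measurable] by simp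
  ultimately show ?thesis unfolding poly_growth_def by blast
qed

lemma poly_growth_sum: "(\<And>i. i \<in> A \<Longrightarrow> poly_growth N (f i)) \<Longrightarrow> poly_growth N (\<lambda>l. \<Sum>i\<in>A. f i l)"
  by (induction A rule: infinite_finite_induct) (auto intro: poly_growth_const poly_growth_add)

lemma poly_growth_power: "poly_growth N f \<Longrightarrow> poly_growth N (\<lambda>l. f l ^ k)"
  by (induction k) (auto intro: poly_growth_const poly_growth_mult)

lemma poly_growth_minus: "poly_growth N f \<Longrightarrow> poly_growth N (\<lambda>l. - f l)"
  using poly_growth_mult[OF poly_growth_const[of N "-1"]] by simp

lemma poly_growth_diff: "poly_growth N f \<Longrightarrow> poly_growth N g \<Longrightarrow> poly_growth N (\<lambda>l. f l - g l)"
  using poly_growth_add[OF _ poly_growth_minus] by simp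

lemmas growth_intros = poly_growth_const poly_growth_coord poly_growth_add poly_growth_mult
  poly_growth_sum poly_growth_power poly_growth_minus poly_growth_diff

definition gauss_weight :: "nat \<Rightarrow> (nat \<Rightarrow> real) \<Rightarrow> real" where
  "gauss_weight N l = exp (- 2 * real N * (\<Sum>j=1..N. (l j)\<^sup>2))"

lemma gauss_weight_pos: "gauss_weight N l > 0" by (simp add: gauss_weight_def)

lemma gauss_weight_prod: "gauss_weight N l = (\<Prod>j\<in>{1..N}. exp (- (2 * real N) * (l j)\<^sup>2))"
  by (simp add: gauss_weight_def sum_distrib_left exp_sum)

lemma gauss_weight_measurable [measurable]: "gauss_weight N \<in> borel_measurable (lebesgue_coords N)"
  unfolding gauss_weight_def by measurable

interpretation lborels: product_sigma_finite "\<lambda>_::nat. lborel :: real measure"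
  by (simp add: product_sigma_finite_def lborel.sigma_finite_measure_axioms)

lemma poly_growth_integrable:
  assumes "poly_growth N g" "N \<ge> 1"
  shows "integrable (lebesgue_coords N) (\<lambda>l. g l * gauss_weight N l)"
proof -
  obtain C n where C: "C \<ge> 0" "\<And>l m. n \<le> m \<Longrightarrow> \<bar>g l\<bar> \<le> C * (\<Prod>i\<in>{1..N}. (1 + \<bar>l i\<bar>) ^ m)"
    by (rule poly_growthE[OF assms(1)]) blast
  have [measurable]: "g \<in> borel_measurable (lebesgue_coords N)" by (rule poly_growth_measurable[OF assms(1)])
  show ?thesis
  proof (rule Bochner_Integration.integrable_bound)
    show "integrable (lebesgue_coords N)
        (\<lambda>l. C * (\<Prod>i\<in>{1..N}. (1 + \<bar>l i\<bar>) ^ n * exp (- (2 * real N) * (l i)\<^sup>2)))"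
      using assms(2) by (intro integrable_mult_right lborels.product_integrable_prod
          power_exp_minus_square_integrable) auto
    have bound: "\<bar>g l * gauss_weight N l\<bar> \<le> C * (\<Prod>i\<in>{1..N}. (1 + \<bar>l i\<bar>) ^ n * exp (- (2 * real N) * (l i)\<^sup>2))" for l
    proof -
      have "\<bar>g l * gauss_weight N l\<bar> = \<bar>g l\<bar> * gauss_weight N l"
        using gauss_weight_pos[of N l] by (simp add: abs_mult)
      also have "\<dots> \<le> (C * (\<Prod>i\<in>{1..N}. (1 + \<bar>l i\<bar>) ^ n)) * gauss_weight N l"
        using C(2)[of n l] gauss_weight_pos[of N l] by (intro mult_right_mono) auto
      finally show ?thesis by (simp add: gauss_weight_prod prod.distrib mult.assoc)
    qed
    show "AE l in lebesgue_coords N. norm (g l * gauss_weight N l) \<le>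
        norm (C * (\<Prod>i\<in>{1..N}. (1 + \<bar>l i\<bar>) ^ n * exp (- (2 * real N) * (l i)\<^sup>2)))"
      unfolding real_norm_def by (intro AE_I2 order_trans[OF bound abs_ge_self])
  qed measurable
qed

text \<open>\<open>D j\<close> is the \<open>j\<close>-th partial derivative of \<open>\<Psi>\<close>. The continuity along coordinate lines is what the
  fundamental theorem of calculus asks for in \<open>gauss_integration_by_parts\<close>.\<close>

definition smooth :: "nat \<Rightarrow> ((nat \<Rightarrow> real) \<Rightarrow> real) \<Rightarrow> (nat \<Rightarrow> (nat \<Rightarrow> real) \<Rightarrow> real) \<Rightarrow> bool" where
  "smooth N \<Psi> D \<longleftrightarrow> poly_growth N \<Psi> \<and> (\<forall>j\<in>{1..N}. poly_growth N (D j) \<and>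
    (\<forall>l. ((\<lambda>t. \<Psi> (l(j := t))) has_real_derivative D j l) (at (l j))) \<and>
    (\<forall>l. continuous_on UNIV (\<lambda>t. D j (l(j := t)))))"

lemma smooth_growth: "smooth N \<Psi> D \<Longrightarrow> poly_growth N \<Psi>"
  and smooth_growth': "smooth N \<Psi> D \<Longrightarrow> j \<in> {1..N} \<Longrightarrow> poly_growth N (D j)"
  and smooth_deriv: "smooth N \<Psi> D \<Longrightarrow> j \<in> {1..N} \<Longrightarrow> ((\<lambda>t. \<Psi> (l(j := t))) has_real_derivative D j l) (at (l j))"
  and smooth_continuous': "smooth N \<Psi> D \<Longrightarrow> j \<in> {1..N} \<Longrightarrow> continuous_on UNIV (\<lambda>t. D j (l(j := t)))"
  by (auto simp: smooth_def)

lemma smooth_deriv_line: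
  assumes "smooth N \<Psi> D" "j \<in> {1..N}"
  shows "((\<lambda>t. \<Psi> (l(j := t))) has_real_derivative D j (l(j := t))) (at t)"
  using smooth_deriv[OF assms, of "l(j := t)"] by simp

lemma smooth_continuous: "smooth N \<Psi> D \<Longrightarrow> j \<in> {1..N} \<Longrightarrow> continuous_on UNIV (\<lambda>t. \<Psi> (l(j := t)))"
  by (rule bounded_deriv_continuous) (rule smooth_deriv_line)

lemma smooth_const: "smooth N (\<lambda>_. c) (\<lambda>_ _. 0)"
  by (auto simp: smooth_def intro: growth_intros)

lemma smooth_power:
  assumes "i \<in> {1..N}"
  shows "smooth N (\<lambda>l. l i ^ k) (\<lambda>j l. if j = i then real k * l i ^ (k - 1) else 0)"
  unfolding smooth_def
proof (intro conjI ballI allI)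
  fix j l assume j: "j \<in> {1..N}"
  show "poly_growth N (\<lambda>l. if j = i then real k * l i ^ (k - 1) else 0)"
    by (cases "j = i") (use assms in \<open>auto intro!: growth_intros\<close>)
  show "((\<lambda>t. (l(j := t)) i ^ k) has_real_derivative (if j = i then real k * l i ^ (k - 1) else 0)) (at (l j))"
    by (auto intro!: derivative_eq_intros)
  show "continuous_on UNIV (\<lambda>t. if j = i then real k * (l(j := t)) i ^ (k - 1) else 0)"
    by (cases "j = i") (auto intro!: continuous_intros)
qed (use assms in \<open>auto intro!: growth_intros\<close>)

lemma smooth_add:
  assumes "smooth N f D" "smooth N g E"
  shows "smooth N (\<lambda>l. f l + g l) (\<lambda>j l. D j l + E j l)"
  using assms unfolding smooth_def
  by (auto intro!: growth_intros continuous_intros derivative_intros)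

lemma smooth_mult:
  assumes "smooth N f D" "smooth N g E"
  shows "smooth N (\<lambda>l. f l * g l) (\<lambda>j l. D j l * g l + f l * E j l)"
  unfolding smooth_def
proof (intro conjI ballI allI)
  fix j l assume j: "j \<in> {1..N}"
  note s = smooth_growth[OF assms(1)] smooth_growth[OF assms(2)]
    smooth_growth'[OF assms(1) j] smooth_growth'[OF assms(2) j]
  show "poly_growth N (\<lambda>l. D j l * g l + f l * E j l)" by (intro growth_intros s)
  show "((\<lambda>t. f (l(j := t)) * g (l(j := t))) has_real_derivative D j l * g l + f l * E j l) (at (l j))"
    using DERIV_mult[OF smooth_deriv[OF assms(1) j, of l] smooth_deriv[OF assms(2) j, of l]]
    by (simp add: algebra_simps)
  show "continuous_on UNIV (\<lambda>t. D j (l(j := t)) * g (l(j := t)) + f (l(j := t)) * E j (l(j := t)))"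
    by (intro continuous_intros smooth_continuous[OF assms(1) j] smooth_continuous[OF assms(2) j]
        smooth_continuous'[OF assms(1) j] smooth_continuous'[OF assms(2) j])
qed (intro growth_intros smooth_growth[OF assms(1)] smooth_growth[OF assms(2)])

lemma smooth_sum:
  assumes "\<And>i. i \<in> A \<Longrightarrow> smooth N (f i) (D i)"
  shows "smooth N (\<lambda>l. \<Sum>i\<in>A. f i l) (\<lambda>j l. \<Sum>i\<in>A. D i j l)"
  using assms
  by (induction A rule: infinite_finite_induct) (auto intro: smooth_const smooth_add)

lemma smooth_cmult:
  assumes "smooth N f D"
  shows "smooth N (\<lambda>l. c * f l) (\<lambda>j l. c * D j l)"
  using smooth_mult[OF smooth_const[of N c] assms] by simp

lemma smooth_comp:
  assumes f: "smooth N f D" and d: "\<And>x. (\<phi> has_real_derivative \<phi>' x) (at x)"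
    and c: "continuous_on UNIV \<phi>'" and K: "\<And>x. \<bar>\<phi>' x\<bar> \<le> K"
  shows "smooth N (\<lambda>l. \<phi> (f l)) (\<lambda>j l. \<phi>' (f l) * D j l)"
proof -
  have [measurable]: "\<phi> \<in> borel_measurable borel" "\<phi>' \<in> borel_measurable borel"
    using bounded_deriv_continuous[OF d] c by (auto intro: borel_measurable_continuous_onI)
  have fm [measurable]: "f \<in> borel_measurable (lebesgue_coords N)"
    by (rule poly_growth_measurable[OF smooth_growth[OF f]])
  have le: "poly_growth N h" if h: "h \<in> borel_measurable (lebesgue_coords N)"
    and g: "poly_growth N g" "\<And>l. \<bar>h l\<bar> \<le> g l" for g h
  proof -
    obtain C n where "\<And>l m. n \<le> m \<Longrightarrow> \<bar>g l\<bar> \<le> C * (\<Prod>i\<in>{1..N}. (1 + \<bar>l i\<bar>) ^ m)"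
      by (rule poly_growthE[OF g(1)]) blast
    then have "\<bar>h l\<bar> \<le> C * (\<Prod>i\<in>{1..N}. (1 + \<bar>l i\<bar>) ^ n)" for l
      using g(2)[of l] by (meson abs_ge_self order_trans le_refl)
    with h show ?thesis unfolding poly_growth_def by blast
  qed
  have K0: "K \<ge> 0" using K[of 0] by linarith
  have p1: "poly_growth N (\<lambda>l. \<phi> (f l))"
  proof (rule le)
    show "poly_growth N (\<lambda>l. \<bar>\<phi> 0\<bar> + K * (1 + (f l)\<^sup>2))"
      by (intro growth_intros smooth_growth[OF f])
    fix l
    have "\<bar>f l\<bar> \<le> 1 + (f l)\<^sup>2"
    proof -
      have "0 \<le> (\<bar>f l\<bar> - 1/2)\<^sup>2" by simp
      then show ?thesis by (simp add: power2_eq_square algebra_simps)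
    qed
    then have "K * \<bar>f l\<bar> \<le> K * (1 + (f l)\<^sup>2)" using K0 by (rule mult_left_mono)
    then show "\<bar>\<phi> (f l)\<bar> \<le> \<bar>\<phi> 0\<bar> + K * (1 + (f l)\<^sup>2)"
      using bounded_deriv_linear_growth[OF d K, of "f l"] by linarith
  qed measurable
  have p2: "poly_growth N (\<lambda>l. \<phi>' (f l))"
    by (rule le[OF _ poly_growth_const[of N K]]) (measurable, rule K)
  show ?thesis
    unfolding smooth_def
  proof (intro conjI ballI allI p1)
    fix j l assume j: "j \<in> {1..N}"
    show "poly_growth N (\<lambda>l. \<phi>' (f l) * D j l)" by (intro growth_intros p2 smooth_growth'[OF f j])
    show "((\<lambda>t. \<phi> (f (l(j := t)))) has_real_derivative \<phi>' (f l) * D j l) (at (l j))"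
      using DERIV_chain2[OF d smooth_deriv[OF f j, of l]] by simp
    show "continuous_on UNIV (\<lambda>t. \<phi>' (f (l(j := t))) * D j (l(j := t)))"
      by (intro continuous_intros continuous_on_compose2[OF c smooth_continuous[OF f j]]
          smooth_continuous'[OF f j]) auto
  qed
qed

lemma gauss_integration_by_parts:
  assumes s: "smooth N \<Psi> D" and j: "j \<in> {1..N}"
  shows "(\<integral>l. (D j l - 4 * real N * l j * \<Psi> l) * gauss_weight N l \<partial>lebesgue_coords N) = 0"
proof -
  let ?f = "\<lambda>l. (D j l - 4 * real N * l j * \<Psi> l) * gauss_weight N l"
  have N: "N \<ge> 1" using j by simp
  have I: "insert j ({1..N} - {j}) = {1..N}" using j by auto
  have g: "poly_growth N (\<lambda>l. D j l - 4 * real N * l j * \<Psi> l)"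
    by (intro growth_intros smooth_growth'[OF s j] smooth_growth[OF s] j)
  have fubini: "integral\<^sup>L (lebesgue_coords N) ?f =
      (\<integral>l. (\<integral>t. ?f (l(j := t)) \<partial>lborel) \<partial>(\<Pi>\<^sub>M i\<in>{1..N} - {j}. lborel))"
  proof -
    have "integrable (\<Pi>\<^sub>M i\<in>insert j ({1..N} - {j}). lborel) ?f"
      using poly_growth_integrable[OF g N] by (simp only: I)
    from lborels.product_integral_insert[OF _ _ this] show ?thesis by (simp only: I) simp
  qed
  have inner: "(\<integral>t. ?f (l(j := t)) \<partial>lborel) = 0" for l
  proof -
    define G where "G = exp (- 2 * real N * (\<Sum>i\<in>{1..N} - {j}. (l i)\<^sup>2))"
    have gw: "gauss_weight N (l(j := t)) = G * exp (- (2 * real N) * t\<^sup>2)" for t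
    proof -
      have "(\<Sum>i=1..N. ((l(j := t)) i)\<^sup>2) = t\<^sup>2 + (\<Sum>i\<in>{1..N} - {j}. (l i)\<^sup>2)"
        using j by (subst sum.remove[of _ j]) (auto intro!: sum.cong)
      then show ?thesis by (simp add: gauss_weight_def G_def algebra_simps flip: exp_add)
    qed
    have gwd: "((\<lambda>t. gauss_weight N (l(j := t))) has_real_derivative - 4 * real N * t * gauss_weight N (l(j := t))) (at t)" for t
      unfolding gw by (auto intro!: derivative_eq_intros)
    have gwc: "continuous_on UNIV (\<lambda>t. gauss_weight N (l(j := t)))"
      by (rule bounded_deriv_continuous[OF gwd])
    have line_bound: "\<exists>C n. C \<ge> 0 \<and> (\<forall>t. \<bar>h (l(j := t)) * gauss_weight N (l(j := t))\<bar> \<le>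
        C * ((1 + \<bar>t\<bar>) ^ n * exp (- (2 * real N) * t\<^sup>2)))" if "poly_growth N h" for h
    proof -
      obtain C n where C: "C \<ge> 0" "\<And>l m. n \<le> m \<Longrightarrow> \<bar>h l\<bar> \<le> C * (\<Prod>i\<in>{1..N}. (1 + \<bar>l i\<bar>) ^ m)"
        by (rule poly_growthE[OF \<open>poly_growth N h\<close>]) blast
      define B where "B = (\<Prod>i\<in>{1..N} - {j}. (1 + \<bar>l i\<bar>) ^ n)"
      have "\<bar>h (l(j := t)) * gauss_weight N (l(j := t))\<bar> \<le> (C * B * G) * ((1 + \<bar>t\<bar>) ^ n * exp (- (2 * real N) * t\<^sup>2))" for t
      proof -
        have "(\<Prod>i\<in>{1..N}. (1 + \<bar>(l(j := t)) i\<bar>) ^ n) = (1 + \<bar>t\<bar>) ^ n * B"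
          unfolding B_def using j by (subst prod.remove[of _ j]) (auto intro!: prod.cong)
        then have "\<bar>h (l(j := t))\<bar> \<le> C * ((1 + \<bar>t\<bar>) ^ n * B)" using C(2)[of n "l(j := t)"] by simp
        then have "\<bar>h (l(j := t))\<bar> * gauss_weight N (l(j := t)) \<le> C * ((1 + \<bar>t\<bar>) ^ n * B) * (G * exp (- (2 * real N) * t\<^sup>2))"
          unfolding gw by (intro mult_right_mono) (auto simp: G_def)
        then show ?thesis using gauss_weight_pos[of N "l(j := t)"] by (simp add: abs_mult mult_ac)
      qed
      moreover have "C * B * G \<ge> 0" using C(1) by (simp add: B_def G_def prod_nonneg)
      ultimately show ?thesis by blast
    qed
    have fcont: "continuous_on UNIV (\<lambda>t. ?f (l(j := t)))"
      by (intro continuous_intros gwc smooth_continuous[OF s j] smooth_continuous'[OF s j]) simp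
    show ?thesis
    proof (rule integral_derivative_eq_0[where H = "\<lambda>t. \<Psi> (l(j := t)) * gauss_weight N (l(j := t))"])
      show "((\<lambda>t. \<Psi> (l(j := t)) * gauss_weight N (l(j := t))) has_real_derivative ?f (l(j := t))) (at t)" for t
        using DERIV_mult[OF smooth_deriv_line[OF s j] gwd] by (simp add: algebra_simps)
      obtain C n where "C \<ge> 0" and C: "\<And>t. \<bar>?f (l(j := t))\<bar> \<le> C * ((1 + \<bar>t\<bar>) ^ n * exp (- (2 * real N) * t\<^sup>2))"
        using line_bound[OF g] by blast
      show "integrable lborel (\<lambda>t. ?f (l(j := t)))"
      proof (rule Bochner_Integration.integrable_bound)
        show "integrable lborel (\<lambda>t. C * ((1 + \<bar>t\<bar>) ^ n * exp (- (2 * real N) * t\<^sup>2)))"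
          using N by (intro integrable_mult_right power_exp_minus_square_integrable) simp
        show "(\<lambda>t. ?f (l(j := t))) \<in> borel_measurable lborel"
          using borel_measurable_continuous_onI[OF fcont] by simp
        show "AE t in lborel. norm (?f (l(j := t))) \<le> norm (C * ((1 + \<bar>t\<bar>) ^ n * exp (- (2 * real N) * t\<^sup>2)))"
          unfolding real_norm_def by (intro AE_I2 order_trans[OF C abs_ge_self])
      qed
      obtain C n where C: "\<And>t. \<bar>\<Psi> (l(j := t)) * gauss_weight N (l(j := t))\<bar> \<le> C * ((1 + \<bar>t\<bar>) ^ n * exp (- (2 * real N) * t\<^sup>2))"
        using line_bound[OF smooth_growth[OF s]] by blast
      have "((\<lambda>t. C * ((1 + \<bar>t\<bar>) ^ n * exp (- (2 * real N) * t\<^sup>2))) \<longlongrightarrow> C * 0) at_infinity"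
        using N by (intro tendsto_mult tendsto_const power_exp_minus_square_tendsto_0) simp
      then have lim: "((\<lambda>t. C * ((1 + \<bar>t\<bar>) ^ n * exp (- (2 * real N) * t\<^sup>2))) \<longlongrightarrow> 0) at_infinity" by simp
      show "((\<lambda>t. \<Psi> (l(j := t)) * gauss_weight N (l(j := t))) \<longlongrightarrow> 0) at_infinity"
        by (rule Lim_null_comparison[OF always_eventually lim]) (use C in auto)
    qed (rule fcont)
  qed
  show ?thesis unfolding fubini inner by simp
qed

section \<open>Loop equations\<close>

definition power_sum :: "nat \<Rightarrow> nat \<Rightarrow> (nat \<Rightarrow> real) \<Rightarrow> real" where
  "power_sum N k l = (\<Sum>j=1..N. l j ^ k)"

text \<open>The vector field with components \<open>l j ^ k\<close> acts on \<open>f\<close> as multiplication by \<open>c k\<close>. For the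
  Vandermonde product \<open>c k\<close> is a polynomial, so stating the property in this form avoids the
  singular terms \<open>1 / (l i - l j)\<close>; the partial derivatives \<open>D\<close> are the same for all \<open>k\<close>.\<close>

definition power_logderiv :: "nat \<Rightarrow> ((nat \<Rightarrow> real) \<Rightarrow> real) \<Rightarrow> (nat \<Rightarrow> (nat \<Rightarrow> real) \<Rightarrow> real) \<Rightarrow> bool" where
  "power_logderiv N f c \<longleftrightarrow>
    (\<exists>D. smooth N f D \<and> (\<forall>k l. (\<Sum>j=1..N. l j ^ k * D j l) = f l * c k l))"

lemma power_logderiv_1: "power_logderiv N (\<lambda>_. 1) (\<lambda>_ _. 0)"
  unfolding power_logderiv_def using smooth_const[of N 1] by (intro exI[of _ "\<lambda>_ _. 0"]) simp

lemma power_logderiv_mult: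
  assumes "power_logderiv N f c" "power_logderiv N g d"
  shows "power_logderiv N (\<lambda>l. f l * g l) (\<lambda>k l. c k l + d k l)"
proof -
  obtain D where D: "smooth N f D" "\<And>k l. (\<Sum>j=1..N. l j ^ k * D j l) = f l * c k l"
    using assms(1) by (auto simp: power_logderiv_def)
  obtain E where E: "smooth N g E" "\<And>k l. (\<Sum>j=1..N. l j ^ k * E j l) = g l * d k l"
    using assms(2) by (auto simp: power_logderiv_def)
  have "(\<Sum>j=1..N. l j ^ k * (D j l * g l + f l * E j l)) = f l * g l * (c k l + d k l)" for k l
  proof -
    have "(\<Sum>j=1..N. l j ^ k * (D j l * g l + f l * E j l)) =
        (\<Sum>j=1..N. l j ^ k * D j l) * g l + f l * (\<Sum>j=1..N. l j ^ k * E j l)"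
      by (simp add: sum_distrib_left sum_distrib_right sum.distrib algebra_simps)
    then show ?thesis unfolding D(2) E(2) by (simp add: algebra_simps)
  qed
  with smooth_mult[OF D(1) E(1)] show ?thesis
    unfolding power_logderiv_def by blast
qed

lemma power_logderiv_prod:
  assumes "\<And>e. e \<in> A \<Longrightarrow> power_logderiv N (f e) (c e)"
  shows "power_logderiv N (\<lambda>l. \<Prod>e\<in>A. f e l) (\<lambda>k l. \<Sum>e\<in>A. c e k l)"
  using assms
  by (induction A rule: infinite_finite_induct) (auto intro: power_logderiv_1 power_logderiv_mult)

lemma power_logderiv_pair:
  assumes "i \<in> {1..N}" "j \<in> {1..N}"
  shows "power_logderiv N (\<lambda>l. \<bar>l i - l j\<bar>\<^sup>2) (\<lambda>k l. 2 * (\<Sum>a<k. l i ^ a * l j ^ (k - 1 - a)))"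
proof -
  let ?d = "\<lambda>m l. (if m = i then real 1 * l i ^ (1 - 1) else 0) + (- 1) * (if m = j then real 1 * l j ^ (1 - 1) else 0)"
  have s: "smooth N (\<lambda>l. l i ^ 1 + (- 1) * l j ^ 1) ?d"
    by (intro smooth_add smooth_cmult smooth_power assms)
  have "(\<Sum>m=1..N. l m ^ k * (?d m l * (l i ^ 1 + (- 1) * l j ^ 1) + (l i ^ 1 + (- 1) * l j ^ 1) * ?d m l)) =
      \<bar>l i - l j\<bar>\<^sup>2 * (2 * (\<Sum>a<k. l i ^ a * l j ^ (k - 1 - a)))" for k and l :: "nat \<Rightarrow> real"
  proof -
    have "(\<Sum>m=1..N. l m ^ k * (?d m l * (l i ^ 1 + (- 1) * l j ^ 1) + (l i ^ 1 + (- 1) * l j ^ 1) * ?d m l)) =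
        (\<Sum>m=1..N. (if m = i then l m ^ k * (2 * (l i - l j)) else 0) - (if m = j then l m ^ k * (2 * (l i - l j)) else 0))"
      by (intro sum.cong) (auto simp: algebra_simps)
    also have "\<dots> = 2 * (l i - l j) * (l i ^ k - l j ^ k)"
      using assms by (simp add: sum_subtractf algebra_simps)
    also have "l i ^ k - l j ^ k = (l i - l j) * (\<Sum>a<k. l i ^ a * l j ^ (k - 1 - a))"
      by (subst power_diff_sumr2) (simp add: mult.commute)
    finally show ?thesis by (simp add: power2_eq_square)
  qed
  moreover have "(\<lambda>l :: nat \<Rightarrow> real. \<bar>l i - l j\<bar>\<^sup>2) = (\<lambda>l. (l i ^ 1 + (- 1) * l j ^ 1) * (l i ^ 1 + (- 1) * l j ^ 1))"
    by (rule ext) (simp add: power2_eq_square)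
  ultimately show ?thesis
    unfolding power_logderiv_def using smooth_mult[OF s s] by (simp only:) blast
qed

lemma sum_symmetric_pairs:
  fixes h :: "nat \<Rightarrow> nat \<Rightarrow> real"
  assumes "\<And>i j. h i j = h j i"
  shows "(\<Sum>j=1..N. \<Sum>i=1..N. h i j) = (\<Sum>j=1..N. \<Sum>i\<in>{1..<j}. 2 * h i j) + (\<Sum>j=1..N. h j j)"
proof (induction N)
  case (Suc N)
  have "(\<Sum>j=1..Suc N. \<Sum>i=1..Suc N. h i j) =
      (\<Sum>j=1..N. \<Sum>i=1..N. h i j) + (\<Sum>j=1..N. h (Suc N) j) + (\<Sum>i=1..N. h i (Suc N)) + h (Suc N) (Suc N)"
    by (simp add: sum.distrib)
  also have "(\<Sum>j=1..N. h (Suc N) j) = (\<Sum>i=1..N. h i (Suc N))" using assms by simp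
  finally show ?case
    using Suc by (simp add: sum_distrib_left[symmetric] atLeastLessThanSuc_atLeastAtMost)
qed simp

definition vandermonde_square :: "nat \<Rightarrow> (nat \<Rightarrow> real) \<Rightarrow> real" where
  "vandermonde_square N l = (\<Prod>j\<in>{1..N}. \<Prod>i\<in>{1..<j}. \<bar>l i - l j\<bar>\<^sup>2)"

lemma gue_weight_eq: "gue_weight N l = vandermonde_square N l * gauss_weight N l"
  by (simp add: gue_weight_def vandermonde_square_def gauss_weight_def)

text \<open>Each factor \<open>(l i - l j)\<^sup>2\<close> contributes \<open>2 (l i ^ k - l j ^ k) / (l i - l j)\<close>. Over all pairs
  this adds up to the double sum of \<open>l i ^ a * l j ^ b\<close> with \<open>a + b = k - 1\<close> over \<open>i \<noteq> j\<close>; the subtracted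
  term is the diagonal of the product of power sums.\<close>

lemma vandermonde_logderiv:
  "power_logderiv N (vandermonde_square N)
    (\<lambda>k l. (\<Sum>a<k. power_sum N a l * power_sum N (k - 1 - a) l) - real k * power_sum N (k - 1) l)"
proof -
  have "power_logderiv N (vandermonde_square N) (\<lambda>k l. \<Sum>j=1..N. \<Sum>i\<in>{1..<j}. 2 * (\<Sum>a<k. l i ^ a * l j ^ (k - 1 - a)))"
    unfolding vandermonde_square_def[abs_def] by (intro power_logderiv_prod power_logderiv_pair) auto
  moreover have "(\<Sum>j=1..N. \<Sum>i\<in>{1..<j}. 2 * (\<Sum>a<k. l i ^ a * l j ^ (k - 1 - a))) =
      (\<Sum>a<k. power_sum N a l * power_sum N (k - 1 - a) l) - real k * power_sum N (k - 1) l" for k l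
  proof -
    have sym: "(\<Sum>a<k. l i ^ a * l j ^ (k - 1 - a)) = (\<Sum>a<k. l j ^ a * l i ^ (k - 1 - a))" for i j
    proof -
      have "(\<Sum>a<k. l j ^ a * l i ^ (k - 1 - a)) = (\<Sum>a<k. l j ^ (k - Suc a) * l i ^ (k - 1 - (k - Suc a)))"
        by (rule sum.nat_diff_reindex[symmetric])
      also have "\<dots> = (\<Sum>a<k. l i ^ a * l j ^ (k - 1 - a))"
        by (intro sum.cong) (auto simp: mult.commute)
      finally show ?thesis by simp
    qed
    have "(\<Sum>a<k. power_sum N a l * power_sum N (k - 1 - a) l) =
        (\<Sum>a<k. \<Sum>j=1..N. \<Sum>i=1..N. l i ^ a * l j ^ (k - 1 - a))"
      by (simp add: power_sum_def sum_product) (subst sum.swap, rule refl)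
    also have "\<dots> = (\<Sum>j=1..N. \<Sum>i=1..N. \<Sum>a<k. l i ^ a * l j ^ (k - 1 - a))"
    proof -
      have "(\<Sum>j=1..N. \<Sum>i=1..N. \<Sum>a<k. l i ^ a * l j ^ (k - 1 - a)) =
          (\<Sum>j=1..N. \<Sum>a<k. \<Sum>i=1..N. l i ^ a * l j ^ (k - 1 - a))"
        by (intro sum.cong refl sum.swap)
      also have "\<dots> = (\<Sum>a<k. \<Sum>j=1..N. \<Sum>i=1..N. l i ^ a * l j ^ (k - 1 - a))"
        by (rule sum.swap)
      finally show ?thesis by simp
    qed
    also have "\<dots> = (\<Sum>j=1..N. \<Sum>i\<in>{1..<j}. 2 * (\<Sum>a<k. l i ^ a * l j ^ (k - 1 - a)))
        + (\<Sum>j=1..N. \<Sum>a<k. l j ^ a * l j ^ (k - 1 - a))"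
      by (rule sum_symmetric_pairs) (rule sym)
    also have "(\<Sum>j=1..N. \<Sum>a<k. l j ^ a * l j ^ (k - 1 - a)) = real k * power_sum N (k - 1) l"
    proof -
      have "(\<Sum>a<k. l j ^ a * l j ^ (k - 1 - a)) = real k * l j ^ (k - 1)" for j
        by (simp add: power_add[symmetric])
      then show ?thesis by (simp add: power_sum_def sum_distrib_left)
    qed
    finally show ?thesis by simp
  qed
  ultimately show ?thesis by simp
qed

text \<open>Integration by parts for \<open>l j ^ k * \<Psi> l\<close> times the squared Vandermonde product, summed over \<open>j\<close>.
  The derivative of \<open>l j ^ k\<close> contributes \<open>k\<close> times the power sum of order \<open>k - 1\<close>, which cancels the
  diagonal in \<open>vandermonde_logderiv\<close>; this exact cancellation is particular to the exponent \<open>2\<close>.\<close>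

lemma loop_equation_unnormalised:
  assumes N: "N \<ge> 1" and s: "smooth N \<Psi> D"
  shows "(\<integral>l. (((\<Sum>a<k. power_sum N a l * power_sum N (k - 1 - a) l) - 4 * real N * power_sum N (k + 1) l) * \<Psi> l
     + (\<Sum>j=1..N. l j ^ k * D j l)) * gue_weight N l \<partial>lebesgue_coords N) = 0"
proof -
  obtain E where E: "smooth N (vandermonde_square N) E"
    "\<And>k l. (\<Sum>j=1..N. l j ^ k * E j l) = vandermonde_square N l *
      ((\<Sum>a<k. power_sum N a l * power_sum N (k - 1 - a) l) - real k * power_sum N (k - 1) l)"
    using vandermonde_logderiv[of N] unfolding power_logderiv_def by blast
  define u where "u j l = vandermonde_square N l * (l j ^ k * \<Psi> l)" for j and l :: "nat \<Rightarrow> real"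
  define Du where "Du j i l = E i l * (l j ^ k * \<Psi> l) + vandermonde_square N l *
      ((if i = j then real k * l j ^ (k - 1) else 0) * \<Psi> l + l j ^ k * D i l)" for j i l
  have su: "smooth N (u j) (Du j)" if "j \<in> {1..N}" for j
    unfolding u_def[abs_def] Du_def[abs_def] by (intro smooth_mult E(1) s smooth_power that)
  let ?f = "\<lambda>j l. (Du j j l - 4 * real N * l j * u j l) * gauss_weight N l"
  have i: "integrable (lebesgue_coords N) (?f j)" if j: "j \<in> {1..N}" for j
    by (intro poly_growth_integrable[OF _ N] growth_intros smooth_growth[OF su] smooth_growth'[OF su] j)
  have pt: "(((\<Sum>a<k. power_sum N a l * power_sum N (k - 1 - a) l) - 4 * real N * power_sum N (k + 1) l) * \<Psi> l
     + (\<Sum>j=1..N. l j ^ k * D j l)) * gue_weight N l = (\<Sum>j=1..N. ?f j l)" for l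
  proof -
    let ?V = "vandermonde_square N l"
    have "(\<Sum>j=1..N. Du j j l - 4 * real N * l j * u j l) =
        (\<Sum>j=1..N. l j ^ k * E j l) * \<Psi> l + ?V * (real k * power_sum N (k - 1) l * \<Psi> l)
        + ?V * (\<Sum>j=1..N. l j ^ k * D j l) - 4 * real N * power_sum N (k + 1) l * (?V * \<Psi> l)"
      by (simp add: Du_def u_def power_sum_def sum_distrib_left sum_distrib_right sum_subtractf sum.distrib algebra_simps)
    also have "\<dots> = ?V * (((\<Sum>a<k. power_sum N a l * power_sum N (k - 1 - a) l) - 4 * real N * power_sum N (k + 1) l) * \<Psi> l
     + (\<Sum>j=1..N. l j ^ k * D j l))"
      unfolding E(2) by (simp add: algebra_simps)
    finally show ?thesis by (simp add: gue_weight_eq sum_distrib_right[symmetric])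
  qed
  have "(\<integral>l. (\<Sum>j=1..N. ?f j l) \<partial>lebesgue_coords N) = (\<Sum>j=1..N. \<integral>l. ?f j l \<partial>lebesgue_coords N)"
    by (rule Bochner_Integration.integral_sum) (rule i)
  also have "\<dots> = 0" by (intro sum.neutral ballI gauss_integration_by_parts su)
  finally show ?thesis unfolding pt .
qed

section \<open>Expectations under the eigenvalue density\<close>

lemma gue_weight_nonneg: "0 \<le> gue_weight N l"
  by (simp add: gue_weight_eq vandermonde_square_def gauss_weight_def prod_nonneg)

lemma vandermonde_growth: "poly_growth N (vandermonde_square N)"
  using vandermonde_logderiv[of N] smooth_growth unfolding power_logderiv_def by blast

lemma gue_integrable_lebesgue:
  assumes "N \<ge> 1" "poly_growth N g"
  shows "integrable (lebesgue_coords N) (\<lambda>l. g l * gue_weight N l)"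
  using poly_growth_integrable[OF poly_growth_mult[OF assms(2) vandermonde_growth] assms(1)]
  by (simp add: gue_weight_eq mult.assoc)

definition gue_mass :: "nat \<Rightarrow> real" where
  "gue_mass N = (\<integral>l. gue_weight N l \<partial>lebesgue_coords N)"

text \<open>The weight is positive on a box whose sides are disjoint intervals, since the coordinates are
  then distinct.\<close>

lemma gue_mass_pos:
  assumes N: "N \<ge> 1"
  shows "gue_mass N > 0"
proof (rule ccontr)
  assume "\<not> gue_mass N > 0"
  have i: "integrable (lebesgue_coords N) (gue_weight N)"
    using gue_integrable_lebesgue[OF N poly_growth_const[of N 1]] by simp
  have "gue_mass N \<ge> 0" unfolding gue_mass_def by (rule Bochner_Integration.integral_nonneg) (rule gue_weight_nonneg)
  then have "integral\<^sup>L (lebesgue_coords N) (gue_weight N) = 0"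
    using \<open>\<not> gue_mass N > 0\<close> by (simp add: gue_mass_def)
  then have ae: "AE l in lebesgue_coords N. gue_weight N l = 0"
    using integral_nonneg_eq_0_iff_AE[OF i] gue_weight_nonneg by simp
  let ?box = "\<Pi>\<^sub>E j\<in>{1..N}. {real j<..<real j + 1 / 2}"
  have pos: "gue_weight N l \<noteq> 0" if "l \<in> ?box" for l
  proof -
    have "l i \<noteq> l j" if "j \<in> {1..N}" "i \<in> {1..<j}" for i j
    proof -
      have "l i < real i + 1 / 2" "real j < l j"
        using PiE_mem[OF \<open>l \<in> ?box\<close>, of i] PiE_mem[OF \<open>l \<in> ?box\<close>, of j] that by auto
      moreover have "real i + 1 \<le> real j" using that by auto
      ultimately show ?thesis by linarith
    qed
    then show ?thesis
      using gauss_weight_pos[of N l] by (auto simp: gue_weight_eq vandermonde_square_def)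
  qed
  have box: "?box \<in> sets (lebesgue_coords N)" by (rule sets_PiM_I_finite) auto
  have "AE l in lebesgue_coords N. l \<notin> ?box" using ae by (rule eventually_mono) (use pos in blast)
  then have "emeasure (lebesgue_coords N) ?box = 0"
    using AE_iff_measurable[OF box, of "\<lambda>l. l \<notin> ?box"] sets.sets_into_space[OF box] by auto
  moreover have "emeasure (lebesgue_coords N) ?box = (\<Prod>j\<in>{1..N}. emeasure lborel {real j<..<real j + 1 / 2})"
    by (rule lborels.emeasure_PiM) auto
  moreover have "\<dots> \<noteq> 0" by (simp add: ennreal_power)
  ultimately show False by simp
qed

lemma gue_normalization_eq:
  assumes "N \<ge> 1"
  shows "gue_normalization N = ennreal (gue_mass N)"
  unfolding gue_normalization_def gue_mass_def
  by (rule nn_integral_eq_integral)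
    (use gue_integrable_lebesgue[OF assms poly_growth_const[of N 1]] gue_weight_nonneg in auto)

lemma sets_gue [simp, measurable_cong]: "sets (gue_eigenvalues N) = sets (lebesgue_coords N)"
  and space_gue: "space (gue_eigenvalues N) = space (lebesgue_coords N)"
  by (simp_all add: gue_eigenvalues_def)

lemma gue_weight_measurable [measurable]: "gue_weight N \<in> borel_measurable (lebesgue_coords N)"
  unfolding gue_weight_eq[abs_def] using poly_growth_measurable[OF vandermonde_growth] by measurable

lemma gue_density:
  assumes "N \<ge> 1"
  shows "gue_eigenvalues N = density (lebesgue_coords N) (\<lambda>l. ennreal (gue_weight N l / gue_mass N))"
  unfolding gue_eigenvalues_def gue_normalization_eq[OF assms]
  using gue_mass_pos[OF assms] gue_weight_nonneg by (simp add: divide_ennreal)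

lemma gue_integral:
  assumes N: "N \<ge> 1" and g: "poly_growth N g"
  shows "integrable (gue_eigenvalues N) g"
    and "integral\<^sup>L (gue_eigenvalues N) g = (\<integral>l. g l * gue_weight N l \<partial>lebesgue_coords N) / gue_mass N"
proof -
  have [measurable]: "g \<in> borel_measurable (lebesgue_coords N)" by (rule poly_growth_measurable[OF g])
  have m: "(\<lambda>l. gue_weight N l / gue_mass N) \<in> borel_measurable (lebesgue_coords N)" by measurable
  have nn: "AE l in lebesgue_coords N. 0 \<le> gue_weight N l / gue_mass N"
    using gue_mass_pos[OF N] gue_weight_nonneg by (intro AE_I2) simp
  have eq: "(gue_weight N l / gue_mass N) *\<^sub>R g l = g l * gue_weight N l / gue_mass N" for l
    by simp
  show "integrable (gue_eigenvalues N) g"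
    unfolding gue_density[OF N] integrable_density[OF poly_growth_measurable[OF g] m nn] eq
    by (intro Bochner_Integration.integrable_divide gue_integrable_lebesgue N g)
  show "integral\<^sup>L (gue_eigenvalues N) g = (\<integral>l. g l * gue_weight N l \<partial>lebesgue_coords N) / gue_mass N"
    unfolding gue_density[OF N] integral_density[OF poly_growth_measurable[OF g] m nn] eq by simp
qed

lemma prob_space_gue:
  assumes N: "N \<ge> 1"
  shows "prob_space (gue_eigenvalues N)"
proof
  have "emeasure (gue_eigenvalues N) (space (gue_eigenvalues N)) =
      (\<integral>\<^sup>+l. ennreal (gue_weight N l / gue_mass N) \<partial>lebesgue_coords N)"
  proof -
    have m: "(\<lambda>l. ennreal (gue_weight N l / gue_mass N)) \<in> borel_measurable (lebesgue_coords N)"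
      by measurable
    show ?thesis
      unfolding gue_density[OF N] space_density emeasure_density[OF m sets.top]
      by (intro nn_integral_cong) simp
  qed
  also have "\<dots> = ennreal (\<integral>l. gue_weight N l / gue_mass N \<partial>lebesgue_coords N)"
    using gue_integrable_lebesgue[OF N poly_growth_const[of N 1]] gue_mass_pos[OF N] gue_weight_nonneg
    by (intro nn_integral_eq_integral AE_I2) auto
  also have "\<dots> = 1" using gue_mass_pos[OF N] by (simp add: gue_mass_def)
  finally show "emeasure (gue_eigenvalues N) (space (gue_eigenvalues N)) = 1" .
qed

definition centred_power_sum :: "nat \<Rightarrow> nat \<Rightarrow> (nat \<Rightarrow> real) \<Rightarrow> real" where
  "centred_power_sum N k l = power_sum N k l - real N * sc_moment k"

lemma power_sum_growth: "poly_growth N (power_sum N k)"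
  unfolding power_sum_def[abs_def] by (intro growth_intros)

lemma centred_power_sum_growth: "poly_growth N (centred_power_sum N k)"
  unfolding centred_power_sum_def[abs_def] by (intro growth_intros power_sum_growth)

lemma centred_power_sum_0 [simp]: "centred_power_sum N 0 l = 0"
  by (simp add: centred_power_sum_def power_sum_def)

text \<open>Centring the power sums at the semicircle moments removes the terms of order \<open>N\<^sup>2\<close> from the drift,
  by \<open>sc_moment_convolution\<close>.\<close>

theorem loop_equation:
  assumes N: "N \<ge> 1" and s: "smooth N \<Psi> D"
  shows "(\<integral>l. (4 * centred_power_sum N (k + 1) l
        - 2 * (\<Sum>a<k. sc_moment a * centred_power_sum N (k - 1 - a) l)
        - 1 / real N * (\<Sum>a<k. centred_power_sum N a l * centred_power_sum N (k - 1 - a) l)) * \<Psi> l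
        \<partial>gue_eigenvalues N)
    = 1 / real N * (\<integral>l. (\<Sum>j=1..N. l j ^ k * D j l) \<partial>gue_eigenvalues N)"
proof -
  let ?\<nu> = "centred_power_sum N"
  let ?A = "\<lambda>l. (4 * ?\<nu> (k + 1) l - 2 * (\<Sum>a<k. sc_moment a * ?\<nu> (k - 1 - a) l)
        - 1 / real N * (\<Sum>a<k. ?\<nu> a l * ?\<nu> (k - 1 - a) l)) * \<Psi> l"
  let ?B = "\<lambda>l. \<Sum>j=1..N. l j ^ k * D j l"
  have gA: "poly_growth N ?A"
    by (intro growth_intros centred_power_sum_growth smooth_growth[OF s])
  have gB: "poly_growth N ?B" by (intro growth_intros smooth_growth'[OF s])
  have drift: "(\<Sum>a<k. power_sum N a l * power_sum N (k - 1 - a) l) - 4 * real N * power_sum N (k + 1) l =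
      - real N * (4 * ?\<nu> (k + 1) l - 2 * (\<Sum>a<k. sc_moment a * ?\<nu> (k - 1 - a) l)
        - 1 / real N * (\<Sum>a<k. ?\<nu> a l * ?\<nu> (k - 1 - a) l))" for l
  proof -
    let ?n = "real N" and ?s = sc_moment
    have p: "power_sum N m l = ?n * ?s m + ?\<nu> m l" for m by (simp add: centred_power_sum_def)
    have "(\<Sum>a<k. ?\<nu> a l * ?s (k - 1 - a)) = (\<Sum>a<k. ?\<nu> (k - Suc a) l * ?s (k - 1 - (k - Suc a)))"
      by (rule sum.nat_diff_reindex[symmetric])
    also have "\<dots> = (\<Sum>a<k. ?s a * ?\<nu> (k - 1 - a) l)"
      by (intro sum.cong) (auto simp: mult.commute)
    finally have r: "(\<Sum>a<k. ?\<nu> a l * ?s (k - 1 - a)) = (\<Sum>a<k. ?s a * ?\<nu> (k - 1 - a) l)" .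
    have "(\<Sum>a<k. power_sum N a l * power_sum N (k - 1 - a) l) =
        ?n\<^sup>2 * (\<Sum>a<k. ?s a * ?s (k - 1 - a)) + ?n * (\<Sum>a<k. ?s a * ?\<nu> (k - 1 - a) l)
        + ?n * (\<Sum>a<k. ?\<nu> a l * ?s (k - 1 - a)) + (\<Sum>a<k. ?\<nu> a l * ?\<nu> (k - 1 - a) l)"
      unfolding p by (simp add: sum_distrib_left sum.distrib algebra_simps power2_eq_square)
    then show ?thesis
      unfolding r sc_moment_convolution p[of "k + 1"] using N
      by (simp add: algebra_simps power2_eq_square)
  qed
  have "(\<integral>l. (- real N * ?A l + ?B l) * gue_weight N l \<partial>lebesgue_coords N) = 0"
    using loop_equation_unnormalised[OF N s, of k] unfolding drift by (simp only: mult.assoc)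
  moreover have "poly_growth N (\<lambda>l. - real N * ?A l + ?B l)"
    by (intro poly_growth_add[OF poly_growth_mult[OF poly_growth_const gA] gB])
  ultimately have "(\<integral>l. - real N * ?A l + ?B l \<partial>gue_eigenvalues N) = 0"
    using gue_integral(2)[OF N] by simp
  moreover have "(\<integral>l. - real N * ?A l + ?B l \<partial>gue_eigenvalues N) =
      - real N * (\<integral>l. ?A l \<partial>gue_eigenvalues N) + (\<integral>l. ?B l \<partial>gue_eigenvalues N)"
    using gue_integral(1)[OF N gA] gue_integral(1)[OF N gB]
    by (subst Bochner_Integration.integral_add) (auto simp only: integral_mult_right_zero intro!: integrable_mult_right)
  ultimately have "real N * (\<integral>l. ?A l \<partial>gue_eigenvalues N) = (\<integral>l. ?B l \<partial>gue_eigenvalues N)" by linarith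
  then show ?thesis using N by (simp add: field_simps)
qed

section \<open>Polynomials in the centred power sums\<close>

lemma smooth_cong:
  assumes "smooth N f D" "\<And>j l. j \<in> {1..N} \<Longrightarrow> D' j l = D j l"
  shows "smooth N f D'"
proof -
  have "D' j = D j" if "j \<in> {1..N}" for j using assms(2)[OF that] by (rule ext)
  then show ?thesis using assms(1) by (auto simp: smooth_def)
qed

lemma smooth_poly_sum:
  "smooth N (\<lambda>l. (\<Sum>i=1..N. poly p (l i)) + c) (\<lambda>j l. poly (pderiv p) (l j))"
proof -
  have coord: "smooth N (\<lambda>l. poly p (l i)) (\<lambda>j l. if j = i then poly (pderiv p) (l i) else 0)"
    if i: "i \<in> {1..N}" for i
    unfolding smooth_def
  proof (intro conjI ballI allI)
    show g: "poly_growth N (\<lambda>l. poly p (l i))" for p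
      unfolding poly_altdef by (intro growth_intros i)
    fix j l assume j: "j \<in> {1..N}"
    show "poly_growth N (\<lambda>l. if j = i then poly (pderiv p) (l i) else 0)"
      by (cases "j = i") (use g growth_intros in auto)
    show "((\<lambda>t. poly p ((l(j := t)) i)) has_real_derivative (if j = i then poly (pderiv p) (l i) else 0)) (at (l j))"
      by (cases "j = i") (auto intro: poly_DERIV)
    show "continuous_on UNIV (\<lambda>t. if j = i then poly (pderiv p) ((l(j := t)) i) else 0)"
      by (cases "j = i") (auto intro!: continuous_intros)
  qed
  have "smooth N (\<lambda>l. (\<Sum>i=1..N. poly p (l i)) + c)
      (\<lambda>j l. (\<Sum>i=1..N. if j = i then poly (pderiv p) (l i) else 0) + 0)"
    by (intro smooth_add smooth_sum smooth_const coord)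
  then show ?thesis by (rule smooth_cong) simp
qed

lemma smooth_centred_power_sum:
  "smooth N (centred_power_sum N m) (\<lambda>j l. real m * l j ^ (m - 1))"
  using smooth_poly_sum[of N "monom 1 m" "- real N * sc_moment m"]
  by (simp add: centred_power_sum_def[abs_def] power_sum_def poly_monom pderiv_monom)

definition nu_prod :: "nat \<Rightarrow> nat list \<Rightarrow> (nat \<Rightarrow> real) \<Rightarrow> real" where
  "nu_prod N ms l = (\<Prod>m\<leftarrow>ms. centred_power_sum N m l)"

lemma nu_prod_simps [simp]:
  "nu_prod N [] l = 1" "nu_prod N (m # ms) l = centred_power_sum N m l * nu_prod N ms l"
  "nu_prod N (ms @ ks) l = nu_prod N ms l * nu_prod N ks l"
  by (simp_all add: nu_prod_def)

text \<open>Families, indexed by \<open>N\<close>, of polynomials in the centred power sums whose coefficients stay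
  bounded in \<open>N\<close>; the degree of a monomial is the sum of its indices. The rule \<open>cong\<close> identifies
  families that agree for \<open>N \<ge> 1\<close>, since \<open>1 / real 0 = 0\<close> invalidates at \<open>N = 0\<close> the identity behind
  \<open>admissible_mean_power\<close>.\<close>

inductive admissible :: "nat \<Rightarrow> (nat \<Rightarrow> (nat \<Rightarrow> real) \<Rightarrow> real) \<Rightarrow> bool" for d where
  monomial: "(\<And>N. \<bar>c N\<bar> \<le> C) \<Longrightarrow> sum_list ms \<le> d \<Longrightarrow> admissible d (\<lambda>N l. c N * nu_prod N ms l)"
| add: "admissible d g \<Longrightarrow> admissible d h \<Longrightarrow> admissible d (\<lambda>N l. g N l + h N l)"
| cong: "admissible d g \<Longrightarrow> (\<And>N l. 1 \<le> N \<Longrightarrow> h N l = g N l) \<Longrightarrow> admissible d h"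

lemma admissible_mono: "admissible d h \<Longrightarrow> d \<le> e \<Longrightarrow> admissible e h"
proof (induction rule: admissible.induct)
  case (monomial c C ms)
  then show ?case by (intro admissible.monomial[of c C]) auto
next
  case (add g h)
  then show ?case by (intro admissible.add)
next
  case (cong g h)
  then show ?case by (intro admissible.cong[of e g h])
qed

lemma admissible_bounded: "(\<And>N. \<bar>c N\<bar> \<le> C) \<Longrightarrow> admissible d (\<lambda>N l. c N)"
  using admissible.monomial[of c C "[]" d] by simp

lemma admissible_const: "admissible d (\<lambda>N l. c)"
  by (rule admissible_bounded) (rule order_refl)

lemma admissible_inverse: "admissible d (\<lambda>N l. 1 / real N)"
  by (rule admissible_bounded[where C = 1]) (auto simp: divide_simps)

lemma admissible_centred: "m \<le> d \<Longrightarrow> admissible d (\<lambda>N l. centred_power_sum N m l)"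
  using admissible.monomial[of "\<lambda>_. 1" 1 "[m]" d] by simp

lemma admissible_nu_prod: "sum_list ms \<le> d \<Longrightarrow> admissible d (\<lambda>N l. nu_prod N ms l)"
  using admissible.monomial[of "\<lambda>_. 1" 1 ms d] by simp

lemma admissible_mult:
  assumes "admissible d g" "admissible e h"
  shows "admissible (d + e) (\<lambda>N l. g N l * h N l)"
  using assms(1)
proof induction
  case (monomial c C ms)
  note c = monomial
  from assms(2) show ?case
  proof induction
    case (monomial c' C' ms')
    have "admissible (d + e) (\<lambda>N l. (c N * c' N) * nu_prod N (ms @ ms') l)"
    proof (rule admissible.monomial)
      show "\<bar>c N * c' N\<bar> \<le> C * C'" for N
        unfolding abs_mult using c(1)[of N] monomial(1)[of N] by (intro mult_mono) auto
      show "sum_list (ms @ ms') \<le> d + e" using c(2) monomial(2) by simp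
    qed
    then show ?case by (rule admissible.cong) (simp add: algebra_simps)
  next
    case (add g h)
    from admissible.add[OF add.IH] show ?case by (rule admissible.cong) (simp add: algebra_simps)
  next
    case (cong g h)
    from cong.IH show ?case by (rule admissible.cong) (simp add: cong.hyps)
  qed
next
  case (add g g')
  from admissible.add[OF add.IH] show ?case by (rule admissible.cong) (simp add: algebra_simps)
next
  case (cong g g')
  from cong.IH show ?case by (rule admissible.cong) (simp add: cong.hyps)
qed

lemma admissible_mult_le:
  "admissible d g \<Longrightarrow> admissible e h \<Longrightarrow> d + e \<le> f \<Longrightarrow> admissible f (\<lambda>N l. g N l * h N l)"
  using admissible_mult admissible_mono by blast

lemma admissible_cmult: "admissible d h \<Longrightarrow> admissible d (\<lambda>N l. c * h N l)"
  using admissible_mult[OF admissible_const[of 0 c]] by simp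

lemma admissible_over_N: "admissible d h \<Longrightarrow> admissible d (\<lambda>N l. 1 / real N * h N l)"
  using admissible_mult[OF admissible_inverse[of 0]] by simp

lemma admissible_sum:
  "(\<And>i. i \<in> A \<Longrightarrow> admissible d (h i)) \<Longrightarrow> admissible d (\<lambda>N l. \<Sum>i\<in>A. h i N l)"
  by (induction A rule: infinite_finite_induct) (auto intro: admissible_const admissible.add)

lemma admissible_mean_power:
  assumes "m \<le> d"
  shows "admissible d (\<lambda>N l. 1 / real N * power_sum N m l)"
proof -
  have "admissible d (\<lambda>N l. sc_moment m + 1 / real N * centred_power_sum N m l)"
    by (intro admissible.add admissible_const admissible_over_N admissible_centred assms)
  then show ?thesis
    by (rule admissible.cong) (simp add: centred_power_sum_def field_simps)
qed

fun nu_prod_deriv :: "nat \<Rightarrow> nat list \<Rightarrow> nat \<Rightarrow> (nat \<Rightarrow> real) \<Rightarrow> real" where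
  "nu_prod_deriv N [] j l = 0"
| "nu_prod_deriv N (m # ms) j l =
    real m * l j ^ (m - 1) * nu_prod N ms l + centred_power_sum N m l * nu_prod_deriv N ms j l"

lemma smooth_nu_prod: "smooth N (nu_prod N ms) (nu_prod_deriv N ms)"
proof (induction ms)
  case Nil
  have "nu_prod N [] = (\<lambda>_. 1)" "nu_prod_deriv N [] = (\<lambda>_ _. 0)" by (simp_all add: fun_eq_iff)
  then show ?case using smooth_const[of N 1] by simp
next
  case (Cons m ms)
  have "nu_prod N (m # ms) = (\<lambda>l. centred_power_sum N m l * nu_prod N ms l)"
    "nu_prod_deriv N (m # ms) = (\<lambda>j l. real m * l j ^ (m - 1) * nu_prod N ms l
       + centred_power_sum N m l * nu_prod_deriv N ms j l)"
    by (simp_all add: fun_eq_iff)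
  then show ?case using smooth_mult[OF smooth_centred_power_sum Cons] by simp
qed

lemma admissible_smooth:
  "admissible d h \<Longrightarrow> \<forall>N\<ge>1. \<exists>D. smooth N (h N) D"
proof (induction rule: admissible.induct)
  case (monomial c C ms)
  then show ?case using smooth_cmult[OF smooth_nu_prod] by blast
next
  case (add g h)
  then show ?case using smooth_add by blast
next
  case (cong g h)
  then have "h N = g N" if "N \<ge> 1" for N using that by (intro ext) auto
  then show ?case using cong.IH by simp
qed

lemma admissible_growth: "admissible d h \<Longrightarrow> N \<ge> 1 \<Longrightarrow> poly_growth N (h N)"
  using admissible_smooth smooth_growth by blast

text \<open>Differentiating \<open>\<nu>\<^sub>m\<close> along the field \<open>l j ^ k\<close> produces \<open>m\<close> times the power sum of order \<open>k + m - 1\<close>,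
  of size \<open>N\<close>; the factor \<open>1 / N\<close> brings it back to the admissible families.\<close>

lemma admissible_nu_prod_drift:
  "admissible (k + sum_list ms) (\<lambda>N l. 1 / real N * (\<Sum>j=1..N. l j ^ k * nu_prod_deriv N ms j l))"
proof (induction ms)
  case Nil then show ?case by (simp add: admissible_const)
next
  case (Cons m ms)
  have "admissible (k + sum_list (m # ms)) (\<lambda>N l.
      real m * ((1 / real N * power_sum N (k + (m - 1)) l) * nu_prod N ms l)
      + centred_power_sum N m l * (1 / real N * (\<Sum>j=1..N. l j ^ k * nu_prod_deriv N ms j l)))"
    by (intro admissible.add admissible_cmult
        admissible_mult_le[OF admissible_mean_power[OF order_refl] admissible_nu_prod[OF order_refl]]
        admissible_mult_le[OF admissible_centred[OF order_refl] Cons]) auto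
  then show ?case
    by (rule admissible.cong)
      (simp add: power_sum_def sum.distrib sum_distrib_left sum_distrib_right power_add algebra_simps sum_divide_distrib)
qed

section \<open>Representation by divergences\<close>

inductive vector_field :: "(nat \<Rightarrow> nat \<Rightarrow> (nat \<Rightarrow> real) \<Rightarrow> real) \<Rightarrow> bool" where
  monomial: "admissible d h \<Longrightarrow> vector_field (\<lambda>N j l. h N l * l j ^ k)"
| add: "vector_field U \<Longrightarrow> vector_field V \<Longrightarrow> vector_field (\<lambda>N j l. U N j l + V N j l)"

lemma vector_field_0: "vector_field (\<lambda>N j l. 0)"
  using vector_field.monomial[OF admissible_const[of 0 0], of 0] by simp

lemma vector_field_scale:
  assumes "vector_field U" "\<And>N. \<bar>c N\<bar> \<le> C"
  shows "vector_field (\<lambda>N j l. c N * U N j l)"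
  using assms(1)
proof induction
  case (monomial d h k)
  from vector_field.monomial[where k = k, OF admissible_mult[OF admissible_bounded[of c C 0, OF assms(2)] monomial]]
  show ?case by (simp add: mult.assoc)
next
  case (add U V)
  from vector_field.add[OF add.IH] show ?case by (simp add: distrib_left)
qed

lemma vector_field_growth:
  "vector_field U \<Longrightarrow> N \<ge> 1 \<Longrightarrow> j \<in> {1..N} \<Longrightarrow> poly_growth N (U N j)"
proof (induction rule: vector_field.induct)
  case (monomial d h k)
  then have "poly_growth N (\<lambda>l. h N l * l j ^ k)"
    by (intro growth_intros admissible_growth[of d h]) auto
  then show ?case by simp
next
  case (add U V)
  then show ?case using poly_growth_add[of N "U N j" "V N j"] by simp
qed

lemma vector_field_pairing:
  "vector_field U \<Longrightarrow> \<exists>d. admissible d (\<lambda>N l. 1 / real N * (\<Sum>j=1..N. U N j l * poly p (l j)))"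
proof (induction rule: vector_field.induct)
  case (monomial d h k)
  have "admissible (d + (k + degree p)) (\<lambda>N l. h N l *
      (\<Sum>m\<le>degree p. coeff p m * (1 / real N * power_sum N (k + m) l)))"
    by (intro admissible_mult monomial admissible_sum admissible_cmult admissible_mean_power) auto
  moreover have "1 / real N * (\<Sum>j=1..N. h N l * l j ^ k * poly p (l j)) =
      h N l * (\<Sum>m\<le>degree p. coeff p m * (1 / real N * power_sum N (k + m) l))" for N l
  proof -
    have "(\<Sum>j=1..N. l j ^ k * poly p (l j)) = (\<Sum>m\<le>degree p. coeff p m * power_sum N (k + m) l)"
      unfolding poly_altdef power_sum_def sum_distrib_left power_add
      by (subst sum.swap) (simp add: algebra_simps)
    moreover have "(\<Sum>j=1..N. h N l * l j ^ k * poly p (l j)) = h N l * (\<Sum>j=1..N. l j ^ k * poly p (l j))"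
      by (simp add: sum_distrib_left mult.assoc)
    ultimately have "(\<Sum>j=1..N. h N l * l j ^ k * poly p (l j)) = h N l * (\<Sum>m\<le>degree p. coeff p m * power_sum N (k + m) l)"
      by (simp only:)
    then show ?thesis by (simp add: sum_distrib_left algebra_simps)
  qed
  ultimately have "admissible (d + (k + degree p)) (\<lambda>N l. 1 / real N * (\<Sum>j=1..N. h N l * l j ^ k * poly p (l j)))"
    by (rule admissible.cong)
  then show ?case by blast
next
  case (add U V)
  then obtain d e where "admissible d (\<lambda>N l. 1 / real N * (\<Sum>j=1..N. U N j l * poly p (l j)))"
    "admissible e (\<lambda>N l. 1 / real N * (\<Sum>j=1..N. V N j l * poly p (l j)))" by blast
  then have "admissible (max d e) (\<lambda>N l. 1 / real N * (\<Sum>j=1..N. U N j l * poly p (l j))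
      + 1 / real N * (\<Sum>j=1..N. V N j l * poly p (l j)))"
    by (intro admissible.add) (auto intro: admissible_mono)
  then have "admissible (max d e) (\<lambda>N l. 1 / real N * (\<Sum>j=1..N. (U N j l + V N j l) * poly p (l j)))"
    by (rule admissible.cong) (simp add: distrib_right sum.distrib add_divide_distrib)
  then show ?case by blast
qed

text \<open>In the weak sense, \<open>g\<close> is its mean \<open>c\<close> minus \<open>1 / N\<close> times the divergence of \<open>U\<close> with respect to
  the eigenvalue density.\<close>

definition stein_identity where
  "stein_identity N g c U \<longleftrightarrow> (\<forall>\<Psi> D. smooth N \<Psi> D \<longrightarrow>
    (\<integral>l. g l * \<Psi> l \<partial>gue_eigenvalues N) = c * (\<integral>l. \<Psi> l \<partial>gue_eigenvalues N)
      + 1 / real N * (\<integral>l. (\<Sum>j=1..N. U j l * D j l) \<partial>gue_eigenvalues N))"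

definition stein_rep :: "(nat \<Rightarrow> (nat \<Rightarrow> real) \<Rightarrow> real) \<Rightarrow> bool" where
  "stein_rep g \<longleftrightarrow> (\<exists>c C U. (\<forall>N. \<bar>c N\<bar> \<le> C) \<and> vector_field U \<and>
     (\<forall>N\<ge>1. stein_identity N (g N) (c N) (U N)))"

lemma pairing_growth:
  assumes "smooth N \<Psi> D" "\<And>j. j \<in> {1..N} \<Longrightarrow> poly_growth N (U j)"
  shows "poly_growth N (\<lambda>l. \<Sum>j=1..N. U j l * D j l)"
  by (intro growth_intros assms(2) smooth_growth'[OF assms(1)])

lemma stein_rep_add:
  assumes "stein_rep g" "stein_rep h"
    and gr: "\<And>N. N \<ge> 1 \<Longrightarrow> poly_growth N (g N)" "\<And>N. N \<ge> 1 \<Longrightarrow> poly_growth N (h N)"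
  shows "stein_rep (\<lambda>N l. g N l + h N l)"
proof -
  obtain c C U where 1: "\<And>N. \<bar>c N\<bar> \<le> C" "vector_field U" "\<And>N. N \<ge> 1 \<Longrightarrow> stein_identity N (g N) (c N) (U N)"
    using assms(1) by (auto simp: stein_rep_def)
  obtain d D V where 2: "\<And>N. \<bar>d N\<bar> \<le> D" "vector_field V" "\<And>N. N \<ge> 1 \<Longrightarrow> stein_identity N (h N) (d N) (V N)"
    using assms(2) by (auto simp: stein_rep_def)
  have "stein_identity N (\<lambda>l. g N l + h N l) (c N + d N) (\<lambda>j l. U N j l + V N j l)" if N: "N \<ge> 1" for N
    unfolding stein_identity_def
  proof (intro allI impI)
    fix \<Psi> E assume s: "smooth N \<Psi> E"
    have i: "integrable (gue_eigenvalues N) (\<lambda>l. g N l * \<Psi> l)" "integrable (gue_eigenvalues N) (\<lambda>l. h N l * \<Psi> l)"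
      "integrable (gue_eigenvalues N) (\<lambda>l. \<Sum>j=1..N. U N j l * E j l)"
      "integrable (gue_eigenvalues N) (\<lambda>l. \<Sum>j=1..N. V N j l * E j l)"
      by (intro gue_integral(1)[OF N] poly_growth_mult gr N smooth_growth[OF s] pairing_growth[OF s]
          vector_field_growth[OF 1(2) N] vector_field_growth[OF 2(2) N]; assumption)+
    show "(\<integral>l. (g N l + h N l) * \<Psi> l \<partial>gue_eigenvalues N) = (c N + d N) * (\<integral>l. \<Psi> l \<partial>gue_eigenvalues N)
      + 1 / real N * (\<integral>l. (\<Sum>j=1..N. (U N j l + V N j l) * E j l) \<partial>gue_eigenvalues N)"
      using 1(3)[OF N, unfolded stein_identity_def, rule_format, OF s]
        2(3)[OF N, unfolded stein_identity_def, rule_format, OF s] i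
      by (simp add: distrib_right sum.distrib distrib_left add_divide_distrib)
  qed
  moreover have "\<bar>c N + d N\<bar> \<le> C + D" for N using 1(1)[of N] 2(1)[of N] by linarith
  ultimately show ?thesis
    unfolding stein_rep_def using vector_field.add[OF 1(2) 2(2)]
    by (intro exI[of _ "\<lambda>N. c N + d N"] exI[of _ "C + D"] exI[of _ "\<lambda>N j l. U N j l + V N j l"]) simp
qed

lemma stein_rep_scale:
  assumes "stein_rep g" and b: "\<And>N. \<bar>b N\<bar> \<le> B"
  shows "stein_rep (\<lambda>N l. b N * g N l)"
proof -
  obtain c C U where 1: "\<And>N. \<bar>c N\<bar> \<le> C" "vector_field U" "\<And>N. N \<ge> 1 \<Longrightarrow> stein_identity N (g N) (c N) (U N)"
    using assms(1) by (auto simp: stein_rep_def)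
  have "stein_identity N (\<lambda>l. b N * g N l) (b N * c N) (\<lambda>j l. b N * U N j l)" if N: "N \<ge> 1" for N
    using 1(3)[OF N] unfolding stein_identity_def
    by (simp add: mult.assoc sum_distrib_left[symmetric] distrib_left)
  moreover have "\<bar>b N * c N\<bar> \<le> B * C" for N
    unfolding abs_mult using b[of N] 1(1)[of N] by (intro mult_mono) auto
  ultimately show ?thesis
    unfolding stein_rep_def using vector_field_scale[OF 1(2) b]
    by (intro exI[of _ "\<lambda>N. b N * c N"] exI[of _ "B * C"] exI[of _ "\<lambda>N j l. b N * U N j l"]) simp
qed

lemma stein_rep_cong:
  assumes "stein_rep g" "\<And>N l. 1 \<le> N \<Longrightarrow> h N l = g N l"
  shows "stein_rep h"
proof -
  have "h N = g N" if "N \<ge> 1" for N using assms(2)[OF that] by (rule ext)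
  then show ?thesis using assms(1) by (auto simp: stein_rep_def)
qed

lemma stein_rep_const: "stein_rep (\<lambda>N l. c)"
  unfolding stein_rep_def stein_identity_def
  by (intro exI[of _ "\<lambda>_. c"] exI[of _ "\<bar>c\<bar>"] exI[of _ "\<lambda>_ _ _. 0"]) (simp add: vector_field_0)

text \<open>Let \<open>m = k + 1\<close> be the first index and \<open>P\<close> the product over the other indices. The loop equation,
  tested with \<open>P \<Psi>\<close>, expresses \<open>4 \<nu>\<^sub>m P\<close> through the remainder \<open>R\<close>, whose degree is smaller, and the
  divergence of the field \<open>P l j ^ k\<close>.\<close>

lemma stein_rep_nu_prod_step:
  assumes IH: "\<And>d' h. d' < d \<Longrightarrow> admissible d' h \<Longrightarrow> stein_rep h" and le: "sum_list ms \<le> d"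
  shows "stein_rep (\<lambda>N l. nu_prod N ms l)"
proof (cases ms)
  case Nil
  then show ?thesis using stein_rep_const[of 1] by simp
next
  case (Cons m ms')
  show ?thesis
  proof (cases m)
    case 0
    then show ?thesis using Cons stein_rep_const[of 0] by simp
  next
    case (Suc k)
    \<comment> \<open>The terms of the loop equation that lose degree, including the derivative of the other factors.\<close>
    define R where "R N l = 2 * (\<Sum>a<k. sc_moment a * (centred_power_sum N (k - 1 - a) l * nu_prod N ms' l))
      + 1 / real N * (\<Sum>a<k. (centred_power_sum N a l * centred_power_sum N (k - 1 - a) l) * nu_prod N ms' l)
      + 1 / real N * (\<Sum>j=1..N. l j ^ k * nu_prod_deriv N ms' j l)" for N l
    have R: "admissible (k + sum_list ms') R"
      unfolding R_def[abs_def]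
      by (intro admissible.add admissible_cmult admissible_over_N admissible_sum admissible_nu_prod_drift
          admissible_mult_le[OF admissible_centred[OF order_refl] admissible_nu_prod[OF order_refl]]
          admissible_mult_le[OF admissible_mult[OF admissible_centred[OF order_refl] admissible_centred[OF order_refl]]
            admissible_nu_prod[OF order_refl]]) auto
    have "k + sum_list ms' < d" using le Cons Suc by simp
    from IH[OF this R] obtain c C U where U: "\<And>N. \<bar>c N\<bar> \<le> C" "vector_field U"
      "\<And>N. N \<ge> 1 \<Longrightarrow> stein_identity N (R N) (c N) (U N)"
      by (auto simp: stein_rep_def)
    let ?V = "\<lambda>N j l. 1 / 4 * (U N j l + nu_prod N ms' l * l j ^ k)"
    have V: "vector_field ?V"
      by (rule vector_field_scale[where C = "1/4"])
        (auto intro!: vector_field.intros U(2) admissible_nu_prod[OF order_refl])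
    have "stein_identity N (nu_prod N ms) (c N / 4) (?V N)" if N: "N \<ge> 1" for N
      unfolding stein_identity_def
    proof (intro allI impI)
      fix \<Psi> D assume s: "smooth N \<Psi> D"
      let ?E = "\<lambda>f. \<integral>l. f l \<partial>gue_eigenvalues N" and ?P = "nu_prod N ms'" and ?\<nu> = "centred_power_sum N"
      note sP = smooth_mult[OF smooth_nu_prod[of N ms'] s]
      have gP: "poly_growth N ?P" by (rule smooth_growth[OF smooth_nu_prod])
      have gR: "poly_growth N (R N)" by (rule admissible_growth[OF R N])
      have i1: "integrable (gue_eigenvalues N) (\<lambda>l. 4 * (nu_prod N ms l * \<Psi> l))"
        by (intro gue_integral(1)[OF N] growth_intros smooth_growth[OF s] smooth_growth[OF smooth_nu_prod])
      have i2: "integrable (gue_eigenvalues N) (\<lambda>l. R N l * \<Psi> l)"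
        by (intro gue_integral(1)[OF N] growth_intros smooth_growth[OF s] gR)
      have i3: "integrable (gue_eigenvalues N) (\<lambda>l. 1 / real N * (\<Sum>j=1..N. l j ^ k * nu_prod_deriv N ms' j l) * \<Psi> l)"
        by (intro gue_integral(1)[OF N] growth_intros smooth_growth[OF s] smooth_growth'[OF smooth_nu_prod])
      have i4: "integrable (gue_eigenvalues N) (\<lambda>l. \<Sum>j=1..N. ?P l * l j ^ k * D j l)"
        by (intro gue_integral(1)[OF N] growth_intros gP smooth_growth'[OF s])
      have i5: "integrable (gue_eigenvalues N) (\<lambda>l. \<Sum>j=1..N. U N j l * D j l)"
        by (intro gue_integral(1)[OF N] pairing_growth[OF s] vector_field_growth[OF U(2) N])
      let ?dr = "\<lambda>l. 1 / real N * (\<Sum>j=1..N. l j ^ k * nu_prod_deriv N ms' j l) * \<Psi> l"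
      have "(4 * ?\<nu> (k + 1) l - 2 * (\<Sum>a<k. sc_moment a * ?\<nu> (k - 1 - a) l)
        - 1 / real N * (\<Sum>a<k. ?\<nu> a l * ?\<nu> (k - 1 - a) l)) * (?P l * \<Psi> l) =
        4 * (nu_prod N ms l * \<Psi> l) - R N l * \<Psi> l + ?dr l" for l
        by (simp add: R_def Cons Suc sum_distrib_left sum_distrib_right algebra_simps)
      moreover have "(\<Sum>j=1..N. l j ^ k * (nu_prod_deriv N ms' j l * \<Psi> l + ?P l * D j l)) =
          real N * ?dr l + (\<Sum>j=1..N. ?P l * l j ^ k * D j l)" for l
        using N by (simp add: sum_distrib_left sum_distrib_right sum.distrib algebra_simps)
      ultimately have "?E (\<lambda>l. 4 * (nu_prod N ms l * \<Psi> l) - R N l * \<Psi> l + ?dr l) =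
          1 / real N * ?E (\<lambda>l. real N * ?dr l + (\<Sum>j=1..N. ?P l * l j ^ k * D j l))"
        using loop_equation[OF N sP, of k] by simp
      moreover have "?E (\<lambda>l. 4 * (nu_prod N ms l * \<Psi> l) - R N l * \<Psi> l + ?dr l) =
          4 * ?E (\<lambda>l. nu_prod N ms l * \<Psi> l) - ?E (\<lambda>l. R N l * \<Psi> l) + ?E ?dr"
        using i1 i2 i3 by (subst Bochner_Integration.integral_add Bochner_Integration.integral_diff,
            (auto simp del: times_divide_eq_left)[2])+ (simp only: integral_mult_right_zero)
      moreover have "?E (\<lambda>l. real N * ?dr l + (\<Sum>j=1..N. ?P l * l j ^ k * D j l)) =
          real N * ?E ?dr + ?E (\<lambda>l. \<Sum>j=1..N. ?P l * l j ^ k * D j l)"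
        by (subst Bochner_Integration.integral_add[OF integrable_mult_right[OF i3] i4])
          (simp only: integral_mult_right_zero)
      moreover have "?E (\<lambda>l. R N l * \<Psi> l) = c N * ?E \<Psi> + 1 / real N * ?E (\<lambda>l. \<Sum>j=1..N. U N j l * D j l)"
        using U(3)[OF N] s by (simp add: stein_identity_def)
      moreover have "?E (\<lambda>l. \<Sum>j=1..N. ?V N j l * D j l) =
          1 / 4 * (?E (\<lambda>l. \<Sum>j=1..N. U N j l * D j l) + ?E (\<lambda>l. \<Sum>j=1..N. ?P l * l j ^ k * D j l))"
      proof -
        have "(\<Sum>j=1..N. ?V N j l * D j l) =
            1 / 4 * ((\<Sum>j=1..N. U N j l * D j l) + (\<Sum>j=1..N. ?P l * l j ^ k * D j l))" for l
          by (simp only: sum_distrib_left sum.distrib[symmetric]) (simp add: algebra_simps)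
        then show ?thesis using i4 i5 by (simp only: integral_mult_right_zero Bochner_Integration.integral_add)
      qed
      ultimately show "?E (\<lambda>l. nu_prod N ms l * \<Psi> l) = c N / 4 * ?E \<Psi>
          + 1 / real N * ?E (\<lambda>l. \<Sum>j=1..N. ?V N j l * D j l)"
        using N by (simp add: field_simps)
    qed
    moreover have "\<bar>c N / 4\<bar> \<le> C" for N using U(1)[of N] by simp
    ultimately show ?thesis
      unfolding stein_rep_def using V
      by (intro exI[of _ "\<lambda>N. c N / 4"] exI[of _ C] exI[of _ ?V]) simp
  qed
qed

theorem admissible_stein_rep: "admissible d h \<Longrightarrow> stein_rep h"
proof (induction d arbitrary: h rule: less_induct)
  case (less d)
  from less.prems show ?case
  proof induction
    case (monomial c C ms)
    then show ?case by (intro stein_rep_scale stein_rep_nu_prod_step[OF less.IH])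
  next
    case (add g h)
    then show ?case by (intro stein_rep_add admissible_growth[of d])
  next
    case (cong g h)
    then show ?case using stein_rep_cong by blast
  qed
qed

text \<open>For the constant test function the divergence drops out.\<close>

corollary admissible_moment_bounded:
  assumes "admissible d h"
  shows "\<exists>C. \<forall>N\<ge>1. \<bar>\<integral>l. h N l \<partial>gue_eigenvalues N\<bar> \<le> C"
proof -
  obtain c C U where U: "\<And>N. \<bar>c N\<bar> \<le> C" "\<And>N. N \<ge> 1 \<Longrightarrow> stein_identity N (h N) (c N) (U N)"
    using admissible_stein_rep[OF assms] by (auto simp: stein_rep_def)
  have "\<bar>\<integral>l. h N l \<partial>gue_eigenvalues N\<bar> \<le> C" if N: "N \<ge> 1" for N
  proof -
    interpret prob_space "gue_eigenvalues N" by (rule prob_space_gue[OF N])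
    show ?thesis
      using U(2)[OF N, unfolded stein_identity_def, rule_format, OF smooth_const[of N 1]] U(1)[of N]
      by (simp add: prob_space)
  qed
  then show ?thesis by blast
qed

section \<open>The upper bound for linear statistics\<close>

lemma moment_functional_affine:
  "moment_functional (\<lambda>k. c k + b * d k) p = moment_functional c p + b * moment_functional d p"
  by (simp add: moment_functional_def sum_distrib_left sum.distrib algebra_simps)

lemma power_sum_poly: "(\<Sum>j=1..N. poly p (l j)) = moment_functional (\<lambda>k. power_sum N k l) p"
  unfolding poly_altdef moment_functional_def power_sum_def sum_distrib_left by (rule sum.swap)

lemma nu_integral_poly: "nu_integral N (poly p) l = moment_functional (\<lambda>k. centred_power_sum N k l) p"
  using moment_functional_affine[of "\<lambda>k. power_sum N k l" "- real N" sc_moment p]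
  unfolding nu_integral_def integral_mu_sc_poly power_sum_poly by (simp add: centred_power_sum_def)

lemma admissible_nu_integral: "admissible (degree p) (\<lambda>N l. nu_integral N (poly p) l)"
  unfolding nu_integral_poly moment_functional_def
  by (intro admissible_sum) (auto simp: mult.commute[of _ "centred_power_sum _ _ _"]
      intro!: admissible_mult_le[OF admissible_centred[OF order_refl] admissible_const[of 0]])

lemma smooth_nu_integral: "smooth N (nu_integral N (poly p)) (\<lambda>j l. poly (pderiv p) (l j))"
  using smooth_poly_sum[of N p "- real N * (LINT x|mu_sc. poly p x)"]
  by (simp add: nu_integral_def[abs_def])

text \<open>The loop equations are combined with the coefficients of \<open>H p\<close>, the difference quotient with
  the arcsine moments. By \<open>drift_inversion\<close> their linear parts add up to \<open>4 \<nu>(p)\<close>; the quadratic part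
  \<open>Q\<close> carries a factor \<open>1 / N\<close> and is itself a mean plus a divergence.\<close>

theorem linear_statistic_stein:
  obtains c C U where "\<And>N. \<bar>c N :: real\<bar> \<le> C" "vector_field U"
    "\<And>N \<Psi> D. N \<ge> 1 \<Longrightarrow> smooth N \<Psi> D \<Longrightarrow>
      4 * (\<integral>l. nu_integral N (poly p) l * \<Psi> l \<partial>gue_eigenvalues N) =
      1 / real N * (c N * (\<integral>l. \<Psi> l \<partial>gue_eigenvalues N)
       + (\<integral>l. (\<Sum>j=1..N. (poly (difference_quotient arcsine_moment p) (l j) + 1 / real N * U N j l) * D j l)
           \<partial>gue_eigenvalues N))"
proof -
  define h where "h = difference_quotient arcsine_moment p"
  define Q where "Q N l = (\<Sum>k\<le>degree h. coeff h k *
      (\<Sum>a<k. centred_power_sum N a l * centred_power_sum N (k - 1 - a) l))" for N l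
  have Q: "admissible (2 * degree h) Q"
    unfolding Q_def[abs_def]
    by (intro admissible_sum admissible_cmult
        admissible_mult_le[OF admissible_centred[OF order_refl] admissible_centred[OF order_refl]]) auto
  obtain c C U where U: "\<And>N. \<bar>c N\<bar> \<le> C" "vector_field U"
      "\<And>N. N \<ge> 1 \<Longrightarrow> stein_identity N (Q N) (c N) (U N)"
    using admissible_stein_rep[OF Q] by (auto simp: stein_rep_def)
  have "4 * (\<integral>l. nu_integral N (poly p) l * \<Psi> l \<partial>gue_eigenvalues N) =
      1 / real N * (c N * (\<integral>l. \<Psi> l \<partial>gue_eigenvalues N)
       + (\<integral>l. (\<Sum>j=1..N. (poly h (l j) + 1 / real N * U N j l) * D j l) \<partial>gue_eigenvalues N))"
    if N: "N \<ge> 1" and s: "smooth N \<Psi> D" for N \<Psi> D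
  proof -
    let ?E = "\<lambda>f. \<integral>l. f l \<partial>gue_eigenvalues N" and ?\<nu> = "centred_power_sum N"
    let ?A = "\<lambda>k l. (4 * ?\<nu> (k + 1) l - 2 * (\<Sum>a<k. sc_moment a * ?\<nu> (k - 1 - a) l)
        - 1 / real N * (\<Sum>a<k. ?\<nu> a l * ?\<nu> (k - 1 - a) l)) * \<Psi> l"
    have iA: "integrable (gue_eigenvalues N) (?A k)" for k
      by (intro gue_integral(1)[OF N] growth_intros centred_power_sum_growth smooth_growth[OF s])
    have iB: "integrable (gue_eigenvalues N) (\<lambda>l. \<Sum>j=1..N. l j ^ k * D j l)" for k
      by (intro gue_integral(1)[OF N] growth_intros smooth_growth'[OF s])
    have i1: "integrable (gue_eigenvalues N) (\<lambda>l. nu_integral N (poly p) l * \<Psi> l)"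
      by (intro gue_integral(1)[OF N] growth_intros smooth_growth[OF s] smooth_growth[OF smooth_nu_integral])
    have i2: "integrable (gue_eigenvalues N) (\<lambda>l. Q N l * \<Psi> l)"
      by (intro gue_integral(1)[OF N] growth_intros smooth_growth[OF s] admissible_growth[OF Q N])
    have gh: "poly_growth N (\<lambda>l. poly h (l j))" if "j \<in> {1..N}" for j
      unfolding poly_altdef using that by (intro growth_intros)
    have i3: "integrable (gue_eigenvalues N) (\<lambda>l. \<Sum>j=1..N. poly h (l j) * D j l)"
      by (intro gue_integral(1)[OF N] pairing_growth[OF s] gh)
    have i4: "integrable (gue_eigenvalues N) (\<lambda>l. \<Sum>j=1..N. U N j l * D j l)"
      by (intro gue_integral(1)[OF N] pairing_growth[OF s] vector_field_growth[OF U(2) N])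
    have lhs: "(\<Sum>k\<le>degree h. coeff h k * ?A k l) =
        4 * (nu_integral N (poly p) l * \<Psi> l) - 1 / real N * (Q N l * \<Psi> l)" for l
    proof -
      let ?M = "moment_functional (\<lambda>k. ?\<nu> k l)"
      have quotient: "?M (difference_quotient sc_moment h) = (\<Sum>k\<le>degree h. coeff h k * (\<Sum>a<k. sc_moment a * ?\<nu> (k - 1 - a) l))"
        using moment_functional_difference_quotient[of "\<lambda>k. ?\<nu> k l" sc_moment h 1]
        by (simp add: moment_functional_monom sum_distrib_left mult.assoc)
      have shift: "?M (pCons 0 h) = (\<Sum>k\<le>degree h. coeff h k * ?\<nu> (k + 1) l)"
        by (simp add: moment_functional_pCons) (simp add: moment_functional_def)
      have "4 * ?M (pCons 0 h) - 2 * ?M (difference_quotient sc_moment h) = 4 * ?M p"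
        using arg_cong[OF drift_inversion[of p], of ?M]
        unfolding h_def[symmetric] moment_functional_diff moment_functional_smult
        by (simp add: moment_functional_pCons)
      moreover have "(\<Sum>k\<le>degree h. coeff h k * ?A k l) =
          (4 * ?M (pCons 0 h) - 2 * ?M (difference_quotient sc_moment h) - 1 / real N * Q N l) * \<Psi> l"
        unfolding shift quotient Q_def
        by (simp add: sum_distrib_left sum_distrib_right sum_subtractf sum.distrib algebra_simps)
      ultimately have "(\<Sum>k\<le>degree h. coeff h k * ?A k l) = (4 * ?M p - 1 / real N * Q N l) * \<Psi> l"
        by (simp only:)
      then show ?thesis by (simp add: nu_integral_poly algebra_simps)
    qed
    have rhs: "(\<Sum>k\<le>degree h. coeff h k * (\<Sum>j=1..N. l j ^ k * D j l)) = (\<Sum>j=1..N. poly h (l j) * D j l)" for l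
      unfolding poly_altdef sum_distrib_left sum_distrib_right by (subst sum.swap) (simp add: mult.assoc)
    have "?E (\<lambda>l. \<Sum>k\<le>degree h. coeff h k * ?A k l) = (\<Sum>k\<le>degree h. coeff h k * ?E (?A k))"
      by (subst Bochner_Integration.integral_sum) (use iA in \<open>auto intro!: integrable_mult_right simp only: integral_mult_right_zero\<close>)
    also have "\<dots> = (\<Sum>k\<le>degree h. coeff h k * (1 / real N * ?E (\<lambda>l. \<Sum>j=1..N. l j ^ k * D j l)))"
      by (simp only: loop_equation[OF N s])
    also have "\<dots> = 1 / real N * (\<Sum>k\<le>degree h. coeff h k * ?E (\<lambda>l. \<Sum>j=1..N. l j ^ k * D j l))"
      by (simp add: sum_distrib_left algebra_simps)
    also have "(\<Sum>k\<le>degree h. coeff h k * ?E (\<lambda>l. \<Sum>j=1..N. l j ^ k * D j l)) =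
        ?E (\<lambda>l. \<Sum>k\<le>degree h. coeff h k * (\<Sum>j=1..N. l j ^ k * D j l))"
      by (subst Bochner_Integration.integral_sum) (use iB in \<open>auto intro!: integrable_mult_right simp only: integral_mult_right_zero\<close>)
    finally have main: "?E (\<lambda>l. 4 * (nu_integral N (poly p) l * \<Psi> l) - 1 / real N * (Q N l * \<Psi> l)) =
        1 / real N * ?E (\<lambda>l. \<Sum>j=1..N. poly h (l j) * D j l)"
      unfolding lhs rhs .
    have split: "?E (\<lambda>l. 4 * (nu_integral N (poly p) l * \<Psi> l) - 1 / real N * (Q N l * \<Psi> l)) =
        4 * ?E (\<lambda>l. nu_integral N (poly p) l * \<Psi> l) - 1 / real N * ?E (\<lambda>l. Q N l * \<Psi> l)"
      by (subst Bochner_Integration.integral_diff[OF integrable_mult_right[OF i1] integrable_mult_right[OF i2]])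
        (simp only: integral_mult_right_zero)
    have EQ: "?E (\<lambda>l. Q N l * \<Psi> l) = c N * ?E \<Psi> + 1 / real N * ?E (\<lambda>l. \<Sum>j=1..N. U N j l * D j l)"
      using U(3)[OF N] s by (simp add: stein_identity_def)
    have sum: "?E (\<lambda>l. \<Sum>j=1..N. (poly h (l j) + 1 / real N * U N j l) * D j l) =
        ?E (\<lambda>l. \<Sum>j=1..N. poly h (l j) * D j l) + 1 / real N * ?E (\<lambda>l. \<Sum>j=1..N. U N j l * D j l)"
    proof -
      have "(\<Sum>j=1..N. (poly h (l j) + 1 / real N * U N j l) * D j l) =
          (\<Sum>j=1..N. poly h (l j) * D j l) + 1 / real N * (\<Sum>j=1..N. U N j l * D j l)" for l
        by (simp only: sum_distrib_left distrib_right sum.distrib mult.assoc)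
      then show ?thesis using i3 i4
        by (simp only: integral_mult_right_zero Bochner_Integration.integral_add integrable_mult_right)
    qed
    have "4 * ?E (\<lambda>l. nu_integral N (poly p) l * \<Psi> l) =
        1 / real N * ?E (\<lambda>l. \<Sum>j=1..N. poly h (l j) * D j l) + 1 / real N * ?E (\<lambda>l. Q N l * \<Psi> l)"
      using split main by linarith
    then show ?thesis unfolding sum EQ by (simp only: distrib_left add.left_commute)
  qed
  with U(1,2) show ?thesis unfolding h_def by (rule that)
qed

text \<open>For a function of the statistic alone, the divergences in \<open>linear_statistic_stein\<close> pair with
  \<open>p'\<close> and form the Stein kernel \<open>\<tau>\<close>. Its leading term is \<open>\<integral> p' H p d\<mu>\<^sub>s\<^sub>c / (4 \<sigma>\<^sup>2) = 1\<close> by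
  \<open>Sigma_functional_poly\<close>, and the rest is \<open>1 / N\<close> times the admissible family \<open>B\<close>.\<close>

theorem normalized_law_W2_upper:
  assumes p: "degree p > 0"
  shows "\<exists>C\<ge>0. \<forall>N\<ge>1. W2 (normalized_law N (poly p)) std_gaussian \<le> ennreal (C / real N)"
proof -
  define h where "h = difference_quotient arcsine_moment p"
  define \<sigma> where "\<sigma> = sqrt (Sigma_functional (poly p))"
  have \<sigma>: "\<sigma> > 0" using Sigma_functional_pos[OF p] by (simp add: \<sigma>_def)
  have \<sigma>2: "4 * \<sigma>\<^sup>2 = moment_functional sc_moment (h * pderiv p)"
    using \<sigma> Sigma_functional_pos[OF p] by (simp add: \<sigma>_def Sigma_functional_poly h_def)
  obtain c C U where U: "\<And>N. \<bar>c N :: real\<bar> \<le> C" "vector_field U"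
    and stein: "\<And>N \<Psi> D. N \<ge> 1 \<Longrightarrow> smooth N \<Psi> D \<Longrightarrow>
      4 * (\<integral>l. nu_integral N (poly p) l * \<Psi> l \<partial>gue_eigenvalues N) =
      1 / real N * (c N * (\<integral>l. \<Psi> l \<partial>gue_eigenvalues N)
       + (\<integral>l. (\<Sum>j=1..N. (poly h (l j) + 1 / real N * U N j l) * D j l) \<partial>gue_eigenvalues N))"
    by (rule linear_statistic_stein[of p, folded h_def]) blast
  obtain d where d: "admissible d (\<lambda>N l. 1 / real N * (\<Sum>j=1..N. U N j l * poly (pderiv p) (l j)))"
    using vector_field_pairing[OF U(2)] by blast
  let ?e = "max (degree (h * pderiv p)) d"
  \<comment> \<open>The Stein kernel below is \<open>1 + B N l / N\<close>.\<close>
  define B where "B N l = 1 / (4 * \<sigma>\<^sup>2) * (nu_integral N (poly (h * pderiv p)) l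
      + 1 / real N * (\<Sum>j=1..N. U N j l * poly (pderiv p) (l j)))" for N l
  have B: "admissible ?e B"
    unfolding B_def[abs_def]
    by (intro admissible_cmult admissible.add admissible_mono[OF admissible_nu_integral] admissible_mono[OF d]) auto
  obtain K where K: "\<And>N. N \<ge> 1 \<Longrightarrow> \<bar>\<integral>l. B N l * B N l \<partial>gue_eigenvalues N\<bar> \<le> K"
    using admissible_moment_bounded[OF admissible_mult[OF B B]] by blast
  let ?C = "sqrt (3 * (K + (C / (4 * \<sigma>))\<^sup>2))"
  have "W2 (normalized_law N (poly p)) std_gaussian \<le> ennreal (?C / real N)" if N: "N \<ge> 1" for N
  proof -
    define X where "X l = 1 / \<sigma> * nu_integral N (poly p) l" for l
    define \<tau> where "\<tau> l = 1 + 1 / real N * B N l" for l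
    define m where "m = c N / (4 * \<sigma> * real N)"
    have sX: "smooth N X (\<lambda>j l. 1 / \<sigma> * poly (pderiv p) (l j))"
      unfolding X_def[abs_def] by (rule smooth_cmult[OF smooth_nu_integral])
    have gB: "poly_growth N (B N)" by (rule admissible_growth[OF B N])
    have gX: "poly_growth N X" by (rule smooth_growth[OF sX])
    have g\<tau>: "poly_growth N \<tau>" unfolding \<tau>_def[abs_def] by (intro growth_intros gB)
    have \<tau>_eq: "1 / real N * (\<Sum>j=1..N. (poly h (l j) + 1 / real N * U N j l) * poly (pderiv p) (l j))
        = 4 * \<sigma>\<^sup>2 * \<tau> l" for l
    proof -
      have "(\<Sum>j=1..N. poly h (l j) * poly (pderiv p) (l j)) =
          nu_integral N (poly (h * pderiv p)) l + real N * (4 * \<sigma>\<^sup>2)"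
        unfolding nu_integral_def integral_mu_sc_poly \<sigma>2 by simp
      moreover have "(\<Sum>j=1..N. (poly h (l j) + 1 / real N * U N j l) * poly (pderiv p) (l j)) =
          (\<Sum>j=1..N. poly h (l j) * poly (pderiv p) (l j)) + 1 / real N * (\<Sum>j=1..N. U N j l * poly (pderiv p) (l j))"
        by (simp only: distrib_right sum.distrib sum_distrib_left mult.assoc)
      moreover have "1 / n * ((v + n * (4 * s)) + w) = 4 * s * (1 + 1 / n * (1 / (4 * s) * (v + w)))"
        if "n \<noteq> 0" "s \<noteq> 0" for n v s w :: real
        using that by (simp add: field_simps)
      ultimately show ?thesis
        using N \<sigma> unfolding \<tau>_def B_def by simp
    qed
    have "W2 (distr (gue_eigenvalues N) borel X) std_gaussian \<le>
        ennreal (sqrt (3 * ((\<integral>l. (\<tau> l - 1)\<^sup>2 \<partial>gue_eigenvalues N) + m\<^sup>2)))"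
    proof (rule W2_le_stein_discrepancy[OF prob_space_gue[OF N]])
      show "X \<in> borel_measurable (gue_eigenvalues N)" "\<tau> \<in> borel_measurable (gue_eigenvalues N)"
        using poly_growth_measurable[OF gX] poly_growth_measurable[OF g\<tau>] by (simp_all cong: measurable_cong_sets)
      show "integrable (gue_eigenvalues N) (\<lambda>l. (X l)\<^sup>2)" "integrable (gue_eigenvalues N) (\<lambda>l. (\<tau> l)\<^sup>2)"
        by (intro gue_integral(1)[OF N] growth_intros gX g\<tau>)+
      fix \<phi> \<phi>' :: "real \<Rightarrow> real" and K
      assume \<phi>: "\<And>x. (\<phi> has_real_derivative \<phi>' x) (at x)" "continuous_on UNIV \<phi>'" "\<And>x. \<bar>\<phi>' x\<bar> \<le> K"
      let ?E = "\<lambda>f. \<integral>l. f l \<partial>gue_eigenvalues N"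
      note s = smooth_comp[OF sX \<phi>]
      have i1: "integrable (gue_eigenvalues N) (\<lambda>l. nu_integral N (poly p) l * \<phi> (X l))"
        by (intro gue_integral(1)[OF N] growth_intros smooth_growth[OF s] smooth_growth[OF smooth_nu_integral])
      have i2: "integrable (gue_eigenvalues N) (\<lambda>l. \<phi> (X l))"
        by (intro gue_integral(1)[OF N] smooth_growth[OF s])
      have "1 / real N * ?E (\<lambda>l. \<Sum>j=1..N. (poly h (l j) + 1 / real N * U N j l) * (\<phi>' (X l) * (1 / \<sigma> * poly (pderiv p) (l j))))
          = ?E (\<lambda>l. 4 * \<sigma> * (\<tau> l * \<phi>' (X l)))"
      proof -
        have "1 / real N * (\<Sum>j=1..N. (poly h (l j) + 1 / real N * U N j l) * (\<phi>' (X l) * (1 / \<sigma> * poly (pderiv p) (l j))))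
            = 4 * \<sigma> * (\<tau> l * \<phi>' (X l))" for l
        proof -
          have "1 / real N * (\<Sum>j=1..N. (poly h (l j) + 1 / real N * U N j l) * (\<phi>' (X l) * (1 / \<sigma> * poly (pderiv p) (l j))))
            = \<phi>' (X l) / \<sigma> * (1 / real N * (\<Sum>j=1..N. (poly h (l j) + 1 / real N * U N j l) * poly (pderiv p) (l j)))"
            by (simp add: sum_distrib_left sum_divide_distrib algebra_simps)
          then show ?thesis unfolding \<tau>_eq using \<sigma> by (simp add: power2_eq_square)
        qed
        then show ?thesis by (simp only: integral_mult_right_zero[symmetric])
      qed
      then have "4 * ?E (\<lambda>l. nu_integral N (poly p) l * \<phi> (X l)) =
          c N / real N * ?E (\<lambda>l. \<phi> (X l)) + 4 * \<sigma> * ?E (\<lambda>l. \<tau> l * \<phi>' (X l))"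
        using stein[OF N s] by (simp add: distrib_left)
      moreover have "?E (\<lambda>l. (X l - m) * \<phi> (X l)) =
          1 / \<sigma> * ?E (\<lambda>l. nu_integral N (poly p) l * \<phi> (X l)) - m * ?E (\<lambda>l. \<phi> (X l))"
      proof -
        have "(X l - m) * \<phi> (X l) = 1 / \<sigma> * (nu_integral N (poly p) l * \<phi> (X l)) - m * \<phi> (X l)" for l
          by (simp add: X_def algebra_simps)
        then show ?thesis
          using Bochner_Integration.integral_diff[OF integrable_mult_right[OF i1, of "1 / \<sigma>"] integrable_mult_right[OF i2, of m]]
          by (simp only: integral_mult_right_zero)
      qed
      ultimately show "?E (\<lambda>l. (X l - m) * \<phi> (X l)) = ?E (\<lambda>l. \<tau> l * \<phi>' (X l))"
        using \<sigma> N by (simp add: m_def field_simps)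
    qed
    also have "distr (gue_eigenvalues N) borel X = normalized_law N (poly p)"
      by (simp add: normalized_law_def X_def[abs_def] \<sigma>_def)
    also have "sqrt (3 * ((\<integral>l. (\<tau> l - 1)\<^sup>2 \<partial>gue_eigenvalues N) + m\<^sup>2)) \<le> ?C / real N"
    proof -
      have "(\<tau> l - 1)\<^sup>2 = (1 / real N)\<^sup>2 * (B N l * B N l)" for l
        by (simp add: \<tau>_def power2_eq_square)
      then have "(\<integral>l. (\<tau> l - 1)\<^sup>2 \<partial>gue_eigenvalues N) = (1 / real N)\<^sup>2 * (\<integral>l. B N l * B N l \<partial>gue_eigenvalues N)"
        by (simp only: integral_mult_right_zero)
      also have "\<dots> \<le> (1 / real N)\<^sup>2 * K" using K[OF N] by (intro mult_left_mono) auto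
      finally have 1: "(\<integral>l. (\<tau> l - 1)\<^sup>2 \<partial>gue_eigenvalues N) \<le> (1 / real N)\<^sup>2 * K" .
      have "m = (1 / real N) * (c N / (4 * \<sigma>))" by (simp add: m_def)
      then have "m\<^sup>2 = (1 / real N)\<^sup>2 * (c N / (4 * \<sigma>))\<^sup>2" by (simp only: power_mult_distrib)
      also have "\<dots> \<le> (1 / real N)\<^sup>2 * (C / (4 * \<sigma>))\<^sup>2"
        using U(1)[of N] \<sigma> by (intro mult_left_mono) (auto simp: power_divide intro!: divide_right_mono power2_le_iff_abs_le[THEN iffD2] abs_le_square_iff[THEN iffD1])
      finally have 2: "m\<^sup>2 \<le> (1 / real N)\<^sup>2 * (C / (4 * \<sigma>))\<^sup>2" .
      have "3 * ((\<integral>l. (\<tau> l - 1)\<^sup>2 \<partial>gue_eigenvalues N) + m\<^sup>2) \<le> (1 / real N)\<^sup>2 * (3 * (K + (C / (4 * \<sigma>))\<^sup>2))"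
        using 1 2 by (simp add: distrib_left)
      then have "sqrt (3 * ((\<integral>l. (\<tau> l - 1)\<^sup>2 \<partial>gue_eigenvalues N) + m\<^sup>2)) \<le>
          sqrt ((1 / real N)\<^sup>2 * (3 * (K + (C / (4 * \<sigma>))\<^sup>2)))" by (rule real_sqrt_le_mono)
      then show ?thesis by (simp add: real_sqrt_mult real_sqrt_divide power_divide)
    qed
    finally show ?thesis by (auto simp: ennreal_leI)
  qed
  moreover have "K \<ge> 0" using K[of 1] by linarith
  ultimately show ?thesis by (intro exI[of _ ?C]) auto
qed

section \<open>Sharpness for the quadratic statistic\<close>

lemma ennreal_sqrt_ge:
  assumes "ennreal a \<le> x" "0 \<le> a"
  shows "ennreal (sqrt a) \<le> ennreal_sqrt x"
proof (cases "x = \<top>")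
  case False
  then have "a \<le> enn2real x" using enn2real_mono[OF assms(1)] assms(2) by (simp add: less_top)
  then show ?thesis using False by (simp add: ennreal_sqrt_def ennreal_leI)
qed (simp add: ennreal_sqrt_def)

text \<open>Young's inequality for \<open>x ^ 3 - y ^ 3 = (x - y) (x\<^sup>2 + x y + y\<^sup>2)\<close>.\<close>

lemma cubic_difference_bound:
  fixes x y t :: real
  assumes t: "t > 0"
  shows "x ^ 3 - y ^ 3 \<le> t / 2 * (x - y)\<^sup>2 + 9 / (4 * t) * (x ^ 4 + y ^ 4)"
proof -
  define q where "q = x\<^sup>2 + x * y + y\<^sup>2"
  have "x ^ 3 - y ^ 3 = (x - y) * q" by (simp add: q_def algebra_simps power2_eq_square power3_eq_cube)
  also have "\<dots> \<le> t / 2 * (x - y)\<^sup>2 + 1 / (2 * t) * q\<^sup>2"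
  proof -
    have "0 \<le> (t * (x - y) - q)\<^sup>2 / (2 * t)" using t by simp
    also have "\<dots> = t / 2 * (x - y)\<^sup>2 + 1 / (2 * t) * q\<^sup>2 - (x - y) * q"
      using t by (simp add: power2_eq_square field_simps)
    finally show ?thesis by simp
  qed
  also have "q\<^sup>2 \<le> 9 / 2 * (x ^ 4 + y ^ 4)"
  proof -
    have "\<bar>q\<bar> \<le> 3 / 2 * (x\<^sup>2 + y\<^sup>2)"
    proof -
      have "0 \<le> (x - y)\<^sup>2" "0 \<le> (x + y)\<^sup>2" by simp_all
      then have "2 * (x * y) \<le> x\<^sup>2 + y\<^sup>2" "- (2 * (x * y)) \<le> x\<^sup>2 + y\<^sup>2"
        by (simp_all add: power2_diff power2_sum)
      moreover have "\<bar>u + w + v\<bar> \<le> 3 / 2 * (u + v)"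
        if "2 * w \<le> u + v" "- (2 * w) \<le> u + v" "0 \<le> u" "0 \<le> v" for u v w :: real
      proof -
        have "u + w + v \<le> 3 / 2 * (u + v)" "0 \<le> u + w + v" "0 \<le> 3 / 2 * (u + v)"
          using that by (simp_all add: field_simps)
        then show ?thesis by simp
      qed
      ultimately show ?thesis unfolding q_def by simp
    qed
    then have "\<bar>q\<bar>\<^sup>2 \<le> (3 / 2 * (x\<^sup>2 + y\<^sup>2))\<^sup>2" by (intro power_mono) auto
    also have "\<dots> = 9 / 2 * (x ^ 4 + y ^ 4) - (3 / 2 * (x\<^sup>2 - y\<^sup>2))\<^sup>2"
      by (simp add: power2_eq_square eval_nat_numeral field_simps)
    also have "\<dots> \<le> 9 / 2 * (x ^ 4 + y ^ 4)"
      using zero_le_power2[of "3 / 2 * (x\<^sup>2 - y\<^sup>2)"] by linarith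
    finally show ?thesis by simp
  qed
  then have "1 / (2 * t) * q\<^sup>2 \<le> 1 / (2 * t) * (9 / 2 * (x ^ 4 + y ^ 4))"
    using t by (intro mult_left_mono) auto
  finally show ?thesis using t by (simp add: field_simps)
qed

text \<open>Integrating \<open>cubic_difference_bound\<close> over a coupling compares the third moments with the
  transport cost.\<close>

lemma W2_third_moment_lower:
  assumes sets: "sets \<mu> = sets (borel :: real measure)"
    and i3: "integrable \<mu> (\<lambda>x. x ^ 3)" and i4: "integrable \<mu> (\<lambda>x. x ^ 4)"
    and a: "a = (\<integral>x. x ^ 3 \<partial>\<mu>)" "a > 0" and m4: "(\<integral>x. x ^ 4 \<partial>\<mu>) \<le> 15"
  shows "ennreal (a / 9) \<le> W2 \<mu> std_gaussian"
proof -
  have "ennreal (a\<^sup>2 / 81) \<le> (\<integral>\<^sup>+(x, y). ennreal ((x - y)\<^sup>2) \<partial>\<pi>)"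
    if \<pi>: "\<pi> \<in> couplings \<mu> std_gaussian" for \<pi>
  proof -
    have sp: "sets \<pi> = sets (\<mu> \<Otimes>\<^sub>M std_gaussian)" and d1: "distr \<pi> \<mu> fst = \<mu>"
      and d2: "distr \<pi> std_gaussian snd = std_gaussian"
      using \<pi> by (auto simp: couplings_def)
    note [measurable_cong] = sp sets
    have [measurable]: "fst \<in> measurable \<pi> \<mu>" "snd \<in> measurable \<pi> std_gaussian"
      by (simp_all cong: measurable_cong_sets add: sp)
    have f: "fst \<in> borel_measurable \<pi>" and s: "snd \<in> borel_measurable \<pi>"
      using \<open>fst \<in> measurable \<pi> \<mu>\<close> \<open>snd \<in> measurable \<pi> std_gaussian\<close> sets
      by (simp_all cong: measurable_cong_sets)
    note [measurable] = f s
    have fst_int: "integrable \<pi> (\<lambda>v. g (fst v))" "(\<integral>v. g (fst v) \<partial>\<pi>) = integral\<^sup>L \<mu> g"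
      if "integrable \<mu> g" for g :: "real \<Rightarrow> real"
      using that integrable_distr_eq[of fst \<pi> \<mu> g] integral_distr[of fst \<pi> \<mu> g] by (auto simp: d1)
    have snd_int: "integrable \<pi> (\<lambda>v. g (snd v))" "(\<integral>v. g (snd v) \<partial>\<pi>) = integral\<^sup>L std_gaussian g"
      if "integrable std_gaussian g" for g :: "real \<Rightarrow> real"
      using that integrable_distr_eq[of snd \<pi> std_gaussian g] integral_distr[of snd \<pi> std_gaussian g]
      by (auto simp: d2)
    note g3 = snd_int[OF std_gaussian_moment_integrable[of 3], unfolded std_gaussian_moments]
    note g4 = snd_int[OF std_gaussian_moment_integrable[of 4], unfolded std_gaussian_moments]
    show ?thesis
    proof (cases "(\<integral>\<^sup>+(x, y). ennreal ((x - y)\<^sup>2) \<partial>\<pi>) = \<infinity>")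
      case False
      have fin: "(\<integral>\<^sup>+v. ennreal ((fst v - snd v)\<^sup>2) \<partial>\<pi>) < \<infinity>"
        using False by (simp add: split_beta' less_top)
      have i2: "integrable \<pi> (\<lambda>v. (fst v - snd v)\<^sup>2)"
        by (rule integrableI_nonneg) (use fin in auto)
      define c where "c = (\<integral>v. (fst v - snd v)\<^sup>2 \<partial>\<pi>)"
      have c: "(\<integral>\<^sup>+(x, y). ennreal ((x - y)\<^sup>2) \<partial>\<pi>) = ennreal c"
        unfolding c_def using nn_integral_eq_integral[OF i2] by (simp add: split_beta')
      \<comment> \<open>With this \<open>t\<close> the fourth moments account for at most half of \<open>a\<close>.\<close>
      define t where "t = 81 / a"
      have t: "t > 0" using a by (simp add: t_def)
      have "a = (\<integral>v. fst v ^ 3 - snd v ^ 3 \<partial>\<pi>)"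
        using fst_int[OF i3] g3 a by simp
      also have "\<dots> \<le> (\<integral>v. t / 2 * (fst v - snd v)\<^sup>2 + 9 / (4 * t) * (fst v ^ 4 + snd v ^ 4) \<partial>\<pi>)"
        using fst_int(1)[OF i3] fst_int(1)[OF i4] g3(1) g4(1) i2 cubic_difference_bound[OF t]
        by (intro Bochner_Integration.integral_mono) auto
      also have "\<dots> = t / 2 * c + 9 / (4 * t) * ((\<integral>x. x ^ 4 \<partial>\<mu>) + 3)"
        using fst_int[OF i4] g4 i2 by (simp add: c_def)
      also have "\<dots> \<le> t / 2 * c + 9 / (4 * t) * (15 + 3)"
        using m4 t by (intro add_left_mono mult_left_mono) auto
      also have "\<dots> = 81 / (2 * a) * c + a / 2" using a by (simp add: t_def field_simps)
      finally have "a / 2 \<le> 81 / (2 * a) * c" by simp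
      then have "a\<^sup>2 / 81 \<le> c" using a by (simp add: field_simps power2_eq_square)
      then show ?thesis unfolding c by (rule ennreal_leI)
    qed simp
  qed
  then have "ennreal (a\<^sup>2 / 81) \<le> (INF \<pi>\<in>couplings \<mu> std_gaussian. \<integral>\<^sup>+(x, y). ennreal ((x - y)\<^sup>2) \<partial>\<pi>)"
    by (intro INF_greatest)
  from ennreal_sqrt_ge[OF this] show ?thesis
    using a by (simp add: W2_def real_sqrt_divide)
qed

lemma smooth_power_fun:
  assumes "smooth N f D"
  shows "smooth N (\<lambda>l. f l ^ r) (\<lambda>j l. real r * f l ^ (r - 1) * D j l)"
proof (induction r)
  case 0 then show ?case using smooth_const[of N 1] by simp
next
  case (Suc r)
  have "D j l * f l ^ r + f l * (real r * f l ^ (r - 1) * D j l) = real (Suc r) * f l ^ (Suc r - 1) * D j l" for j l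
    by (cases r) (simp_all add: algebra_simps)
  then show ?case using smooth_mult[OF assms Suc] by simp
qed

text \<open>For \<open>k = 1\<close> the loop equation involves \<open>\<nu>\<^sub>2\<close> only, because \<open>\<nu>\<^sub>0 = 0\<close> and the second power sum is
  \<open>N / 4 + \<nu>\<^sub>2\<close>. Testing with powers of \<open>\<nu>\<^sub>2\<close> gives a recursion for its moments.\<close>

lemma trace_square_moments:
  assumes N: "N \<ge> 1"
  defines "M \<equiv> \<lambda>r. \<integral>l. centred_power_sum N 2 l ^ r \<partial>gue_eigenvalues N"
  shows "M 3 = 1 / (8 * real N)" and "M 4 \<le> 15 / 64"
proof -
  interpret prob_space "gue_eigenvalues N" by (rule prob_space_gue[OF N])
  let ?\<nu> = "centred_power_sum N 2"
  have i: "integrable (gue_eigenvalues N) (\<lambda>l. ?\<nu> l ^ r)" for r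
    by (intro gue_integral(1)[OF N] growth_intros centred_power_sum_growth)
  have rec: "M (r + 1) = real r / 2 * (M (r - 1) / 4 + M r / real N)" for r
  proof -
    note s = smooth_power_fun[OF smooth_centred_power_sum[of N 2], of r]
    have "(\<Sum>j=1..N. l j ^ 1 * (real r * ?\<nu> l ^ (r - 1) * (real 2 * l j ^ (2 - 1)))) =
        real N * (2 * (real r * (?\<nu> l ^ (r - 1) / 4 + ?\<nu> l ^ r / real N)))" for l
    proof -
      have "(\<Sum>j=1..N. l j ^ 1 * (real r * ?\<nu> l ^ (r - 1) * (real 2 * l j ^ (2 - 1)))) =
          real r * ?\<nu> l ^ (r - 1) * 2 * power_sum N 2 l"
        by (simp add: power_sum_def sum_distrib_left sum_distrib_right power2_eq_square mult_ac)
      also have "power_sum N 2 l = real N / 4 + ?\<nu> l"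
        by (simp add: centred_power_sum_def sc_moment_2)
      finally show ?thesis using N by (cases r) (simp_all add: field_simps)
    qed
    then have "(\<integral>l. 4 * ?\<nu> l * ?\<nu> l ^ r \<partial>gue_eigenvalues N) =
        1 / real N * (\<integral>l. real N * (2 * (real r * (?\<nu> l ^ (r - 1) / 4 + ?\<nu> l ^ r / real N))) \<partial>gue_eigenvalues N)"
      using loop_equation[OF N s, of 1] by (simp add: numeral_2_eq_2)
    also have "\<dots> = 2 * (real r * (M (r - 1) / 4 + M r / real N))"
      using i N by (simp add: M_def)
    finally show ?thesis using i by (simp add: M_def mult.assoc)
  qed
  have M0: "M 0 = 1" by (simp add: M_def prob_space)
  have M1: "M 1 = 0" using rec[of 0] by simp
  have M2: "M 2 = 1 / 8" using rec[of 1] M0 M1 by (simp add: numeral_2_eq_2)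
  show M3: "M 3 = 1 / (8 * real N)" using rec[of 2] M1 M2 by simp
  have "M 4 = 3 / 64 + 3 / (16 * (real N)\<^sup>2)"
    using rec[of 3] M2 M3 by (simp add: power2_eq_square)
  also have "3 / (16 * (real N)\<^sup>2) \<le> 3 / 16"
    using N by (intro divide_left_mono) auto
  finally show "M 4 \<le> 15 / 64" by simp
qed

lemma square_poly: "(\<lambda>x::real. x\<^sup>2) = poly [:0, 0, 1:]"
  by (simp add: fun_eq_iff power2_eq_square)

lemma Sigma_functional_square: "Sigma_functional (\<lambda>x. x\<^sup>2) = 1 / 8"
  unfolding square_poly Sigma_functional_poly
  by (simp add: difference_quotient_pCons moment_functional_pCons pderiv_pCons sc_moment_2[unfolded numeral_2_eq_2])

lemma normalized_law_square_lower:
  assumes N: "N \<ge> 1"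
  shows "ennreal (sqrt 8 / 9 / real N) \<le> W2 (normalized_law N (\<lambda>x. x\<^sup>2)) std_gaussian"
proof -
  let ?\<nu> = "centred_power_sum N 2" and ?\<mu> = "normalized_law N (\<lambda>x. x\<^sup>2)"
  define X where "X l = sqrt 8 * ?\<nu> l" for l
  have law: "?\<mu> = distr (gue_eigenvalues N) borel X"
  proof -
    have "1 / sqrt (Sigma_functional (\<lambda>x. x\<^sup>2)) = sqrt 8"
      unfolding Sigma_functional_square by (simp add: real_sqrt_divide)
    moreover have "nu_integral N (\<lambda>x. x\<^sup>2) l = ?\<nu> l" for l
      unfolding square_poly nu_integral_poly by (simp add: moment_functional_pCons numeral_2_eq_2)
    ultimately show ?thesis by (simp add: normalized_law_def X_def[abs_def])
  qed
  have g: "poly_growth N X" unfolding X_def[abs_def] by (intro growth_intros centred_power_sum_growth)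
  have X: "X \<in> borel_measurable (gue_eigenvalues N)"
    using poly_growth_measurable[OF g] by (simp cong: measurable_cong_sets)
  have i: "integrable ?\<mu> (\<lambda>x. x ^ k)" for k
    unfolding law using gue_integral(1)[OF N poly_growth_power[OF g]] X by (simp add: integrable_distr_eq)
  have m: "(\<integral>x. x ^ k \<partial>?\<mu>) = sqrt 8 ^ k * (\<integral>l. ?\<nu> l ^ k \<partial>gue_eigenvalues N)" for k
    unfolding law using X by (simp add: integral_distr) (simp add: X_def power_mult_distrib)
  have "sqrt 8 ^ 3 = 8 * sqrt (8::real)" by (simp add: power3_eq_cube)
  then have m3: "(\<integral>x. x ^ 3 \<partial>?\<mu>) = sqrt 8 / real N"
    unfolding m trace_square_moments(1)[OF N] by simp
  have "sqrt 8 ^ 4 = ((sqrt 8)\<^sup>2)\<^sup>2" by (simp only: power_mult[symmetric]) simp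
  then have s4: "sqrt 8 ^ 4 = (64 :: real)" by simp
  have m4: "(\<integral>x. x ^ 4 \<partial>?\<mu>) \<le> 15"
    unfolding m s4 using trace_square_moments(2)[OF N] by simp
  have "ennreal (sqrt 8 / real N / 9) \<le> W2 ?\<mu> std_gaussian"
    by (rule W2_third_moment_lower[OF _ i i m3[symmetric] _ m4]) (use N in \<open>auto simp: law\<close>)
  then show ?thesis by (simp add: mult.commute)
qed

theorem theorem1p4:
  shows "(\<forall>p :: real poly. degree p > 0 \<longrightarrow>
            (\<exists>C::real. C \<ge> 0 \<and> (\<forall>N\<ge>1. W2 (normalized_law N (poly p)) std_gaussian \<le> ennreal (C / real N))))
       \<and> (\<exists>c C :: real. 0 < c \<and> c \<le> C \<and>
            (\<forall>N\<ge>1. ennreal (c / real N) \<le> W2 (normalized_law N (\<lambda>x. x\<^sup>2)) std_gaussian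
                 \<and> W2 (normalized_law N (\<lambda>x. x\<^sup>2)) std_gaussian \<le> ennreal (C / real N)))"
proof (intro conjI allI impI)
  fix p :: "real poly"
  assume "degree p > 0"
  then show "\<exists>C::real. C \<ge> 0 \<and> (\<forall>N\<ge>1. W2 (normalized_law N (poly p)) std_gaussian \<le> ennreal (C / real N))"
    by (rule normalized_law_W2_upper)
next
  obtain C where C: "\<And>N. N \<ge> 1 \<Longrightarrow> W2 (normalized_law N (\<lambda>x. x\<^sup>2)) std_gaussian \<le> ennreal (C / real N)"
    using normalized_law_W2_upper[of "[:0, 0, 1:]"] unfolding square_poly by auto
  let ?c = "sqrt 8 / 9" and ?C = "max C (sqrt 8 / 9)"
  have "ennreal (C / real N) \<le> ennreal (?C / real N)" for N
    by (intro ennreal_leI divide_right_mono) auto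
  then have "W2 (normalized_law N (\<lambda>x. x\<^sup>2)) std_gaussian \<le> ennreal (?C / real N)" if "N \<ge> 1" for N
    using C[OF that] order_trans by blast
  then show "\<exists>c C :: real. 0 < c \<and> c \<le> C \<and>
            (\<forall>N\<ge>1. ennreal (c / real N) \<le> W2 (normalized_law N (\<lambda>x. x\<^sup>2)) std_gaussian
                 \<and> W2 (normalized_law N (\<lambda>x. x\<^sup>2)) std_gaussian \<le> ennreal (C / real N))"
    using normalized_law_square_lower by (intro exI[of _ ?c] exI[of _ ?C]) auto
qed

end
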